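(* For every closed $\mathsf{FSO}$-formula $\varphi$, we have $\mathsf{MSO}\vdash[\![\varphi]\!]$ whenever $\mathsf{FSO}\vdash\varphi$.
   Context: Fix a finite non-empty HF-set $\mathcal D$ of tree directions. $\mathsf{MSO}=\mathsf{MSO}_{\mathcal D}$: two-sorted logic with Individuals ($\mathrm{Root}$, successors $\mathrm S_d$, $=$, $<$) and monadic Predicates, with tree axioms, equality, comprehension scheme and induction axiom. $\mathsf{FSO}=\mathsf{FSO}_{\mathcal D}$: same Individuals, plus a sort of hereditarily finite sets (over $V_\omega$, constants $\dot\kappa$ for $\kappa\in V_\omega$, HF-Function constants $\mathsf g_{n,m}$, only bounded quantification $\exists k\in L$, $\exists k\subseteq L$) and Function variables $F:K$ (maps from tree positions into HF-set $K$), with atoms $t=u,t<u,K=L,K\in L,K\subseteq L,F(t)=K$; axioms: equality, tree axioms, induction scheme, axioms on HF-sets ($\mathsf g_{n,m}$ Skolem functions for $\forall\exists!$ statements provable in Skolemized $\mathsf{ZFC}$ without infinity), and Functional Choice Axioms (HF-Bounded Choice for HF-sets, HF-Bounded Choice for Functions, Iterated HF-Bounded Choice $(\forall k\in K)(\exists F:L)\varphi(k,F)\to(\exists G:L^K)(\forall k\in K)\varphi(k,F)[G(k)/\!/F]$, where $[G(k)/\!/F]$ replaces each atom $F(t)=M$ by $(\exists f\in L^K)(G(t)=f\land f(k)=M)$). The translation $[\![-]\!]$ maps HF-closed $\mathsf{FSO}$-formulae without free Function variables to $\mathsf{MSO}$-formulae: $[\![K\,\triangleleft\,L]\!]$ is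 $\top$ or $\bot$ according to whether the standard values satisfy $[\![K]\!]\triangleleft[\![L]\!]$ in $V_\omega$; $[\![t\triangleleft u]\!]=t\triangleleft u$; it commutes with $\lnot,\lor,\exists x$; $[\![(\exists k\triangleleft K)\varphi]\!]=\bigvee_{\kappa\triangleleft [\![K]\!]}[\![\varphi[\kappa/k]]\!]$; and $[\![(\exists F:K)\varphi]\!]=(\exists X_1)\dots(\exists X_c)(\mathrm{Part}_c(X_1,\dots,X_c)\land[\![\varphi']\!])$ where $[\![K]\!]=\{\kappa_1,\dots,\kappa_c\}$, $\mathrm{Part}_c$ says $X_1,\dots,X_c$ partition the tree, and each atom $F(t)=L$ of $\varphi$ is interpreted as $\bigvee_{i:\kappa_i=[\![L]\!]}X_i(t)$. *)

theory Defs
  imports Main "HOL-Library.FSet"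
begin

text \<open>
  All syntax is in de Bruijn form, with an independent namespace of indices for each sort
  (Individuals, HF-sets, Functions, Predicates).  A binder captures index 0 of its own sort only.
  Universal quantifiers and the connectives other than negation and disjunction are derived.
\<close>

section \<open>Hereditarily finite sets\<close>

text \<open>The initial algebra of the finite powerset functor, i.e.\ the set \<open>V\<^sub>\<omega>\<close>.\<close>

datatype hf = HF (elts: "hf fset")

abbreviation hempty :: hf where
  "hempty \<equiv> HF {||}"

text \<open>Some repetition-free enumeration of a finite set; the translation of FSO into MSO and
  some axioms list the elements of a set in an order that is immaterial.\<close>

definition enumeration :: "'a set \<Rightarrow> 'a list" where
  "enumeration A = (SOME xs. distinct xs \<and> set xs = A)"

definition members :: "hf \<Rightarrow> hf list" where
  "members \<kappa> = enumeration {l. l |\<in>| elts \<kappa>}"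

definition subsets :: "hf \<Rightarrow> hf list" where
  "subsets \<kappa> = enumeration {l. elts l |\<subseteq>| elts \<kappa>}"


section \<open>HF-terms and the language of set theory\<close>

text \<open>
  The HF-Function symbol \<open>g\<^sub>n\<^sub>,\<^sub>m\<close>, Skolem function of the \<open>m\<close>-th provable statement
  \<open>\<forall>k\<^sub>1\<dots>k\<^sub>n \<exists>!l. \<phi>(k\<^sub>1,\<dots>,k\<^sub>n,l)\<close>, is represented by the formula \<open>\<phi>\<close> itself instead of by an
  index in an enumeration: \<open>HFun \<phi> [K\<^sub>1,\<dots>,K\<^sub>n]\<close> is the application to \<open>K\<^sub>1,\<dots>,K\<^sub>n\<close> of the symbol
  with arity \<open>n\<close> and defining formula \<open>\<phi>\<close>.  In \<open>\<phi>\<close>, index 0 is \<open>l\<close> and index \<open>i\<close> is \<open>k\<^sub>i\<close>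
  (\<open>1 \<le> i \<le> n\<close>).  The formula \<open>\<phi>\<close> is part of the name of the symbol: substitutions do not act on
  it.  That the statement is provable is required by \<open>sk_term\<close> below.
\<close>

datatype hft =
    HVar nat
  | HConst hf
  | HFun sfm "hft list"
and sfm =
    SEq hft hft
  | SMem hft hft
  | SNeg sfm
  | SOr sfm sfm
  | SEx sfm

abbreviation "SAnd \<phi> \<psi> \<equiv> SNeg (SOr (SNeg \<phi>) (SNeg \<psi>))"
abbreviation "SImp \<phi> \<psi> \<equiv> SOr (SNeg \<phi>) \<psi>"
abbreviation "SIff \<phi> \<psi> \<equiv> SAnd (SImp \<phi> \<psi>) (SImp \<psi> \<phi>)"
abbreviation "SAll \<phi> \<equiv> SNeg (SEx (SNeg \<phi>))"
abbreviation "SFalse \<equiv> SNeg (SEq (HConst hempty) (HConst hempty))"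

text \<open>Simultaneous substitution.\<close>

primrec hsub :: "(nat \<Rightarrow> hft) \<Rightarrow> hft \<Rightarrow> hft" where
  "hsub \<tau> (HVar i) = \<tau> i"
| "hsub \<tau> (HConst \<kappa>) = HConst \<kappa>"
| "hsub \<tau> (HFun \<phi> Ks) = HFun \<phi> (map (hsub \<tau>) Ks)"

abbreviation hshift :: "hft \<Rightarrow> hft" where
  "hshift \<equiv> hsub (\<lambda>i. HVar (Suc i))"

definition hlift :: "(nat \<Rightarrow> hft) \<Rightarrow> nat \<Rightarrow> hft" where
  "hlift \<tau> = case_nat (HVar 0) (\<lambda>i. hshift (\<tau> i))"

primrec ssub :: "(nat \<Rightarrow> hft) \<Rightarrow> sfm \<Rightarrow> sfm" where
  "ssub \<tau> (SEq K L) = SEq (hsub \<tau> K) (hsub \<tau> L)"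
| "ssub \<tau> (SMem K L) = SMem (hsub \<tau> K) (hsub \<tau> L)"
| "ssub \<tau> (SNeg \<phi>) = SNeg (ssub \<tau> \<phi>)"
| "ssub \<tau> (SOr \<phi> \<psi>) = SOr (ssub \<tau> \<phi>) (ssub \<tau> \<psi>)"
| "ssub \<tau> (SEx \<phi>) = SEx (ssub (hlift \<tau>) \<phi>)"

abbreviation sshift :: "sfm \<Rightarrow> sfm" where
  "sshift \<equiv> ssub (\<lambda>i. HVar (Suc i))"

text \<open>\<open>sinst K \<phi>\<close> is \<open>\<phi>[K/k]\<close>; \<open>sskip \<phi>\<close> inserts one new variable directly above index 0.\<close>

abbreviation sinst :: "hft \<Rightarrow> sfm \<Rightarrow> sfm" where
  "sinst K \<equiv> ssub (case_nat K HVar)"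

abbreviation sskip :: "sfm \<Rightarrow> sfm" where
  "sskip \<equiv> ssub (case_nat (HVar 0) (\<lambda>i. HVar (Suc (Suc i))))"

definition SEx1 :: "sfm \<Rightarrow> sfm" where
  "SEx1 \<phi> = SEx (SAnd \<phi> (SAll (SImp (sskip \<phi>) (SEq (HVar 0) (HVar (Suc 0))))))"

definition SSub :: "hft \<Rightarrow> hft \<Rightarrow> sfm" where
  "SSub K L = SAll (SImp (SMem (HVar 0) (hshift K)) (SMem (HVar 0) (hshift L)))"

text \<open>\<open>hbound n K\<close> and \<open>sbound n \<phi>\<close>: all free indices are less than \<open>n\<close>.\<close>

primrec hbound :: "nat \<Rightarrow> hft \<Rightarrow> bool" where
  "hbound n (HVar i) \<longleftrightarrow> i < n"
| "hbound n (HConst \<kappa>) \<longleftrightarrow> True"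
| "hbound n (HFun \<phi> Ks) \<longleftrightarrow> list_all (hbound n) Ks"

primrec sbound :: "nat \<Rightarrow> sfm \<Rightarrow> bool" where
  "sbound n (SEq K L) \<longleftrightarrow> hbound n K \<and> hbound n L"
| "sbound n (SMem K L) \<longleftrightarrow> hbound n K \<and> hbound n L"
| "sbound n (SNeg \<phi>) \<longleftrightarrow> sbound n \<phi>"
| "sbound n (SOr \<phi> \<psi>) \<longleftrightarrow> sbound n \<phi> \<and> sbound n \<psi>"
| "sbound n (SEx \<phi>) \<longleftrightarrow> sbound (Suc n) \<phi>"


section \<open>Skolemized ZFC without infinity\<close>

text \<open>Free variables of axioms are implicitly universally quantified.  The axioms on the constants
  say that the elements of \<open>\<kappa>\<close> are exactly the elements of the set \<open>\<kappa>\<close>.  In a Skolem axiom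
  \<open>\<forall>k\<^sub>1\<dots>k\<^sub>n. \<phi>(k\<^sub>1,\<dots>,k\<^sub>n,g(k\<^sub>1,\<dots>,k\<^sub>n))\<close> (rule \<open>sk_skolem\<close> below) the prefix binds \<open>k\<^sub>1\<close> innermost.\<close>

inductive zfc_axiom :: "sfm \<Rightarrow> bool" where
  eq_refl: "zfc_axiom (SEq K K)"
| eq_subst: "zfc_axiom (SImp (SEq K L) (SImp (sinst K \<phi>) (sinst L \<phi>)))"
| extensionality:
    "zfc_axiom (SImp (SAll (SIff (SMem (HVar 0) (hshift K)) (SMem (HVar 0) (hshift L)))) (SEq K L))"
| foundation:
    "zfc_axiom (SImp (SEx (SMem (HVar 0) (hshift K)))
       (SEx (SAnd (SMem (HVar 0) (hshift K))
          (SNeg (SEx (SAnd (SMem (HVar 0) (HVar 1)) (SMem (HVar 0) (hshift (hshift K)))))))))"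
| pairing:
    "zfc_axiom (SEx (SAll (SIff (SMem (HVar 0) (HVar 1))
       (SOr (SEq (HVar 0) (hshift (hshift K))) (SEq (HVar 0) (hshift (hshift L)))))))"
| union:
    "zfc_axiom (SEx (SAll (SIff (SMem (HVar 0) (HVar 1))
       (SEx (SAnd (SMem (HVar 0) (hshift (hshift (hshift K)))) (SMem (HVar 1) (HVar 0)))))))"
| powerset:
    "zfc_axiom (SEx (SAll (SIff (SMem (HVar 0) (HVar 1)) (SSub (HVar 0) (hshift (hshift K))))))"
| separation: \<comment> \<open>\<open>\<exists>c. \<forall>z. z \<in> c \<leftrightarrow> z \<in> K \<and> \<phi>(z)\<close>\<close>
    "zfc_axiom (SEx (SAll (SIff (SMem (HVar 0) (HVar 1))
       (SAnd (SMem (HVar 0) (hshift (hshift K))) (sskip \<phi>)))))"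
| replacement: \<comment> \<open>in \<open>\<phi>\<close>, index 0 is the value \<open>y\<close> and index 1 is the argument \<open>x \<in> K\<close>\<close>
    "zfc_axiom (SImp
       (SAll (SImp (SMem (HVar 0) (hshift K)) (SEx1 \<phi>)))
       (SEx (SAll (SIff (SMem (HVar 0) (HVar 1))
          (SEx (SAnd (SMem (HVar 0) (hshift (hshift (hshift K))))
             (ssub (case_nat (HVar 1) (case_nat (HVar 0) (\<lambda>i. HVar (i + 3)))) \<phi>)))))))"
| choice: \<comment> \<open>a family of non-empty, pairwise disjoint sets has a transversal\<close>
    "zfc_axiom (SImp
       (SAnd
         (SAll (SImp (SMem (HVar 0) (hshift K)) (SEx (SMem (HVar 0) (HVar 1)))))
         (SAll (SImp (SMem (HVar 0) (hshift K))
           (SAll (SImp (SMem (HVar 0) (hshift (hshift K)))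
             (SImp (SEx (SAnd (SMem (HVar 0) (HVar 1)) (SMem (HVar 0) (HVar 2))))
               (SEq (HVar 0) (HVar 1))))))))
       (SEx (SAll (SImp (SMem (HVar 0) (hshift (hshift K)))
         (SEx1 (SAnd (SMem (HVar 0) (HVar 1)) (SMem (HVar 0) (HVar 2))))))))"
| hf_constant:
    "zfc_axiom (SAll (SIff (SMem (HVar 0) (HConst \<kappa>))
       (foldr SOr (map (\<lambda>l. SEq (HVar 0) (HConst l)) (members \<kappa>)) SFalse)))"

text \<open>
  Mutually: the terms and formulae of the language, whose HF-Function symbols are exactly the Skolem
  functions of provable \<open>\<forall>\<exists>!\<close>-statements (which may themselves contain HF-Function symbols),
  and natural deduction.
\<close>

inductive sk_term :: "hft \<Rightarrow> bool"
  and sk_form :: "sfm \<Rightarrow> bool"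
  and sk_prov :: "sfm list \<Rightarrow> sfm \<Rightarrow> bool"
where
  "sk_term (HVar i)"
| "sk_term (HConst \<kappa>)"
| "sk_form \<phi> \<Longrightarrow> sbound (Suc (length Ks)) \<phi> \<Longrightarrow> sk_prov [] ((SAll ^^ length Ks) (SEx1 \<phi>)) \<Longrightarrow>
     (\<And>K. K \<in> set Ks \<Longrightarrow> sk_term K) \<Longrightarrow> sk_term (HFun \<phi> Ks)"
| "sk_term K \<Longrightarrow> sk_term L \<Longrightarrow> sk_form (SEq K L)"
| "sk_term K \<Longrightarrow> sk_term L \<Longrightarrow> sk_form (SMem K L)"
| "sk_form \<phi> \<Longrightarrow> sk_form (SNeg \<phi>)"
| "sk_form \<phi> \<Longrightarrow> sk_form \<psi> \<Longrightarrow> sk_form (SOr \<phi> \<psi>)"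
| "sk_form \<phi> \<Longrightarrow> sk_form (SEx \<phi>)"
| sk_assm: "\<phi> \<in> set \<Gamma> \<Longrightarrow> (\<And>\<gamma>. \<gamma> \<in> set \<Gamma> \<Longrightarrow> sk_form \<gamma>) \<Longrightarrow> sk_prov \<Gamma> \<phi>"
| sk_ax: "zfc_axiom \<phi> \<Longrightarrow> sk_form \<phi> \<Longrightarrow> (\<And>\<gamma>. \<gamma> \<in> set \<Gamma> \<Longrightarrow> sk_form \<gamma>) \<Longrightarrow> sk_prov \<Gamma> \<phi>"
| sk_skolem: "sk_form \<phi> \<Longrightarrow> sbound (Suc n) \<phi> \<Longrightarrow> sk_prov [] ((SAll ^^ n) (SEx1 \<phi>)) \<Longrightarrow>
     (\<And>\<gamma>. \<gamma> \<in> set \<Gamma> \<Longrightarrow> sk_form \<gamma>) \<Longrightarrow>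
     sk_prov \<Gamma> ((SAll ^^ n) (sinst (HFun \<phi> (map HVar [0..<n])) \<phi>))"
| sk_negI: "sk_prov (\<phi> # \<Gamma>) \<psi> \<Longrightarrow> sk_prov (\<phi> # \<Gamma>) (SNeg \<psi>) \<Longrightarrow> sk_prov \<Gamma> (SNeg \<phi>)"
| sk_negE: "sk_prov \<Gamma> (SNeg (SNeg \<phi>)) \<Longrightarrow> sk_prov \<Gamma> \<phi>"
| sk_disjI1: "sk_prov \<Gamma> \<phi> \<Longrightarrow> sk_form \<psi> \<Longrightarrow> sk_prov \<Gamma> (SOr \<phi> \<psi>)"
| sk_disjI2: "sk_prov \<Gamma> \<psi> \<Longrightarrow> sk_form \<phi> \<Longrightarrow> sk_prov \<Gamma> (SOr \<phi> \<psi>)"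
| sk_disjE: "sk_prov \<Gamma> (SOr \<phi> \<psi>) \<Longrightarrow> sk_prov (\<phi> # \<Gamma>) \<chi> \<Longrightarrow> sk_prov (\<psi> # \<Gamma>) \<chi> \<Longrightarrow> sk_prov \<Gamma> \<chi>"
| sk_exI: "sk_prov \<Gamma> (sinst K \<phi>) \<Longrightarrow> sk_prov \<Gamma> (SEx \<phi>)"
| sk_exE: "sk_prov \<Gamma> (SEx \<phi>) \<Longrightarrow> sk_prov (\<phi> # map sshift \<Gamma>) (sshift \<psi>) \<Longrightarrow> sk_prov \<Gamma> \<psi>"


section \<open>Standard values of HF-terms in \<open>V\<^sub>\<omega>\<close>\<close>

primrec heval :: "hft \<Rightarrow> (nat \<Rightarrow> hf) \<Rightarrow> hf"
  and ssat :: "sfm \<Rightarrow> (nat \<Rightarrow> hf) \<Rightarrow> bool"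
where
  "heval (HVar i) e = e i"
| "heval (HConst \<kappa>) e = \<kappa>"
| "heval (HFun \<phi> Ks) e =
     (THE v. ssat \<phi> (case_nat v (\<lambda>i. if i < length Ks then map (\<lambda>K. heval K e) Ks ! i else hempty)))"
| "ssat (SEq K L) e \<longleftrightarrow> heval K e = heval L e"
| "ssat (SMem K L) e \<longleftrightarrow> heval K e |\<in>| elts (heval L e)"
| "ssat (SNeg \<phi>) e \<longleftrightarrow> \<not> ssat \<phi> e"
| "ssat (SOr \<phi> \<psi>) e \<longleftrightarrow> ssat \<phi> e \<or> ssat \<psi> e"
| "ssat (SEx \<phi>) e \<longleftrightarrow> (\<exists>v. ssat \<phi> (case_nat v e))"

text \<open>The value of a closed HF-term, for which the environment is irrelevant.\<close>

definition hvalue :: "hft \<Rightarrow> hf" where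
  "hvalue K = heval K (\<lambda>_. hempty)"


section \<open>The HF-Functions \<open>L\<^sup>K\<close> and \<open>f(k)\<close>\<close>

text \<open>Functions are sets of Kuratowski pairs.  \<open>is_pair K L P\<close> says \<open>P = {{K},{K,L}}\<close>.\<close>

definition is_upair :: "hft \<Rightarrow> hft \<Rightarrow> hft \<Rightarrow> sfm" where
  "is_upair K L P = SAll (SIff (SMem (HVar 0) (hshift P))
     (SOr (SEq (HVar 0) (hshift K)) (SEq (HVar 0) (hshift L))))"

definition is_pair :: "hft \<Rightarrow> hft \<Rightarrow> hft \<Rightarrow> sfm" where
  "is_pair K L P = SAll (SIff (SMem (HVar 0) (hshift P))
     (SOr (is_upair (hshift K) (hshift K) (HVar 0)) (is_upair (hshift K) (hshift L) (HVar 0))))"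

definition pair_in :: "hft \<Rightarrow> hft \<Rightarrow> hft \<Rightarrow> sfm" where
  "pair_in K L F = SEx (SAnd (SMem (HVar 0) (hshift F)) (is_pair (hshift K) (hshift L) (HVar 0)))"

definition is_function :: "hft \<Rightarrow> hft \<Rightarrow> hft \<Rightarrow> sfm" where \<comment> \<open>\<open>F\<close> is a function from \<open>K\<close> to \<open>L\<close>\<close>
  "is_function F K L = SAnd
     (SAll (SImp (SMem (HVar 0) (hshift F))
       (SEx (SAnd (SMem (HVar 0) (hshift (hshift K)))
         (SEx (SAnd (SMem (HVar 0) (hshift (hshift (hshift L))))
           (is_pair (HVar 1) (HVar 0) (HVar 2))))))))
     (SAll (SImp (SMem (HVar 0) (hshift K))
       (SEx1 (pair_in (HVar 1) (HVar 0) (hshift (hshift F))))))"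

definition hexp :: "hft \<Rightarrow> hft \<Rightarrow> hft" where \<comment> \<open>\<open>hexp L K\<close> is \<open>L\<^sup>K\<close>\<close>
  "hexp L K = HFun
     (SAll (SIff (SMem (HVar 0) (HVar 1)) (is_function (HVar 0) (HVar 3) (HVar 2)))) [L, K]"

text \<open>\<open>happ F K\<close> is \<open>F(K)\<close>, made total by the value \<open>\<emptyset>\<close> where \<open>F\<close> does not relate \<open>K\<close> to exactly
  one set.\<close>

definition happ :: "hft \<Rightarrow> hft \<Rightarrow> hft" where
  "happ F K = HFun
     (let E = SEx1 (pair_in (HVar 3) (HVar 0) (HVar 2))
      in SOr (SAnd E (pair_in (HVar 2) (HVar 0) (HVar 1)))
             (SAnd (SNeg E) (SEq (HVar 0) (HConst hempty)))) [F, K]"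


section \<open>Individuals\<close>

datatype ind = IVar nat | Root | Succ hf ind \<comment> \<open>\<open>Succ d t\<close> is \<open>S\<^sub>d(t)\<close>\<close>

primrec isub :: "(nat \<Rightarrow> ind) \<Rightarrow> ind \<Rightarrow> ind" where
  "isub \<sigma> (IVar i) = \<sigma> i"
| "isub \<sigma> Root = Root"
| "isub \<sigma> (Succ d t) = Succ d (isub \<sigma> t)"

abbreviation ishift :: "ind \<Rightarrow> ind" where
  "ishift \<equiv> isub (\<lambda>i. IVar (Suc i))"

definition ilift :: "(nat \<Rightarrow> ind) \<Rightarrow> nat \<Rightarrow> ind" where
  "ilift \<sigma> = case_nat (IVar 0) (\<lambda>i. ishift (\<sigma> i))"

definition rlift :: "(nat \<Rightarrow> nat) \<Rightarrow> nat \<Rightarrow> nat" where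
  "rlift \<rho> = case_nat 0 (\<lambda>i. Suc (\<rho> i))"

primrec ind_term :: "hf \<Rightarrow> ind \<Rightarrow> bool" where
  "ind_term \<D> (IVar i) \<longleftrightarrow> True"
| "ind_term \<D> Root \<longleftrightarrow> True"
| "ind_term \<D> (Succ d t) \<longleftrightarrow> d |\<in>| elts \<D> \<and> ind_term \<D> t"

primrec ibound :: "nat \<Rightarrow> ind \<Rightarrow> bool" where
  "ibound n (IVar i) \<longleftrightarrow> i < n"
| "ibound n Root \<longleftrightarrow> True"
| "ibound n (Succ d t) \<longleftrightarrow> ibound n t"


section \<open>MSO\<close>

datatype mfm =
    MPred nat ind
  | MEq ind ind
  | MLess ind ind
  | MNeg mfm
  | MOr mfm mfm
  | MExI mfm
  | MExP mfm

abbreviation "MAnd \<phi> \<psi> \<equiv> MNeg (MOr (MNeg \<phi>) (MNeg \<psi>))"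
abbreviation "MImp \<phi> \<psi> \<equiv> MOr (MNeg \<phi>) \<psi>"
abbreviation "MIff \<phi> \<psi> \<equiv> MAnd (MImp \<phi> \<psi>) (MImp \<psi> \<phi>)"
abbreviation "MAllI \<phi> \<equiv> MNeg (MExI (MNeg \<phi>))"
abbreviation "MAllP \<phi> \<equiv> MNeg (MExP (MNeg \<phi>))"
abbreviation "MTrue \<equiv> MEq Root Root"
abbreviation "MFalse \<equiv> MNeg MTrue"
abbreviation "MConj \<phi>s \<equiv> foldr MAnd \<phi>s MTrue"
abbreviation "MDisj \<phi>s \<equiv> foldr MOr \<phi>s MFalse"

text \<open>Substitution of terms for Individual variables and renaming of Predicate variables.\<close>

primrec msub :: "(nat \<Rightarrow> ind) \<Rightarrow> (nat \<Rightarrow> nat) \<Rightarrow> mfm \<Rightarrow> mfm" where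
  "msub \<sigma> \<rho> (MPred X t) = MPred (\<rho> X) (isub \<sigma> t)"
| "msub \<sigma> \<rho> (MEq t u) = MEq (isub \<sigma> t) (isub \<sigma> u)"
| "msub \<sigma> \<rho> (MLess t u) = MLess (isub \<sigma> t) (isub \<sigma> u)"
| "msub \<sigma> \<rho> (MNeg \<phi>) = MNeg (msub \<sigma> \<rho> \<phi>)"
| "msub \<sigma> \<rho> (MOr \<phi> \<psi>) = MOr (msub \<sigma> \<rho> \<phi>) (msub \<sigma> \<rho> \<psi>)"
| "msub \<sigma> \<rho> (MExI \<phi>) = MExI (msub (ilift \<sigma>) \<rho> \<phi>)"
| "msub \<sigma> \<rho> (MExP \<phi>) = MExP (msub \<sigma> (rlift \<rho>) \<phi>)"

abbreviation "minst_ind t \<equiv> msub (case_nat t IVar) (\<lambda>i. i)"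
abbreviation "minst_pred X \<equiv> msub IVar (case_nat X (\<lambda>i. i))"
abbreviation "mshift_ind \<equiv> msub (\<lambda>i. IVar (Suc i)) (\<lambda>i. i)"
abbreviation "mshift_pred \<equiv> msub IVar Suc"

primrec mso_form :: "hf \<Rightarrow> mfm \<Rightarrow> bool" where
  "mso_form \<D> (MPred X t) \<longleftrightarrow> ind_term \<D> t"
| "mso_form \<D> (MEq t u) \<longleftrightarrow> ind_term \<D> t \<and> ind_term \<D> u"
| "mso_form \<D> (MLess t u) \<longleftrightarrow> ind_term \<D> t \<and> ind_term \<D> u"
| "mso_form \<D> (MNeg \<phi>) \<longleftrightarrow> mso_form \<D> \<phi>"
| "mso_form \<D> (MOr \<phi> \<psi>) \<longleftrightarrow> mso_form \<D> \<phi> \<and> mso_form \<D> \<psi>"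
| "mso_form \<D> (MExI \<phi>) \<longleftrightarrow> mso_form \<D> \<phi>"
| "mso_form \<D> (MExP \<phi>) \<longleftrightarrow> mso_form \<D> \<phi>"

inductive mso_axiom :: "hf \<Rightarrow> mfm \<Rightarrow> bool" for \<D> :: hf where
  eq_refl: "mso_axiom \<D> (MAllI (MEq (IVar 0) (IVar 0)))"
| eq_subst: "mso_axiom \<D> (MImp (MEq t u) (MImp (minst_ind t \<phi>) (minst_ind u \<phi>)))"
| succ_not_root: "mso_axiom \<D> (MNeg (MExI (MEq (Succ d (IVar 0)) Root)))"
| succ_inj: "mso_axiom \<D> (MAllI (MAllI
    (MImp (MEq (Succ d (IVar 1)) (Succ d (IVar 0))) (MEq (IVar 1) (IVar 0)))))"
| succ_disjoint: "d \<noteq> d' \<Longrightarrow>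
    mso_axiom \<D> (MNeg (MExI (MExI (MEq (Succ d (IVar 1)) (Succ d' (IVar 0))))))"
| less_irrefl: "mso_axiom \<D> (MNeg (MExI (MLess (IVar 0) (IVar 0))))"
| less_trans: "mso_axiom \<D> (MAllI (MAllI (MAllI
    (MImp (MLess (IVar 2) (IVar 1)) (MImp (MLess (IVar 1) (IVar 0)) (MLess (IVar 2) (IVar 0)))))))"
| less_root: "mso_axiom \<D> (MNeg (MExI (MLess (IVar 0) Root)))"
| less_succ: "mso_axiom \<D> (MAllI (MAllI
    (MIff (MLess (IVar 1) (Succ d (IVar 0)))
       (MOr (MLess (IVar 1) (IVar 0)) (MEq (IVar 1) (IVar 0))))))"
| comprehension: "mso_axiom \<D> (MExP (MAllI (MIff (MPred 0 (IVar 0)) (mshift_pred \<phi>))))"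
| induction: "mso_axiom \<D> (MAllP (MImp (MPred 0 Root)
    (MImp (MConj (map (\<lambda>d. MAllI (MImp (MPred 0 (IVar 0)) (MPred 0 (Succ d (IVar 0))))) (members \<D>)))
       (MAllI (MPred 0 (IVar 0))))))"

inductive mso_prov :: "hf \<Rightarrow> mfm list \<Rightarrow> mfm \<Rightarrow> bool" for \<D> :: hf where
  assm: "\<phi> \<in> set \<Gamma> \<Longrightarrow> \<forall>\<gamma>\<in>set \<Gamma>. mso_form \<D> \<gamma> \<Longrightarrow> mso_prov \<D> \<Gamma> \<phi>"
| ax: "mso_axiom \<D> \<phi> \<Longrightarrow> mso_form \<D> \<phi> \<Longrightarrow> \<forall>\<gamma>\<in>set \<Gamma>. mso_form \<D> \<gamma> \<Longrightarrow> mso_prov \<D> \<Gamma> \<phi>"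
| negI: "mso_prov \<D> (\<phi> # \<Gamma>) \<psi> \<Longrightarrow> mso_prov \<D> (\<phi> # \<Gamma>) (MNeg \<psi>) \<Longrightarrow> mso_prov \<D> \<Gamma> (MNeg \<phi>)"
| negE: "mso_prov \<D> \<Gamma> (MNeg (MNeg \<phi>)) \<Longrightarrow> mso_prov \<D> \<Gamma> \<phi>"
| disjI1: "mso_prov \<D> \<Gamma> \<phi> \<Longrightarrow> mso_form \<D> \<psi> \<Longrightarrow> mso_prov \<D> \<Gamma> (MOr \<phi> \<psi>)"
| disjI2: "mso_prov \<D> \<Gamma> \<psi> \<Longrightarrow> mso_form \<D> \<phi> \<Longrightarrow> mso_prov \<D> \<Gamma> (MOr \<phi> \<psi>)"
| disjE: "mso_prov \<D> \<Gamma> (MOr \<phi> \<psi>) \<Longrightarrow> mso_prov \<D> (\<phi> # \<Gamma>) \<chi> \<Longrightarrow> mso_prov \<D> (\<psi> # \<Gamma>) \<chi> \<Longrightarrow>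
    mso_prov \<D> \<Gamma> \<chi>"
| ex_indI: "mso_prov \<D> \<Gamma> (minst_ind t \<phi>) \<Longrightarrow> mso_prov \<D> \<Gamma> (MExI \<phi>)"
| ex_indE: "mso_prov \<D> \<Gamma> (MExI \<phi>) \<Longrightarrow> mso_prov \<D> (\<phi> # map mshift_ind \<Gamma>) (mshift_ind \<psi>) \<Longrightarrow>
    mso_prov \<D> \<Gamma> \<psi>"
| ex_predI: "mso_prov \<D> \<Gamma> (minst_pred X \<phi>) \<Longrightarrow> mso_prov \<D> \<Gamma> (MExP \<phi>)"
| ex_predE: "mso_prov \<D> \<Gamma> (MExP \<phi>) \<Longrightarrow> mso_prov \<D> (\<phi> # map mshift_pred \<Gamma>) (mshift_pred \<psi>) \<Longrightarrow>
    mso_prov \<D> \<Gamma> \<psi>"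


section \<open>FSO\<close>

datatype ffm =
    FEq ind ind
  | FLess ind ind
  | FHEq hft hft
  | FHMem hft hft
  | FHSub hft hft
  | FApp nat ind hft    \<comment> \<open>\<open>F(t) = K\<close>\<close>
  | FNeg ffm
  | FOr ffm ffm
  | FExI ffm
  | FExMem hft ffm      \<comment> \<open>\<open>\<exists>k \<in> K\<close>; the bound is outside the scope of the quantifier\<close>
  | FExSub hft ffm      \<comment> \<open>\<open>\<exists>k \<subseteq> K\<close>\<close>
  | FExF hft ffm        \<comment> \<open>\<open>\<exists>F : K\<close>\<close>

abbreviation "FAnd \<phi> \<psi> \<equiv> FNeg (FOr (FNeg \<phi>) (FNeg \<psi>))"
abbreviation "FImp \<phi> \<psi> \<equiv> FOr (FNeg \<phi>) \<psi>"
abbreviation "FIff \<phi> \<psi> \<equiv> FAnd (FImp \<phi> \<psi>) (FImp \<psi> \<phi>)"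
abbreviation "FAllI \<phi> \<equiv> FNeg (FExI (FNeg \<phi>))"
abbreviation "FAllMem K \<phi> \<equiv> FNeg (FExMem K (FNeg \<phi>))"
abbreviation "FTrue \<equiv> FEq Root Root"
abbreviation "FConj \<phi>s \<equiv> foldr FAnd \<phi>s FTrue"

text \<open>Substitution of terms for Individual and HF-variables and renaming of Function variables.\<close>

primrec fsub :: "(nat \<Rightarrow> ind) \<Rightarrow> (nat \<Rightarrow> hft) \<Rightarrow> (nat \<Rightarrow> nat) \<Rightarrow> ffm \<Rightarrow> ffm" where
  "fsub \<sigma> \<tau> \<rho> (FEq t u) = FEq (isub \<sigma> t) (isub \<sigma> u)"
| "fsub \<sigma> \<tau> \<rho> (FLess t u) = FLess (isub \<sigma> t) (isub \<sigma> u)"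
| "fsub \<sigma> \<tau> \<rho> (FHEq K L) = FHEq (hsub \<tau> K) (hsub \<tau> L)"
| "fsub \<sigma> \<tau> \<rho> (FHMem K L) = FHMem (hsub \<tau> K) (hsub \<tau> L)"
| "fsub \<sigma> \<tau> \<rho> (FHSub K L) = FHSub (hsub \<tau> K) (hsub \<tau> L)"
| "fsub \<sigma> \<tau> \<rho> (FApp F t K) = FApp (\<rho> F) (isub \<sigma> t) (hsub \<tau> K)"
| "fsub \<sigma> \<tau> \<rho> (FNeg \<phi>) = FNeg (fsub \<sigma> \<tau> \<rho> \<phi>)"
| "fsub \<sigma> \<tau> \<rho> (FOr \<phi> \<psi>) = FOr (fsub \<sigma> \<tau> \<rho> \<phi>) (fsub \<sigma> \<tau> \<rho> \<psi>)"
| "fsub \<sigma> \<tau> \<rho> (FExI \<phi>) = FExI (fsub (ilift \<sigma>) \<tau> \<rho> \<phi>)"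
| "fsub \<sigma> \<tau> \<rho> (FExMem K \<phi>) = FExMem (hsub \<tau> K) (fsub \<sigma> (hlift \<tau>) \<rho> \<phi>)"
| "fsub \<sigma> \<tau> \<rho> (FExSub K \<phi>) = FExSub (hsub \<tau> K) (fsub \<sigma> (hlift \<tau>) \<rho> \<phi>)"
| "fsub \<sigma> \<tau> \<rho> (FExF K \<phi>) = FExF (hsub \<tau> K) (fsub \<sigma> \<tau> (rlift \<rho>) \<phi>)"

abbreviation "finst_ind t \<equiv> fsub (case_nat t IVar) HVar (\<lambda>i. i)"
abbreviation "finst_hf K \<equiv> fsub IVar (case_nat K HVar) (\<lambda>i. i)"
abbreviation "finst_fun F \<equiv> fsub IVar HVar (case_nat F (\<lambda>i. i))"
abbreviation "fshift_ind \<equiv> fsub (\<lambda>i. IVar (Suc i)) HVar (\<lambda>i. i)"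
abbreviation "fshift_hf \<equiv> fsub IVar (\<lambda>i. HVar (Suc i)) (\<lambda>i. i)"
abbreviation "fshift_fun \<equiv> fsub IVar HVar Suc"

primrec fso_form :: "hf \<Rightarrow> ffm \<Rightarrow> bool" where
  "fso_form \<D> (FEq t u) \<longleftrightarrow> ind_term \<D> t \<and> ind_term \<D> u"
| "fso_form \<D> (FLess t u) \<longleftrightarrow> ind_term \<D> t \<and> ind_term \<D> u"
| "fso_form \<D> (FHEq K L) \<longleftrightarrow> sk_term K \<and> sk_term L"
| "fso_form \<D> (FHMem K L) \<longleftrightarrow> sk_term K \<and> sk_term L"
| "fso_form \<D> (FHSub K L) \<longleftrightarrow> sk_term K \<and> sk_term L"
| "fso_form \<D> (FApp F t K) \<longleftrightarrow> ind_term \<D> t \<and> sk_term K"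
| "fso_form \<D> (FNeg \<phi>) \<longleftrightarrow> fso_form \<D> \<phi>"
| "fso_form \<D> (FOr \<phi> \<psi>) \<longleftrightarrow> fso_form \<D> \<phi> \<and> fso_form \<D> \<psi>"
| "fso_form \<D> (FExI \<phi>) \<longleftrightarrow> fso_form \<D> \<phi>"
| "fso_form \<D> (FExMem K \<phi>) \<longleftrightarrow> sk_term K \<and> fso_form \<D> \<phi>"
| "fso_form \<D> (FExSub K \<phi>) \<longleftrightarrow> sk_term K \<and> fso_form \<D> \<phi>"
| "fso_form \<D> (FExF K \<phi>) \<longleftrightarrow> sk_term K \<and> fso_form \<D> \<phi>"

text \<open>\<open>fbound a b c \<phi>\<close>: the free Individual, HF- and Function indices of \<open>\<phi>\<close> are less than \<open>a\<close>, \<open>b\<close>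
  and \<open>c\<close>, respectively.\<close>

primrec fbound :: "nat \<Rightarrow> nat \<Rightarrow> nat \<Rightarrow> ffm \<Rightarrow> bool" where
  "fbound a b c (FEq t u) \<longleftrightarrow> ibound a t \<and> ibound a u"
| "fbound a b c (FLess t u) \<longleftrightarrow> ibound a t \<and> ibound a u"
| "fbound a b c (FHEq K L) \<longleftrightarrow> hbound b K \<and> hbound b L"
| "fbound a b c (FHMem K L) \<longleftrightarrow> hbound b K \<and> hbound b L"
| "fbound a b c (FHSub K L) \<longleftrightarrow> hbound b K \<and> hbound b L"
| "fbound a b c (FApp F t K) \<longleftrightarrow> F < c \<and> ibound a t \<and> hbound b K"
| "fbound a b c (FNeg \<phi>) \<longleftrightarrow> fbound a b c \<phi>"
| "fbound a b c (FOr \<phi> \<psi>) \<longleftrightarrow> fbound a b c \<phi> \<and> fbound a b c \<psi>"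
| "fbound a b c (FExI \<phi>) \<longleftrightarrow> fbound (Suc a) b c \<phi>"
| "fbound a b c (FExMem K \<phi>) \<longleftrightarrow> hbound b K \<and> fbound a (Suc b) c \<phi>"
| "fbound a b c (FExSub K \<phi>) \<longleftrightarrow> hbound b K \<and> fbound a (Suc b) c \<phi>"
| "fbound a b c (FExF K \<phi>) \<longleftrightarrow> hbound b K \<and> fbound a b (Suc c) \<phi>"

definition fso_closed :: "ffm \<Rightarrow> bool" where
  "fso_closed \<phi> \<longleftrightarrow> fbound 0 0 0 \<phi>"

text \<open>\<open>F : K\<close> as a formula, \<open>(\<forall>x)(\<exists>k \<in> K) F(x) = k\<close>.\<close>

definition FTyped :: "nat \<Rightarrow> hft \<Rightarrow> ffm" where
  "FTyped F K = FAllI (FExMem K (FApp F (IVar 0) (HVar 0)))"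

text \<open>Formulae on HF-sets only, and their reading in the language of set theory, in which bounded
  quantifiers and inclusion are defined.\<close>

primrec hf_only :: "ffm \<Rightarrow> bool" where
  "hf_only (FEq t u) \<longleftrightarrow> False"
| "hf_only (FLess t u) \<longleftrightarrow> False"
| "hf_only (FHEq K L) \<longleftrightarrow> True"
| "hf_only (FHMem K L) \<longleftrightarrow> True"
| "hf_only (FHSub K L) \<longleftrightarrow> True"
| "hf_only (FApp F t K) \<longleftrightarrow> False"
| "hf_only (FNeg \<phi>) \<longleftrightarrow> hf_only \<phi>"
| "hf_only (FOr \<phi> \<psi>) \<longleftrightarrow> hf_only \<phi> \<and> hf_only \<psi>"
| "hf_only (FExI \<phi>) \<longleftrightarrow> False"
| "hf_only (FExMem K \<phi>) \<longleftrightarrow> hf_only \<phi>"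
| "hf_only (FExSub K \<phi>) \<longleftrightarrow> hf_only \<phi>"
| "hf_only (FExF K \<phi>) \<longleftrightarrow> False"

primrec to_sfm :: "ffm \<Rightarrow> sfm" where
  "to_sfm (FEq t u) = undefined"
| "to_sfm (FLess t u) = undefined"
| "to_sfm (FHEq K L) = SEq K L"
| "to_sfm (FHMem K L) = SMem K L"
| "to_sfm (FHSub K L) = SSub K L"
| "to_sfm (FApp F t K) = undefined"
| "to_sfm (FNeg \<phi>) = SNeg (to_sfm \<phi>)"
| "to_sfm (FOr \<phi> \<psi>) = SOr (to_sfm \<phi>) (to_sfm \<psi>)"
| "to_sfm (FExI \<phi>) = undefined"
| "to_sfm (FExMem K \<phi>) = SEx (SAnd (SMem (HVar 0) (hshift K)) (to_sfm \<phi>))"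
| "to_sfm (FExSub K \<phi>) = SEx (SAnd (SSub (HVar 0) (hshift K)) (to_sfm \<phi>))"
| "to_sfm (FExF K \<phi>) = undefined"

text \<open>\<open>app_subst E k j \<phi>\<close> is \<open>\<phi>[G(k)//F]\<close> where \<open>G : E\<close>, with \<open>F\<close> and \<open>G\<close> at the same Function index
  \<open>j\<close>: every atom \<open>F(t) = M\<close> becomes \<open>(\<exists>f \<in> E)(G(t) = f \<and> f(k) = M)\<close>.\<close>

primrec app_subst :: "hft \<Rightarrow> hft \<Rightarrow> nat \<Rightarrow> ffm \<Rightarrow> ffm" where
  "app_subst E k j (FEq t u) = FEq t u"
| "app_subst E k j (FLess t u) = FLess t u"
| "app_subst E k j (FHEq K L) = FHEq K L"
| "app_subst E k j (FHMem K L) = FHMem K L"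
| "app_subst E k j (FHSub K L) = FHSub K L"
| "app_subst E k j (FApp F t M) =
     (if F = j
      then FExMem E (FAnd (FApp F t (HVar 0)) (FHEq (happ (HVar 0) (hshift k)) (hshift M)))
      else FApp F t M)"
| "app_subst E k j (FNeg \<phi>) = FNeg (app_subst E k j \<phi>)"
| "app_subst E k j (FOr \<phi> \<psi>) = FOr (app_subst E k j \<phi>) (app_subst E k j \<psi>)"
| "app_subst E k j (FExI \<phi>) = FExI (app_subst E k j \<phi>)"
| "app_subst E k j (FExMem K \<phi>) = FExMem K (app_subst (hshift E) (hshift k) j \<phi>)"
| "app_subst E k j (FExSub K \<phi>) = FExSub K (app_subst (hshift E) (hshift k) j \<phi>)"
| "app_subst E k j (FExF K \<phi>) = FExF K (app_subst E k (Suc j) \<phi>)"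

text \<open>In \<open>choice_hf\<close>, indices 0 and 1 of \<open>\<phi>\<close> are \<open>l\<close> and \<open>k\<close>; the conclusion is
  \<open>(\<exists>f \<in> L\<^sup>K)(\<forall>k \<in> K) \<phi>(k, f(k))\<close>.  In \<open>choice_fun\<close>, \<open>\<phi>(x, F(x))\<close> stands for
  \<open>(\<exists>k \<in> K)(F(x) = k \<and> \<phi>(x, k))\<close>.\<close>

inductive fso_axiom :: "hf \<Rightarrow> ffm \<Rightarrow> bool" for \<D> :: hf where
  eq_refl: "fso_axiom \<D> (FAllI (FEq (IVar 0) (IVar 0)))"
| eq_subst: "fso_axiom \<D> (FImp (FEq t u) (FImp (finst_ind t \<phi>) (finst_ind u \<phi>)))"
| hf_eq_refl: "fso_axiom \<D> (FHEq K K)"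
| hf_eq_subst: "fso_axiom \<D> (FImp (FHEq K L) (FImp (finst_hf K \<phi>) (finst_hf L \<phi>)))"
| fun_eq: "fso_axiom \<D> (FImp (FApp F t K) (FImp (FApp F t L) (FHEq K L)))"
| succ_not_root: "fso_axiom \<D> (FNeg (FExI (FEq (Succ d (IVar 0)) Root)))"
| succ_inj: "fso_axiom \<D> (FAllI (FAllI
    (FImp (FEq (Succ d (IVar 1)) (Succ d (IVar 0))) (FEq (IVar 1) (IVar 0)))))"
| succ_disjoint: "d \<noteq> d' \<Longrightarrow>
    fso_axiom \<D> (FNeg (FExI (FExI (FEq (Succ d (IVar 1)) (Succ d' (IVar 0))))))"
| less_irrefl: "fso_axiom \<D> (FNeg (FExI (FLess (IVar 0) (IVar 0))))"
| less_trans: "fso_axiom \<D> (FAllI (FAllI (FAllI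
    (FImp (FLess (IVar 2) (IVar 1)) (FImp (FLess (IVar 1) (IVar 0)) (FLess (IVar 2) (IVar 0)))))))"
| less_root: "fso_axiom \<D> (FNeg (FExI (FLess (IVar 0) Root)))"
| less_succ: "fso_axiom \<D> (FAllI (FAllI
    (FIff (FLess (IVar 1) (Succ d (IVar 0)))
       (FOr (FLess (IVar 1) (IVar 0)) (FEq (IVar 1) (IVar 0))))))"
| induction: "fso_axiom \<D> (FImp (finst_ind Root \<phi>)
    (FImp (FConj (map (\<lambda>d. FAllI (FImp \<phi>
              (fsub (case_nat (Succ d (IVar 0)) (\<lambda>i. IVar (Suc i))) HVar (\<lambda>i. i) \<phi>))) (members \<D>)))
       (FAllI \<phi>)))"
| hf_sets: "hf_only \<phi> \<Longrightarrow> sk_prov [] (to_sfm \<phi>) \<Longrightarrow> fso_axiom \<D> \<phi>"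
| choice_hf: "fso_axiom \<D> (FImp
    (FAllMem K (FExMem (hshift L) \<phi>))
    (FExMem (hexp L K) (FAllMem (hshift K)
       (fsub IVar
          (case_nat (happ (HVar 1) (HVar 0)) (case_nat (HVar 0) (\<lambda>i. HVar (Suc (Suc i)))))
          (\<lambda>i. i) \<phi>))))"
| choice_fun: "fso_axiom \<D> (FImp
    (FAllI (FExMem K \<phi>))
    (FExF K (FAllI (FExMem K (FAnd (FApp 0 (IVar 0) (HVar 0)) (fshift_fun \<phi>))))))"
| choice_iterated: "fso_axiom \<D> (FImp
    (FAllMem K (FExF (hshift L) \<phi>))
    (FExF (hexp L K) (FAllMem K (app_subst (hshift (hexp L K)) (HVar 0) 0 \<phi>))))"

inductive fso_prov :: "hf \<Rightarrow> ffm list \<Rightarrow> ffm \<Rightarrow> bool" for \<D> :: hf where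
  assm: "\<phi> \<in> set \<Gamma> \<Longrightarrow> \<forall>\<gamma>\<in>set \<Gamma>. fso_form \<D> \<gamma> \<Longrightarrow> fso_prov \<D> \<Gamma> \<phi>"
| ax: "fso_axiom \<D> \<phi> \<Longrightarrow> fso_form \<D> \<phi> \<Longrightarrow> \<forall>\<gamma>\<in>set \<Gamma>. fso_form \<D> \<gamma> \<Longrightarrow> fso_prov \<D> \<Gamma> \<phi>"
| negI: "fso_prov \<D> (\<phi> # \<Gamma>) \<psi> \<Longrightarrow> fso_prov \<D> (\<phi> # \<Gamma>) (FNeg \<psi>) \<Longrightarrow> fso_prov \<D> \<Gamma> (FNeg \<phi>)"
| negE: "fso_prov \<D> \<Gamma> (FNeg (FNeg \<phi>)) \<Longrightarrow> fso_prov \<D> \<Gamma> \<phi>"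
| disjI1: "fso_prov \<D> \<Gamma> \<phi> \<Longrightarrow> fso_form \<D> \<psi> \<Longrightarrow> fso_prov \<D> \<Gamma> (FOr \<phi> \<psi>)"
| disjI2: "fso_prov \<D> \<Gamma> \<psi> \<Longrightarrow> fso_form \<D> \<phi> \<Longrightarrow> fso_prov \<D> \<Gamma> (FOr \<phi> \<psi>)"
| disjE: "fso_prov \<D> \<Gamma> (FOr \<phi> \<psi>) \<Longrightarrow> fso_prov \<D> (\<phi> # \<Gamma>) \<chi> \<Longrightarrow> fso_prov \<D> (\<psi> # \<Gamma>) \<chi> \<Longrightarrow>
    fso_prov \<D> \<Gamma> \<chi>"
| ex_indI: "fso_prov \<D> \<Gamma> (finst_ind t \<phi>) \<Longrightarrow> fso_prov \<D> \<Gamma> (FExI \<phi>)"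
| ex_indE: "fso_prov \<D> \<Gamma> (FExI \<phi>) \<Longrightarrow> fso_prov \<D> (\<phi> # map fshift_ind \<Gamma>) (fshift_ind \<psi>) \<Longrightarrow>
    fso_prov \<D> \<Gamma> \<psi>"
| ex_memI: "fso_prov \<D> \<Gamma> (FHMem L K) \<Longrightarrow> fso_prov \<D> \<Gamma> (finst_hf L \<phi>) \<Longrightarrow> fso_prov \<D> \<Gamma> (FExMem K \<phi>)"
| ex_memE: "fso_prov \<D> \<Gamma> (FExMem K \<phi>) \<Longrightarrow>
    fso_prov \<D> (\<phi> # FHMem (HVar 0) (hshift K) # map fshift_hf \<Gamma>) (fshift_hf \<psi>) \<Longrightarrow> fso_prov \<D> \<Gamma> \<psi>"
| ex_subI: "fso_prov \<D> \<Gamma> (FHSub L K) \<Longrightarrow> fso_prov \<D> \<Gamma> (finst_hf L \<phi>) \<Longrightarrow> fso_prov \<D> \<Gamma> (FExSub K \<phi>)"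
| ex_subE: "fso_prov \<D> \<Gamma> (FExSub K \<phi>) \<Longrightarrow>
    fso_prov \<D> (\<phi> # FHSub (HVar 0) (hshift K) # map fshift_hf \<Gamma>) (fshift_hf \<psi>) \<Longrightarrow> fso_prov \<D> \<Gamma> \<psi>"
| ex_funI: "fso_prov \<D> \<Gamma> (FTyped F K) \<Longrightarrow> fso_prov \<D> \<Gamma> (finst_fun F \<phi>) \<Longrightarrow> fso_prov \<D> \<Gamma> (FExF K \<phi>)"
| ex_funE: "fso_prov \<D> \<Gamma> (FExF K \<phi>) \<Longrightarrow>
    fso_prov \<D> (\<phi> # FTyped 0 K # map fshift_fun \<Gamma>) (fshift_fun \<psi>) \<Longrightarrow> fso_prov \<D> \<Gamma> \<psi>"


section \<open>The translation of FSO into MSO\<close>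

text \<open>The Predicate variables with indices \<open>0, \<dots>, c - 1\<close> form a partition.\<close>

definition MPart :: "nat \<Rightarrow> mfm" where
  "MPart c = MAllI (MAnd
     (MDisj (map (\<lambda>i. MPred i (IVar 0)) [0..<c]))
     (MConj (concat (map (\<lambda>j. map (\<lambda>i. MNeg (MAnd (MPred i (IVar 0)) (MPred j (IVar 0)))) [0..<j]) [0..<c]))))"

primrec fsize :: "ffm \<Rightarrow> nat" where
  "fsize (FEq t u) = 0"
| "fsize (FLess t u) = 0"
| "fsize (FHEq K L) = 0"
| "fsize (FHMem K L) = 0"
| "fsize (FHSub K L) = 0"
| "fsize (FApp F t K) = 0"
| "fsize (FNeg \<phi>) = Suc (fsize \<phi>)"
| "fsize (FOr \<phi> \<psi>) = Suc (fsize \<phi> + fsize \<psi>)"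
| "fsize (FExI \<phi>) = Suc (fsize \<phi>)"
| "fsize (FExMem K \<phi>) = Suc (fsize \<phi>)"
| "fsize (FExSub K \<phi>) = Suc (fsize \<phi>)"
| "fsize (FExF K \<phi>) = Suc (fsize \<phi>)"

lemma fsize_fsub [simp]: "fsize (fsub \<sigma> \<tau> \<rho> \<phi>) = fsize \<phi>"
  by (induction \<phi> arbitrary: \<sigma> \<tau> \<rho>) simp_all

text \<open>
  The environment interprets a Function variable \<open>F : {\<kappa>\<^sub>1,\<dots>,\<kappa>\<^sub>c}\<close> by the list
  \<open>[\<kappa>\<^sub>1,\<dots>,\<kappa>\<^sub>c]\<close> and the first of the \<open>c\<close> consecutive Predicate indices assigned to it.  When \<open>c\<close> new
  Predicate variables are bound, they receive the indices \<open>0, \<dots>, c - 1\<close> and all others are raised by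
  \<open>c\<close>.
\<close>

function transl :: "(nat \<Rightarrow> hf list \<times> nat) \<Rightarrow> ffm \<Rightarrow> mfm" where
  "transl \<eta> (FEq t u) = MEq t u"
| "transl \<eta> (FLess t u) = MLess t u"
| "transl \<eta> (FHEq K L) = (if hvalue K = hvalue L then MTrue else MFalse)"
| "transl \<eta> (FHMem K L) = (if hvalue K |\<in>| elts (hvalue L) then MTrue else MFalse)"
| "transl \<eta> (FHSub K L) = (if elts (hvalue K) |\<subseteq>| elts (hvalue L) then MTrue else MFalse)"
| "transl \<eta> (FApp F t L) = (case \<eta> F of (\<kappa>s, X) \<Rightarrow>
     MDisj (map (\<lambda>i. MPred (X + i) t) (filter (\<lambda>i. \<kappa>s ! i = hvalue L) [0..<length \<kappa>s])))"
| "transl \<eta> (FNeg \<phi>) = MNeg (transl \<eta> \<phi>)"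
| "transl \<eta> (FOr \<phi> \<psi>) = MOr (transl \<eta> \<phi>) (transl \<eta> \<psi>)"
| "transl \<eta> (FExI \<phi>) = MExI (transl \<eta> \<phi>)"
| "transl \<eta> (FExMem K \<phi>) =
     MDisj (map (\<lambda>\<kappa>. transl \<eta> (finst_hf (HConst \<kappa>) \<phi>)) (members (hvalue K)))"
| "transl \<eta> (FExSub K \<phi>) =
     MDisj (map (\<lambda>\<kappa>. transl \<eta> (finst_hf (HConst \<kappa>) \<phi>)) (subsets (hvalue K)))"
| "transl \<eta> (FExF K \<phi>) =
     (let \<kappa>s = members (hvalue K); c = length \<kappa>s
      in (MExP ^^ c) (MAnd (MPart c)
           (transl (case_nat (\<kappa>s, 0) (\<lambda>F. (fst (\<eta> F), snd (\<eta> F) + c))) \<phi>)))"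
  by pat_completeness auto
termination
  by (relation "measure (\<lambda>(\<eta>, \<phi>). fsize \<phi>)") simp_all

text \<open>For HF-closed formulae without free Function variables, the environment is irrelevant.\<close>

definition translation :: "ffm \<Rightarrow> mfm"  (\<open>\<lbrakk>_\<rbrakk>\<close>) where
  "\<lbrakk>\<phi>\<rbrakk> = transl (\<lambda>_. ([], 0)) \<phi>"

end

theory Submission
  imports Defs "HOL-Library.Countable"
begin

text \<open>
  MSO is complete for its Henkin theories: a formula that belongs to every maximal consistent theory
  with witnesses for both sorts of existential quantifiers is provable.  Over such a theory \<open>M\<close> there is
  a structure for FSO: Individuals are the well-formed terms, HF-sets are the elements of \<open>V\<^sub>\<omega>\<close>, and
  Functions are the maps with finite range whose fibres are extensions of Predicates of \<open>M\<close>.  A formula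
  \<open>\<phi>\<close> holds in this structure exactly if \<open>\<lbrakk>\<phi>\<rbrakk>\<close> belongs to \<open>M\<close>, since a map into
  \<open>{\<kappa>\<^sub>1,\<dots>,\<kappa>\<^sub>c}\<close> amounts to a partition into \<open>c\<close> definable classes.  All axioms of FSO hold there:
  by comprehension in \<open>M\<close>, sets defined by FSO-formulae are definable, which gives induction and the
  choice axioms, and the axioms on HF-sets hold because \<open>V\<^sub>\<omega>\<close> is a model of Skolemized ZFC without
  infinity.
\<close>

section \<open>Completeness of MSO for Henkin theories\<close>

text \<open>Induction on FSO derivations inside MSO would need a formal MSO derivation for every
  choice axiom, with one Predicate for each element of L^K, and for every rule under open HF-terms.
  Passing to structures replaces these derivations by arguments about sets of terms. The price is
  that a Henkin theory knows only definable sets, so every choice that depends on an Individual has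
  to be made definably. This works because HF-quantifiers are bounded: a choice among finitely many
  values can take the first one in a fixed list, and a finite family of Functions can be merged into
  one Function with finitely many values. HF-terms have the same standard values over all Henkin
  theories, so derivability in set theory matters only through its soundness. Inside a derivation a
  Function variable can be free without any declared codomain; hence Functions are interpreted by
  maps with some finite range, possibly partial.\<close>

lemma isub_isub: "isub \<sigma> (isub \<sigma>' t) = isub (\<lambda>i. isub \<sigma> (\<sigma>' i)) t"
  by (induction t) simp_all

lemma isub_IVar [simp]: "isub IVar t = t"
  by (induction t) simp_all

lemma ilift_IVar [simp]: "ilift IVar = IVar"
  by (auto simp: ilift_def fun_eq_iff split: nat.split)

lemma rlift_id [simp]: "rlift (\<lambda>i. i) = (\<lambda>i. i)"
  by (auto simp: rlift_def fun_eq_iff split: nat.split)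

lemma ilift_comp: "isub (ilift \<sigma>) (ilift \<sigma>' i) = ilift (\<lambda>i. isub \<sigma> (\<sigma>' i)) i"
  by (auto simp: ilift_def isub_isub split: nat.split)

lemma rlift_comp: "rlift \<rho> (rlift \<rho>' i) = rlift (\<lambda>i. \<rho> (\<rho>' i)) i"
  by (auto simp: rlift_def split: nat.split)

text \<open>The composition law behind the laws that follow: they compose both sides to a single
  substitution and compare the assignments index by index.\<close>

lemma msub_msub: "msub \<sigma> \<rho> (msub \<sigma>' \<rho>' \<phi>) = msub (\<lambda>i. isub \<sigma> (\<sigma>' i)) (\<lambda>i. \<rho> (\<rho>' i)) \<phi>"
  by (induction \<phi> arbitrary: \<sigma> \<rho> \<sigma>' \<rho>') (simp_all add: isub_isub ilift_comp rlift_comp)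

lemma msub_id [simp]: "msub IVar (\<lambda>i. i) \<phi> = \<phi>"
  by (induction \<phi>) simp_all

lemma isub_ilift_inst: "isub (case_nat t IVar) (ilift \<sigma> i) = case_nat t \<sigma> i"
  by (auto simp: ilift_def isub_isub split: nat.split)

lemma minst_ind_ilift: "minst_ind t (msub (ilift \<sigma>) \<rho> \<phi>) = msub (case_nat t \<sigma>) \<rho> \<phi>"
  by (simp add: msub_msub isub_ilift_inst)

lemma minst_pred_rlift: "minst_pred X (msub \<sigma> (rlift \<rho>) \<phi>) = msub \<sigma> (case_nat X \<rho>) \<phi>"
proof -
  have "case_nat X (\<lambda>i. i) (rlift \<rho> j) = case_nat X \<rho> j" for j
    by (auto simp: rlift_def split: nat.split)
  then show ?thesis by (simp add: msub_msub)
qed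

lemma msub_minst_ind: "msub \<sigma> \<rho> (minst_ind t \<phi>) = msub (case_nat (isub \<sigma> t) \<sigma>) \<rho> \<phi>"
proof -
  have "isub \<sigma> (case_nat t IVar i) = case_nat (isub \<sigma> t) \<sigma> i" for i
    by (auto split: nat.split)
  then show ?thesis by (simp add: msub_msub)
qed

lemma msub_minst_pred: "msub \<sigma> \<rho> (minst_pred X \<phi>) = msub \<sigma> (case_nat (\<rho> X) \<rho>) \<phi>"
proof -
  have "\<rho> (case_nat X (\<lambda>i. i) i) = case_nat (\<rho> X) \<rho> i" for i
    by (auto split: nat.split)
  then show ?thesis by (simp add: msub_msub)
qed

lemma msub_mshift_ind: "msub (ilift \<sigma>) \<rho> (mshift_ind \<phi>) = mshift_ind (msub \<sigma> \<rho> \<phi>)"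
  by (simp add: msub_msub ilift_def)

lemma msub_mshift_pred: "msub \<sigma> (rlift \<rho>) (mshift_pred \<phi>) = mshift_pred (msub \<sigma> \<rho> \<phi>)"
  by (simp add: msub_msub rlift_def)

lemma msub_MConj: "msub \<sigma> \<rho> (MConj \<phi>s) = MConj (map (msub \<sigma> \<rho>) \<phi>s)"
  by (induction \<phi>s) simp_all

lemma msub_MDisj: "msub \<sigma> \<rho> (MDisj \<phi>s) = MDisj (map (msub \<sigma> \<rho>) \<phi>s)"
  by (induction \<phi>s) simp_all

lemma mso_form_MConj: "mso_form \<D> (MConj \<phi>s) \<longleftrightarrow> (\<forall>\<phi>\<in>set \<phi>s. mso_form \<D> \<phi>)"
  by (induction \<phi>s) simp_all

lemma mso_form_MDisj: "mso_form \<D> (MDisj \<phi>s) \<longleftrightarrow> (\<forall>\<phi>\<in>set \<phi>s. mso_form \<D> \<phi>)"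
  by (induction \<phi>s) simp_all

lemma ind_term_isub: "ind_term \<D> t \<Longrightarrow> (\<And>i. ind_term \<D> (\<sigma> i)) \<Longrightarrow> ind_term \<D> (isub \<sigma> t)"
  by (induction t) simp_all

lemma ind_term_isubD: "ind_term \<D> (isub \<sigma> t) \<Longrightarrow> ind_term \<D> t"
  by (induction t) simp_all

lemma ind_term_ilift: "(\<And>i. ind_term \<D> (\<sigma> i)) \<Longrightarrow> ind_term \<D> (ilift \<sigma> i)"
  by (auto simp: ilift_def ind_term_isub split: nat.split)

lemma mso_form_msub: "mso_form \<D> \<phi> \<Longrightarrow> (\<And>i. ind_term \<D> (\<sigma> i)) \<Longrightarrow> mso_form \<D> (msub \<sigma> \<rho> \<phi>)"
  by (induction \<phi> arbitrary: \<sigma> \<rho>) (simp_all add: ind_term_isub ind_term_ilift)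

text \<open>The introduction rules for \<exists> see only an instance of their body. That derivable
  formulae are well-formed therefore needs well-formedness to be reflected from an instance.\<close>

lemma mso_form_msubD: "mso_form \<D> (msub \<sigma> \<rho> \<phi>) \<Longrightarrow> mso_form \<D> \<phi>"
  by (induction \<phi> arbitrary: \<sigma> \<rho>) (auto dest: ind_term_isubD)

section \<open>Structural properties of MSO derivations\<close>

lemma mso_prov_form: "mso_prov \<D> \<Gamma> \<phi> \<Longrightarrow> mso_form \<D> \<phi> \<and> (\<forall>\<gamma>\<in>set \<Gamma>. mso_form \<D> \<gamma>)"
  by (induction rule: mso_prov.induct) (auto dest: mso_form_msubD)

text \<open>Equality and comprehension are schemes whose parameters absorb the substitution; the
  other axioms are closed formulae, where only lifted bound indices have to be computed.\<close>

lemma mso_axiom_msub: "mso_axiom \<D> \<phi> \<Longrightarrow> mso_axiom \<D> (msub \<sigma> \<rho> \<phi>)"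
proof (induction rule: mso_axiom.induct)
  case (eq_subst t u \<phi>)
  show ?case
    using mso_axiom.eq_subst[of \<D> "isub \<sigma> t" "isub \<sigma> u" "msub (ilift \<sigma>) \<rho> \<phi>"]
    by (simp add: msub_minst_ind minst_ind_ilift)
next
  case (comprehension \<phi>)
  show ?case
    using mso_axiom.comprehension[of \<D> "msub (ilift \<sigma>) \<rho> \<phi>"]
    by (simp add: msub_mshift_pred) (simp add: ilift_def rlift_def)
next
  case induction
  show ?case
    using mso_axiom.induction[of \<D>]
    by (simp add: msub_MConj comp_def ilift_def rlift_def)
next
  case (succ_inj d)
  show ?case using mso_axiom.succ_inj[of \<D> d] by (simp add: ilift_def)
next
  case (succ_disjoint d d')
  then show ?case using mso_axiom.succ_disjoint[of d d' \<D>] by (simp add: ilift_def)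
next
  case less_irrefl
  show ?case using mso_axiom.less_irrefl[of \<D>] by (simp add: ilift_def)
next
  case less_trans
  show ?case using mso_axiom.less_trans[of \<D>] by (simp add: ilift_def numeral_2_eq_2)
next
  case less_root
  show ?case using mso_axiom.less_root[of \<D>] by (simp add: ilift_def)
next
  case (less_succ d)
  show ?case using mso_axiom.less_succ[of \<D> d] by (simp add: ilift_def)
next
  case eq_refl
  show ?case using mso_axiom.eq_refl[of \<D>] by (simp add: ilift_def)
next
  case (succ_not_root d)
  show ?case using mso_axiom.succ_not_root[of \<D> d] by (simp add: ilift_def)
qed

text \<open>Admissibility of substitution later turns a fresh variable, kept in an unshifted
  context, into the eigenvariable 0 of an elimination rule.\<close>

lemma mso_prov_msub:
  assumes "mso_prov \<D> \<Gamma> \<phi>" and "\<And>i. ind_term \<D> (\<sigma> i)"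
  shows "mso_prov \<D> (map (msub \<sigma> \<rho>) \<Gamma>) (msub \<sigma> \<rho> \<phi>)"
  using assms
proof (induction arbitrary: \<sigma> \<rho> rule: mso_prov.induct)
  case (assm \<phi> \<Gamma>)
  then show ?case by (intro mso_prov.assm) (auto simp: mso_form_msub)
next
  case (ax \<phi> \<Gamma>)
  then show ?case by (intro mso_prov.ax) (auto simp: mso_form_msub mso_axiom_msub)
next
  case (negI \<phi> \<Gamma> \<psi>)
  then show ?case by (auto intro: mso_prov.negI[of _ "msub \<sigma> \<rho> \<phi>" _ "msub \<sigma> \<rho> \<psi>"])
next
  case (negE \<Gamma> \<phi>)
  then show ?case by (auto intro: mso_prov.negE)
next
  case (disjI1 \<Gamma> \<phi> \<psi>)
  then show ?case by (auto intro: mso_prov.disjI1 simp: mso_form_msub)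
next
  case (disjI2 \<Gamma> \<psi> \<phi>)
  then show ?case by (auto intro: mso_prov.disjI2 simp: mso_form_msub)
next
  case (disjE \<Gamma> \<phi> \<psi> \<chi>)
  then show ?case by (auto intro: mso_prov.disjE[of _ _ "msub \<sigma> \<rho> \<phi>" "msub \<sigma> \<rho> \<psi>"])
next
  case (ex_indI \<Gamma> t \<phi>)
  from ex_indI.IH[OF ex_indI.prems] show ?case
    by (auto intro: mso_prov.ex_indI[of _ _ "isub \<sigma> t"] simp: minst_ind_ilift msub_minst_ind)
next
  case (ex_indE \<Gamma> \<phi> \<psi>)
  have "mso_prov \<D> (map (msub \<sigma> \<rho>) \<Gamma>) (MExI (msub (ilift \<sigma>) \<rho> \<phi>))"
    using ex_indE.IH(1) ex_indE.prems by simp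
  moreover have "mso_prov \<D> (msub (ilift \<sigma>) \<rho> \<phi> # map mshift_ind (map (msub \<sigma> \<rho>) \<Gamma>))
      (mshift_ind (msub \<sigma> \<rho> \<psi>))"
    using ex_indE.IH(2)[of "ilift \<sigma>" \<rho>] ex_indE.prems
    by (simp add: ind_term_ilift msub_mshift_ind comp_def)
  ultimately show ?case by (rule mso_prov.ex_indE)
next
  case (ex_predI \<Gamma> X \<phi>)
  have "mso_prov \<D> (map (msub \<sigma> \<rho>) \<Gamma>) (minst_pred (\<rho> X) (msub \<sigma> (rlift \<rho>) \<phi>))"
    using ex_predI.IH[of \<sigma> \<rho>] ex_predI.prems by (simp add: minst_pred_rlift msub_minst_pred)
  then show ?case by (auto intro: mso_prov.ex_predI)
next
  case (ex_predE \<Gamma> \<phi> \<psi>)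
  have "mso_prov \<D> (map (msub \<sigma> \<rho>) \<Gamma>) (MExP (msub \<sigma> (rlift \<rho>) \<phi>))"
    using ex_predE.IH(1) ex_predE.prems by simp
  moreover have "mso_prov \<D> (msub \<sigma> (rlift \<rho>) \<phi> # map mshift_pred (map (msub \<sigma> \<rho>) \<Gamma>))
      (mshift_pred (msub \<sigma> \<rho> \<psi>))"
    using ex_predE.IH(2)[of \<sigma> "rlift \<rho>"] ex_predE.prems
    by (simp add: msub_mshift_pred comp_def)
  ultimately show ?case by (rule mso_prov.ex_predE)
qed

text \<open>Contexts are compared as sets, which covers exchange and contraction too.\<close>

lemma mso_prov_weaken:
  "mso_prov \<D> \<Gamma> \<phi> \<Longrightarrow> set \<Gamma> \<subseteq> set \<Delta> \<Longrightarrow> \<forall>\<gamma>\<in>set \<Delta>. mso_form \<D> \<gamma> \<Longrightarrow> mso_prov \<D> \<Delta> \<phi>"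
proof (induction arbitrary: \<Delta> rule: mso_prov.induct)
  case (assm \<phi> \<Gamma>)
  then show ?case by (auto intro: mso_prov.assm)
next
  case (ax \<phi> \<Gamma>)
  then show ?case by (auto intro: mso_prov.ax)
next
  case (negI \<phi> \<Gamma> \<psi>)
  have "mso_form \<D> \<phi>" using mso_prov_form[OF negI.hyps(1)] by simp
  then have "mso_prov \<D> (\<phi> # \<Delta>) \<psi>" "mso_prov \<D> (\<phi> # \<Delta>) (MNeg \<psi>)"
    using negI.prems by (auto intro!: negI.IH)
  then show ?case by (rule mso_prov.negI)
next
  case (negE \<Gamma> \<phi>)
  then show ?case by (auto intro: mso_prov.negE)
next
  case (disjI1 \<Gamma> \<phi> \<psi>)
  then show ?case by (auto intro: mso_prov.disjI1)
next
  case (disjI2 \<Gamma> \<psi> \<phi>)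
  then show ?case by (auto intro: mso_prov.disjI2)
next
  case (disjE \<Gamma> \<phi> \<psi> \<chi>)
  have "mso_form \<D> \<phi>" "mso_form \<D> \<psi>" using mso_prov_form[OF disjE.hyps(1)] by simp_all
  then have "mso_prov \<D> (\<phi> # \<Delta>) \<chi>" "mso_prov \<D> (\<psi> # \<Delta>) \<chi>"
    using disjE.prems by (auto intro!: disjE.IH(2)[of "\<phi> # \<Delta>"] disjE.IH(3)[of "\<psi> # \<Delta>"])
  with disjE.IH(1)[OF disjE.prems] show ?case by (rule mso_prov.disjE)
next
  case (ex_indI \<Gamma> t \<phi>)
  then show ?case by (auto intro: mso_prov.ex_indI)
next
  case (ex_indE \<Gamma> \<phi> \<psi>)
  have "mso_form \<D> \<phi>" using mso_prov_form[OF ex_indE.hyps(1)] by simp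
  then have "mso_prov \<D> (\<phi> # map mshift_ind \<Delta>) (mshift_ind \<psi>)"
    using ex_indE.prems by (intro ex_indE.IH) (auto simp: mso_form_msub)
  with ex_indE.IH(1)[OF ex_indE.prems] show ?case by (rule mso_prov.ex_indE)
next
  case (ex_predI \<Gamma> X \<phi>)
  then show ?case by (auto intro: mso_prov.ex_predI)
next
  case (ex_predE \<Gamma> \<phi> \<psi>)
  have "mso_form \<D> \<phi>" using mso_prov_form[OF ex_predE.hyps(1)] by simp
  then have "mso_prov \<D> (\<phi> # map mshift_pred \<Delta>) (mshift_pred \<psi>)"
    using ex_predE.prems by (intro ex_predE.IH) (auto simp: mso_form_msub)
  with ex_predE.IH(1)[OF ex_predE.prems] show ?case by (rule mso_prov.ex_predE)
qed

text \<open>The reflexivity axiom is a negated existential; assuming \<open>MFalse\<close> yields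
  that existential with \<open>Root\<close> as witness.\<close>

lemma mso_prov_MTrue: "\<forall>\<gamma>\<in>set \<Gamma>. mso_form \<D> \<gamma> \<Longrightarrow> mso_prov \<D> \<Gamma> MTrue"
proof -
  assume *: "\<forall>\<gamma>\<in>set \<Gamma>. mso_form \<D> \<gamma>"
  have "mso_prov \<D> (MFalse # \<Gamma>) (minst_ind Root (MNeg (MEq (IVar 0) (IVar 0))))"
    using * by (intro mso_prov.assm) auto
  then have "mso_prov \<D> (MFalse # \<Gamma>) (MExI (MNeg (MEq (IVar 0) (IVar 0))))"
    by (rule mso_prov.ex_indI)
  moreover have "mso_prov \<D> (MFalse # \<Gamma>) (MAllI (MEq (IVar 0) (IVar 0)))"
    using * by (intro mso_prov.ax mso_axiom.eq_refl) auto
  ultimately have "mso_prov \<D> \<Gamma> (MNeg MFalse)" by (rule mso_prov.negI)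
  then show ?thesis by (rule mso_prov.negE)
qed

lemma mso_prov_negI_MFalse:
  assumes "mso_prov \<D> (\<phi> # \<Gamma>) MFalse"
  shows "mso_prov \<D> \<Gamma> (MNeg \<phi>)"
  using mso_prov_MTrue assms by (rule mso_prov.negI) (use mso_prov_form[OF assms] in auto)

lemma mso_prov_contradiction:
  assumes "mso_prov \<D> \<Gamma> \<phi>" and "mso_prov \<D> \<Gamma> (MNeg \<phi>)" and "mso_form \<D> \<psi>"
  shows "mso_prov \<D> \<Gamma> \<psi>"
proof -
  have *: "\<forall>\<gamma>\<in>set (MNeg \<psi> # \<Gamma>). mso_form \<D> \<gamma>"
    using mso_prov_form[OF assms(1)] assms(3) by auto
  have "mso_prov \<D> (MNeg \<psi> # \<Gamma>) \<phi>" "mso_prov \<D> (MNeg \<psi> # \<Gamma>) (MNeg \<phi>)"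
    using assms(1,2) * by (auto elim!: mso_prov_weaken)
  then have "mso_prov \<D> \<Gamma> (MNeg (MNeg \<psi>))" by (rule mso_prov.negI)
  then show ?thesis by (rule mso_prov.negE)
qed

section \<open>Fresh variables as witnesses\<close>

primrec mbound :: "nat \<Rightarrow> nat \<Rightarrow> mfm \<Rightarrow> bool" where
  "mbound a b (MPred X t) \<longleftrightarrow> X < b \<and> ibound a t"
| "mbound a b (MEq t u) \<longleftrightarrow> ibound a t \<and> ibound a u"
| "mbound a b (MLess t u) \<longleftrightarrow> ibound a t \<and> ibound a u"
| "mbound a b (MNeg \<phi>) \<longleftrightarrow> mbound a b \<phi>"
| "mbound a b (MOr \<phi> \<psi>) \<longleftrightarrow> mbound a b \<phi> \<and> mbound a b \<psi>"
| "mbound a b (MExI \<phi>) \<longleftrightarrow> mbound (Suc a) b \<phi>"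
| "mbound a b (MExP \<phi>) \<longleftrightarrow> mbound a (Suc b) \<phi>"

lemma isub_cong_ibound: "ibound a t \<Longrightarrow> (\<And>i. i < a \<Longrightarrow> \<sigma> i = \<sigma>' i) \<Longrightarrow> isub \<sigma> t = isub \<sigma>' t"
  by (induction t) simp_all

lemma msub_cong_mbound:
  "mbound a b \<phi> \<Longrightarrow> (\<And>i. i < a \<Longrightarrow> \<sigma> i = \<sigma>' i) \<Longrightarrow> (\<And>i. i < b \<Longrightarrow> \<rho> i = \<rho>' i) \<Longrightarrow>
   msub \<sigma> \<rho> \<phi> = msub \<sigma>' \<rho>' \<phi>"
proof (induction \<phi> arbitrary: a b \<sigma> \<sigma>' \<rho> \<rho>')
  case (MExI \<phi>)
  have "msub (ilift \<sigma>) \<rho> \<phi> = msub (ilift \<sigma>') \<rho>' \<phi>"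
    by (rule MExI.IH[of "Suc a" b]) (use MExI.prems in \<open>auto simp: ilift_def split: nat.split\<close>)
  then show ?case by simp
next
  case (MExP \<phi>)
  have "msub \<sigma> (rlift \<rho>) \<phi> = msub \<sigma>' (rlift \<rho>') \<phi>"
    by (rule MExP.IH[of a "Suc b"]) (use MExP.prems in \<open>auto simp: rlift_def split: nat.split\<close>)
  then show ?case by simp
next
  case (MOr \<phi> \<psi>)
  have "msub \<sigma> \<rho> \<phi> = msub \<sigma>' \<rho>' \<phi>" "msub \<sigma> \<rho> \<psi> = msub \<sigma>' \<rho>' \<psi>"
    using MOr.prems MOr.IH[of a b \<sigma> \<sigma>' \<rho> \<rho>'] by simp_all
  then show ?case by simp
next
  case (MNeg \<phi>)
  have "msub \<sigma> \<rho> \<phi> = msub \<sigma>' \<rho>' \<phi>"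
    by (rule MNeg.IH[of a b]) (use MNeg.prems in simp_all)
  then show ?case by simp
next
  case (MPred X t)
  then show ?case using isub_cong_ibound[of a t \<sigma> \<sigma>'] by simp
next
  case (MEq t u)
  then show ?case
    using isub_cong_ibound[of a t \<sigma> \<sigma>'] isub_cong_ibound[of a u \<sigma> \<sigma>'] by simp
next
  case (MLess t u)
  then show ?case
    using isub_cong_ibound[of a t \<sigma> \<sigma>'] isub_cong_ibound[of a u \<sigma> \<sigma>'] by simp
qed

lemma ibound_mono: "ibound a t \<Longrightarrow> a \<le> a' \<Longrightarrow> ibound a' t"
  by (induction t) simp_all

lemma mbound_mono: "mbound a b \<phi> \<Longrightarrow> a \<le> a' \<Longrightarrow> b \<le> b' \<Longrightarrow> mbound a' b' \<phi>"
proof (induction \<phi> arbitrary: a b a' b')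
  case (MExI \<phi>)
  then show ?case using MExI.IH[of "Suc a" b "Suc a'" b'] by simp
next
  case (MExP \<phi>)
  then show ?case using MExP.IH[of a "Suc b" a' "Suc b'"] by simp
qed (auto intro: ibound_mono)

lemma ex_ibound: "\<exists>a. ibound a t"
  by (induction t) auto

lemma ex_mbound: "\<exists>n. mbound n n \<phi>"
proof (induction \<phi>)
  case (MPred X t)
  obtain a where "ibound a t" using ex_ibound by blast
  then have "mbound (max a (Suc X)) (max a (Suc X)) (MPred X t)" by (auto elim: ibound_mono)
  then show ?case by blast
next
  case (MEq t u)
  obtain a b where "ibound a t" "ibound b u" using ex_ibound by metis
  then have "mbound (max a b) (max a b) (MEq t u)" by (auto elim: ibound_mono)
  then show ?case by blast
next
  case (MLess t u)
  obtain a b where "ibound a t" "ibound b u" using ex_ibound by metis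
  then have "mbound (max a b) (max a b) (MLess t u)" by (auto elim: ibound_mono)
  then show ?case by blast
next
  case (MOr \<phi> \<psi>)
  then obtain a b where "mbound a a \<phi>" "mbound b b \<psi>" by blast
  then have "mbound (max a b) (max a b) (MOr \<phi> \<psi>)" by (auto elim: mbound_mono)
  then show ?case by blast
next
  case (MExI \<phi>)
  then obtain a where "mbound a a \<phi>" by blast
  then have "mbound a a (MExI \<phi>)" by (auto elim: mbound_mono)
  then show ?case by blast
next
  case (MExP \<phi>)
  then obtain a where "mbound a a \<phi>" by blast
  then have "mbound a a (MExP \<phi>)" by (auto elim: mbound_mono)
  then show ?case by blast
qed auto

lemma ex_mbound_list: "\<exists>n. \<forall>\<phi>\<in>set \<Gamma>. mbound n n \<phi>"
proof (induction \<Gamma>)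
  case (Cons \<phi> \<Gamma>)
  then obtain a b where "mbound a a \<phi>" "\<forall>\<phi>\<in>set \<Gamma>. mbound b b \<phi>" using ex_mbound by metis
  then have "\<forall>\<phi>\<in>set (\<phi> # \<Gamma>). mbound (max a b) (max a b) \<phi>"
    by (auto intro: mbound_mono[of a a] mbound_mono[of b b])
  then show ?case by blast
qed simp

text \<open>The elimination rule reserves index 0 and shifts the context, whereas the Henkin
  construction never shifts and takes an index above all free ones. On formulae bounded by
  \<open>n\<close> the substitution \<sigma> coincides with the shift, which reduces this form to
  the rule.\<close>

lemma mso_prov_ex_ind_fresh:
  assumes ex: "mso_prov \<D> \<Gamma> (MExI \<phi>)"
    and inst: "mso_prov \<D> (minst_ind (IVar n) \<phi> # \<Gamma>) MFalse"
    and bd: "\<forall>\<gamma>\<in>set (MExI \<phi> # \<Gamma>). mbound n n \<gamma>"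
  shows "mso_prov \<D> \<Gamma> MFalse"
proof -
  define \<sigma> where "\<sigma> i = (if i = n then IVar 0 else IVar (Suc i))" for i
    \<comment> \<open>turns the fresh variable into the eigenvariable\<close>
  have "msub \<sigma> (\<lambda>i. i) (minst_ind (IVar n) \<phi>) = \<phi>"
  proof -
    have "msub (case_nat (IVar 0) \<sigma>) (\<lambda>i. i) \<phi> = msub IVar (\<lambda>i. i) \<phi>"
      by (rule msub_cong_mbound[of "Suc n" n]) (use bd in \<open>auto simp: \<sigma>_def split: nat.split\<close>)
    then show ?thesis by (simp add: msub_minst_ind \<sigma>_def)
  qed
  moreover have "map (msub \<sigma> (\<lambda>i. i)) \<Gamma> = map mshift_ind \<Gamma>"
  proof (rule map_cong[OF refl])
    fix \<gamma> assume "\<gamma> \<in> set \<Gamma>"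
    then show "msub \<sigma> (\<lambda>i. i) \<gamma> = mshift_ind \<gamma>"
      by (intro msub_cong_mbound[of n n]) (use bd in \<open>auto simp: \<sigma>_def\<close>)
  qed
  moreover have "mso_prov \<D> (map (msub \<sigma> (\<lambda>i. i)) (minst_ind (IVar n) \<phi> # \<Gamma>))
      (msub \<sigma> (\<lambda>i. i) MFalse)"
    using inst by (rule mso_prov_msub) (simp add: \<sigma>_def)
  ultimately have "mso_prov \<D> (\<phi> # map mshift_ind \<Gamma>) (mshift_ind MFalse)"
    by (simp del: map_eq_conv)
  with ex show ?thesis by (rule mso_prov.ex_indE)
qed

lemma mso_prov_ex_pred_fresh:
  assumes ex: "mso_prov \<D> \<Gamma> (MExP \<phi>)"
    and inst: "mso_prov \<D> (minst_pred n \<phi> # \<Gamma>) MFalse"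
    and bd: "\<forall>\<gamma>\<in>set (MExP \<phi> # \<Gamma>). mbound n n \<gamma>"
  shows "mso_prov \<D> \<Gamma> MFalse"
proof -
  define \<rho> where "\<rho> i = (if i = n then 0 else Suc i)" for i
  have "msub IVar \<rho> (minst_pred n \<phi>) = \<phi>"
  proof -
    have "msub IVar (case_nat 0 \<rho>) \<phi> = msub IVar (\<lambda>i. i) \<phi>"
      by (rule msub_cong_mbound[of n "Suc n"]) (use bd in \<open>auto simp: \<rho>_def split: nat.split\<close>)
    then show ?thesis by (simp add: msub_minst_pred \<rho>_def)
  qed
  moreover have "map (msub IVar \<rho>) \<Gamma> = map mshift_pred \<Gamma>"
  proof (rule map_cong[OF refl])
    fix \<gamma> assume "\<gamma> \<in> set \<Gamma>"
    then show "msub IVar \<rho> \<gamma> = mshift_pred \<gamma>"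
      by (intro msub_cong_mbound[of n n]) (use bd in \<open>auto simp: \<rho>_def\<close>)
  qed
  moreover have "mso_prov \<D> (map (msub IVar \<rho>) (minst_pred n \<phi> # \<Gamma>)) (msub IVar \<rho> MFalse)"
    using inst by (rule mso_prov_msub) simp
  ultimately have "mso_prov \<D> (\<phi> # map mshift_pred \<Gamma>) (mshift_pred MFalse)"
    by (simp del: map_eq_conv)
  with ex show ?thesis by (rule mso_prov.ex_predE)
qed

section \<open>Finite consistent contexts and their extension\<close>

definition consistent :: "hf \<Rightarrow> mfm list \<Rightarrow> bool" where
  "consistent \<D> \<Gamma> \<longleftrightarrow> (\<forall>\<gamma>\<in>set \<Gamma>. mso_form \<D> \<gamma>) \<and> \<not> mso_prov \<D> \<Gamma> MFalse"

text \<open>Rejection is stated as refutability, so that a formula inconsistent with the list leaves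
  the list unchanged. Acceptance of an existential includes a witness; hence one step per formula
  serves both maximality and the Henkin property.\<close>

definition decides :: "hf \<Rightarrow> mfm list \<Rightarrow> mfm \<Rightarrow> bool" where
  "decides \<D> \<Gamma> \<phi> \<longleftrightarrow> mso_prov \<D> \<Gamma> (MNeg \<phi>) \<or>
     \<phi> \<in> set \<Gamma> \<and> (\<forall>\<psi>. \<phi> = MExI \<psi> \<longrightarrow> (\<exists>n. minst_ind (IVar n) \<psi> \<in> set \<Gamma>)) \<and>
       (\<forall>\<psi>. \<phi> = MExP \<psi> \<longrightarrow> (\<exists>n. minst_pred n \<psi> \<in> set \<Gamma>))"

lemma decides_MExI: "MExI \<psi> \<in> set \<Gamma> \<Longrightarrow> minst_ind (IVar n) \<psi> \<in> set \<Gamma> \<Longrightarrow> decides \<D> \<Gamma> (MExI \<psi>)"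
  unfolding decides_def by blast

lemma decides_MExP: "MExP \<psi> \<in> set \<Gamma> \<Longrightarrow> minst_pred n \<psi> \<in> set \<Gamma> \<Longrightarrow> decides \<D> \<Gamma> (MExP \<psi>)"
  unfolding decides_def by blast

lemma consistent_extend:
  assumes "consistent \<D> \<Gamma>"
  shows "\<exists>\<Delta>. consistent \<D> \<Delta> \<and> set \<Gamma> \<subseteq> set \<Delta> \<and> (mso_form \<D> \<phi> \<longrightarrow> decides \<D> \<Delta> \<phi>)"
proof -
  consider (form) "\<not> mso_form \<D> \<phi>" | (neg) "mso_form \<D> \<phi>" "\<not> consistent \<D> (\<phi> # \<Gamma>)"
    | (pos) "mso_form \<D> \<phi>" "consistent \<D> (\<phi> # \<Gamma>)" by blast
  then show ?thesis
  proof cases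
    case form
    then show ?thesis using assms by (intro exI[of _ \<Gamma>]) simp
  next
    case neg
    then have "mso_prov \<D> (\<phi> # \<Gamma>) MFalse" using assms by (auto simp: consistent_def)
    then have "decides \<D> \<Gamma> \<phi>" by (simp add: decides_def mso_prov_negI_MFalse)
    then show ?thesis using assms by (intro exI[of _ \<Gamma>]) simp
  next
    case pos
    obtain n where n: "\<forall>\<gamma>\<in>set (\<phi> # \<phi> # \<Gamma>). mbound n n \<gamma>" using ex_mbound_list by blast
    have \<phi>: "mso_prov \<D> (\<phi> # \<Gamma>) \<phi>"
      using pos by (intro mso_prov.assm) (auto simp: consistent_def)
    have ext: "consistent \<D> (\<psi> # \<phi> # \<Gamma>)"
      if "mso_form \<D> \<psi>" "mso_prov \<D> (\<psi> # \<phi> # \<Gamma>) MFalse \<Longrightarrow> mso_prov \<D> (\<phi> # \<Gamma>) MFalse" for \<psi>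
      using that pos unfolding consistent_def by auto
    consider (ind) \<psi> where "\<phi> = MExI \<psi>" | (pred) \<psi> where "\<phi> = MExP \<psi>"
      | (other) "\<forall>\<psi>. \<phi> \<noteq> MExI \<psi>" "\<forall>\<psi>. \<phi> \<noteq> MExP \<psi>" by blast
    then show ?thesis
    proof cases
      case ind
      have "mso_form \<D> (minst_ind (IVar n) \<psi>)"
        using pos(1) ind by (intro mso_form_msub) (auto split: nat.split)
      moreover have "mso_prov \<D> (\<phi> # \<Gamma>) MFalse"
        if inst: "mso_prov \<D> (minst_ind (IVar n) \<psi> # \<phi> # \<Gamma>) MFalse"
      proof (rule mso_prov_ex_ind_fresh)
        show "mso_prov \<D> (\<phi> # \<Gamma>) (MExI \<psi>)" using \<phi> ind by simp
        show "mso_prov \<D> (minst_ind (IVar n) \<psi> # \<phi> # \<Gamma>) MFalse" by (rule inst)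
        show "\<forall>\<gamma>\<in>set (MExI \<psi> # \<phi> # \<Gamma>). mbound n n \<gamma>" using n ind by simp
      qed
      ultimately have "consistent \<D> (minst_ind (IVar n) \<psi> # \<phi> # \<Gamma>)" by (rule ext)
      moreover have "decides \<D> (minst_ind (IVar n) \<psi> # \<phi> # \<Gamma>) \<phi>"
        unfolding ind by (rule decides_MExI[of _ _ n]) simp_all
      ultimately show ?thesis
        by (intro exI[of _ "minst_ind (IVar n) \<psi> # \<phi> # \<Gamma>"]) auto
    next
      case pred
      have "mso_form \<D> (minst_pred n \<psi>)"
        using pos(1) pred by (intro mso_form_msub) (auto split: nat.split)
      moreover have "mso_prov \<D> (\<phi> # \<Gamma>) MFalse"
        if inst: "mso_prov \<D> (minst_pred n \<psi> # \<phi> # \<Gamma>) MFalse"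
      proof (rule mso_prov_ex_pred_fresh)
        show "mso_prov \<D> (\<phi> # \<Gamma>) (MExP \<psi>)" using \<phi> pred by simp
        show "mso_prov \<D> (minst_pred n \<psi> # \<phi> # \<Gamma>) MFalse" by (rule inst)
        show "\<forall>\<gamma>\<in>set (MExP \<psi> # \<phi> # \<Gamma>). mbound n n \<gamma>" using n pred by simp
      qed
      ultimately have "consistent \<D> (minst_pred n \<psi> # \<phi> # \<Gamma>)" by (rule ext)
      moreover have "decides \<D> (minst_pred n \<psi> # \<phi> # \<Gamma>) \<phi>"
        unfolding pred by (rule decides_MExP[of _ _ n]) simp_all
      ultimately show ?thesis
        by (intro exI[of _ "minst_pred n \<psi> # \<phi> # \<Gamma>"]) auto
    next
      case other
      then have "decides \<D> (\<phi> # \<Gamma>) \<phi>" unfolding decides_def by simp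
      then show ?thesis using pos(2) by (intro exI[of _ "\<phi> # \<Gamma>"]) auto
    qed
  qed
qed

text \<open>Ackermann's coding: the binary digits of the code mark the codes of the elements.
  Individuals mention directions, which are HF-sets, so this is what makes the formulae of MSO
  enumerable.\<close>

primrec hf_code :: "hf \<Rightarrow> nat" where
  "hf_code (HF A) = set_encode (fset (hf_code |`| A))"

lemma hf_code_inj: "hf_code x = hf_code y \<Longrightarrow> x = y"
proof (induction x arbitrary: y)
  case (HF A)
  obtain B where y: "y = HF B" by (cases y)
  have "fset (hf_code |`| A) = fset (hf_code |`| B)"
    by (rule inj_onD[OF inj_on_set_encode]) (use HF.prems y in simp_all)
  then have AB: "hf_code ` fset A = hf_code ` fset B" by simp
  have "fset A = fset B"
  proof
    show "fset A \<subseteq> fset B"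
    proof
      fix x assume x: "x \<in> fset A"
      then obtain z where "z \<in> fset B" "hf_code x = hf_code z" using AB by blast
      with HF.IH[OF x] show "x \<in> fset B" by blast
    qed
    show "fset B \<subseteq> fset A"
    proof
      fix z assume "z \<in> fset B"
      then obtain x where "x \<in> fset A" "hf_code x = hf_code z" using AB by force
      with HF.IH show "z \<in> fset A" by blast
    qed
  qed
  then show ?case using y by (simp add: fset_inject)
qed

instance hf :: countable
  by (rule countable_classI[of hf_code]) (rule hf_code_inj)

instance ind :: countable
  by countable_datatype

instance mfm :: countable
  by countable_datatype

text \<open>The truth conditions of a maximal theory with witnesses. Individuals are all well-formed
  terms, open ones included, and Predicates are variables. Terms that the theory makes equal remain
  distinct Individuals.\<close>

locale henkin =
  fixes \<D> :: hf and M :: "mfm \<Rightarrow> bool"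
  assumes M_neg: "mso_form \<D> \<phi> \<Longrightarrow> M (MNeg \<phi>) \<longleftrightarrow> \<not> M \<phi>"
    and M_or: "mso_form \<D> \<phi> \<Longrightarrow> mso_form \<D> \<psi> \<Longrightarrow> M (MOr \<phi> \<psi>) \<longleftrightarrow> M \<phi> \<or> M \<psi>"
    and M_exI: "mso_form \<D> \<phi> \<Longrightarrow> M (MExI \<phi>) \<longleftrightarrow> (\<exists>t. ind_term \<D> t \<and> M (minst_ind t \<phi>))"
    and M_exP: "mso_form \<D> \<phi> \<Longrightarrow> M (MExP \<phi>) \<longleftrightarrow> (\<exists>X. M (minst_pred X \<phi>))"
    and M_axiom: "mso_axiom \<D> \<phi> \<Longrightarrow> mso_form \<D> \<phi> \<Longrightarrow> M \<phi>"

theorem mso_completeness: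
  assumes form: "mso_form \<D> \<phi>" and valid: "\<And>M. henkin \<D> M \<Longrightarrow> M \<phi>"
  shows "mso_prov \<D> [] \<phi>"
proof (rule ccontr)
  assume unprov: "\<not> mso_prov \<D> [] \<phi>"
  have "consistent \<D> [MNeg \<phi>]"
    using form unprov mso_prov_negI_MFalse[of \<D> "MNeg \<phi>" "[]"]
    by (auto simp: consistent_def dest: mso_prov.negE)
  \<comment> \<open>The step out of stage \<open>n\<close> decides the formula with code
    \<open>n\<close>. The first stage is fixed so that the negation of \<phi> stays in the
    limit.\<close>
  then have "\<exists>\<Delta>. \<forall>n. (consistent \<D> (\<Delta> n) \<and> (n = 0 \<longrightarrow> \<Delta> n = [MNeg \<phi>])) \<and>
      set (\<Delta> n) \<subseteq> set (\<Delta> (Suc n)) \<and>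
      (mso_form \<D> (from_nat n) \<longrightarrow> decides \<D> (\<Delta> (Suc n)) (from_nat n))"
    using consistent_extend by (intro dependent_nat_choice) simp_all
  then obtain \<Delta> where \<Delta>0: "\<forall>n. consistent \<D> (\<Delta> n) \<and> (n = 0 \<longrightarrow> \<Delta> n = [MNeg \<phi>])"
    and step: "\<forall>n. set (\<Delta> n) \<subseteq> set (\<Delta> (Suc n)) \<and>
        (mso_form \<D> (from_nat n) \<longrightarrow> decides \<D> (\<Delta> (Suc n)) (from_nat n))"
    by blast
  \<comment> \<open>Membership is derivability from some stage, so the introduction rules give the
    right-to-left halves of the conditions on \<or> and \<exists>.\<close>
  define M where "M \<psi> \<longleftrightarrow> (\<exists>n. mso_prov \<D> (\<Delta> n) \<psi>)" for \<psi>
  have mono: "m \<le> n \<Longrightarrow> set (\<Delta> m) \<subseteq> set (\<Delta> n)" for m n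
    using step lift_Suc_mono_le[of "\<lambda>n. set (\<Delta> n)"] by blast
  have forms: "\<forall>\<gamma>\<in>set (\<Delta> n). mso_form \<D> \<gamma>" and cons: "\<not> mso_prov \<D> (\<Delta> n) MFalse" for n
    using \<Delta>0 by (auto simp: consistent_def)
  have up: "mso_prov \<D> (\<Delta> m) \<psi> \<Longrightarrow> m \<le> n \<Longrightarrow> mso_prov \<D> (\<Delta> n) \<psi>" for m n \<psi>
    using mono forms by (blast intro: mso_prov_weaken)
  have M_form: "mso_form \<D> \<psi>" if "M \<psi>" for \<psi>
    using that mso_prov_form by (auto simp: M_def)
  have M_contr: False if contr: "M \<psi>" "M (MNeg \<psi>)" for \<psi>
  proof -
    obtain m n where "mso_prov \<D> (\<Delta> m) \<psi>" "mso_prov \<D> (\<Delta> n) (MNeg \<psi>)"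
      using contr unfolding M_def by blast
    then have "mso_prov \<D> (\<Delta> (max m n)) \<psi>" "mso_prov \<D> (\<Delta> (max m n)) (MNeg \<psi>)"
      using up[of m \<psi> "max m n"] up[of n "MNeg \<psi>" "max m n"] by simp_all
    then have "mso_prov \<D> (\<Delta> (max m n)) MFalse" by (rule mso_prov_contradiction) simp
    then show False using cons by blast
  qed
  have dec: "\<exists>n. decides \<D> (\<Delta> n) \<psi>" if "mso_form \<D> \<psi>" for \<psi>
    using step[rule_format, of "to_nat \<psi>"] that by auto
  have M_mem: "M \<psi>" if "\<psi> \<in> set (\<Delta> n)" for n \<psi>
    using that forms by (auto simp: M_def intro: mso_prov.assm)
  have neg: "M (MNeg \<psi>) \<longleftrightarrow> \<not> M \<psi>" if \<psi>: "mso_form \<D> \<psi>" for \<psi>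
  proof
    assume "M (MNeg \<psi>)"
    then show "\<not> M \<psi>" using M_contr by blast
  next
    assume "\<not> M \<psi>"
    moreover obtain n where "decides \<D> (\<Delta> n) \<psi>" using dec[OF \<psi>] by blast
    ultimately show "M (MNeg \<psi>)" using M_mem[of \<psi> n] unfolding decides_def M_def by blast
  qed
  have "henkin \<D> M"
  proof
    fix \<psi> assume \<psi>: "mso_form \<D> \<psi>"
    show "M (MNeg \<psi>) \<longleftrightarrow> \<not> M \<psi>" using \<psi> by (rule neg)
    show "M (MOr \<psi> \<chi>) \<longleftrightarrow> M \<psi> \<or> M \<chi>" if \<chi>: "mso_form \<D> \<chi>" for \<chi>
    proof
      assume or: "M (MOr \<psi> \<chi>)"
      show "M \<psi> \<or> M \<chi>"
      proof (rule ccontr)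
        assume "\<not> (M \<psi> \<or> M \<chi>)"
        then have "M (MNeg \<psi>)" "M (MNeg \<chi>)" using neg \<psi> \<chi> by auto
        then obtain k l m where "mso_prov \<D> (\<Delta> k) (MNeg \<psi>)" "mso_prov \<D> (\<Delta> l) (MNeg \<chi>)"
          "mso_prov \<D> (\<Delta> m) (MOr \<psi> \<chi>)" using or unfolding M_def by blast
        moreover define n where "n = max k (max l m)"
        then have "k \<le> n" "l \<le> n" "m \<le> n" by auto
        ultimately have n: "mso_prov \<D> (\<Delta> n) (MNeg \<psi>)" "mso_prov \<D> (\<Delta> n) (MNeg \<chi>)"
          "mso_prov \<D> (\<Delta> n) (MOr \<psi> \<chi>)" by (blast intro: up)+
        have "mso_prov \<D> (\<theta> # \<Delta> n) MFalse" if "mso_prov \<D> (\<Delta> n) (MNeg \<theta>)" "mso_form \<D> \<theta>" for \<theta>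
        proof (rule mso_prov_contradiction)
          show "mso_prov \<D> (\<theta> # \<Delta> n) \<theta>" using that forms by (intro mso_prov.assm) auto
          show "mso_prov \<D> (\<theta> # \<Delta> n) (MNeg \<theta>)"
            using that forms by (intro mso_prov_weaken[OF that(1)]) auto
        qed simp
        from mso_prov.disjE[OF n(3) this[OF n(1) \<psi>] this[OF n(2) \<chi>]]
        have "mso_prov \<D> (\<Delta> n) MFalse" .
        then show False using cons by blast
      qed
    next
      assume "M \<psi> \<or> M \<chi>"
      then show "M (MOr \<psi> \<chi>)"
        using \<psi> \<chi> by (auto simp: M_def intro: mso_prov.disjI1 mso_prov.disjI2)
    qed
    show "M (MExI \<psi>) \<longleftrightarrow> (\<exists>t. ind_term \<D> t \<and> M (minst_ind t \<psi>))"
    proof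
      assume "M (MExI \<psi>)"
      then have "\<not> mso_prov \<D> (\<Delta> n) (MNeg (MExI \<psi>))" for n using M_contr unfolding M_def by blast
      moreover obtain n where "decides \<D> (\<Delta> n) (MExI \<psi>)" using dec[of "MExI \<psi>"] \<psi> by auto
      ultimately obtain k where "minst_ind (IVar k) \<psi> \<in> set (\<Delta> n)"
        unfolding decides_def by blast
      then show "\<exists>t. ind_term \<D> t \<and> M (minst_ind t \<psi>)" using M_mem ind_term.simps(1) by blast
    qed (unfold M_def, blast intro: mso_prov.ex_indI)
    show "M (MExP \<psi>) \<longleftrightarrow> (\<exists>X. M (minst_pred X \<psi>))"
    proof
      assume "M (MExP \<psi>)"
      then have "\<not> mso_prov \<D> (\<Delta> n) (MNeg (MExP \<psi>))" for n using M_contr unfolding M_def by blast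
      moreover obtain n where "decides \<D> (\<Delta> n) (MExP \<psi>)" using dec[of "MExP \<psi>"] \<psi> by auto
      ultimately obtain k where "minst_pred k \<psi> \<in> set (\<Delta> n)"
        unfolding decides_def by blast
      then show "\<exists>X. M (minst_pred X \<psi>)" using M_mem by blast
    qed (unfold M_def, blast intro: mso_prov.ex_predI)
    show "M \<psi>" if "mso_axiom \<D> \<psi>"
      using that \<psi> forms[of 0] by (auto simp: M_def intro: mso_prov.ax)
  qed
  then have "M \<phi>" by (rule valid)
  moreover have "M (MNeg \<phi>)" using M_mem[of "MNeg \<phi>" 0] \<Delta>0 by simp
  ultimately show False by (rule M_contr)
qed

section \<open>Soundness of Skolemized set theory in \<open>V\<^sub>\<omega>\<close>\<close>

lemma enumeration: "finite A \<Longrightarrow> distinct (enumeration A) \<and> set (enumeration A) = A"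
  unfolding enumeration_def by (rule someI_ex) (use finite_distinct_list in blast)

lemma set_members [simp]: "set (members \<kappa>) = {l. l |\<in>| elts \<kappa>}"
  and distinct_members [simp]: "distinct (members \<kappa>)"
  using enumeration[of "{l. l |\<in>| elts \<kappa>}"] by (simp_all add: members_def)

lemma finite_subsets: "finite {l. elts l |\<subseteq>| elts \<kappa>}"
proof -
  have "{l. elts l |\<subseteq>| elts \<kappa>} \<subseteq> HF ` fset (fPow (elts \<kappa>))"
  proof
    fix l assume "l \<in> {l. elts l |\<subseteq>| elts \<kappa>}"
    then show "l \<in> HF ` fset (fPow (elts \<kappa>))" by (intro image_eqI[of _ _ "elts l"]) simp_all
  qed
  then show ?thesis by (rule finite_subset) simp
qed

lemma set_subsets [simp]: "set (subsets \<kappa>) = {l. elts l |\<subseteq>| elts \<kappa>}"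
  using enumeration[OF finite_subsets[of \<kappa>]] by (simp add: subsets_def)

lemma hf_eqI: "(\<And>l. l |\<in>| elts a \<longleftrightarrow> l |\<in>| elts b) \<Longrightarrow> a = b"
  by (cases a, cases b) (auto intro: fset_eqI)

text \<open>Induction along the datatype: an element that meets \<open>a\<close> has a member in
  \<open>a\<close>, so the descent ends at an element that does not meet \<open>a\<close>.\<close>

lemma hf_foundation:
  assumes "x |\<in>| elts a"
  shows "\<exists>y. y |\<in>| elts a \<and> \<not> (\<exists>z. z |\<in>| elts y \<and> z |\<in>| elts a)"
  using assms
proof (induction x)
  case (HF A)
  show ?case
  proof (cases "\<exists>z. z |\<in>| A \<and> z |\<in>| elts a")
    case True
    then show ?thesis using HF.IH by blast
  next
    case False
    then show ?thesis using HF.prems by (intro exI[of _ "HF A"]) auto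
  qed
qed

text \<open>The defining formula is part of the symbol and substitution never enters it. The value
  thus depends on the values of the arguments alone, and the formula half of the joint induction is
  vacuous.\<close>

lemma heval_hsub: "heval (hsub \<tau> K) e = heval K (\<lambda>i. heval (\<tau> i) e)"
proof (induction K rule: hft.induct[where ?P2.0 = "\<lambda>_. True"])
  case (HFun \<phi> Ks)
  then have "map (\<lambda>K. heval K e) (map (hsub \<tau>) Ks) = map (\<lambda>K. heval K (\<lambda>i. heval (\<tau> i) e)) Ks"
    by simp
  then show ?case by (simp only: hsub.simps heval.simps length_map)
qed simp_all

lemma heval_hshift [simp]: "heval (hshift K) (case_nat v e) = heval K e"
  by (simp add: heval_hsub)

lemma heval_hlift: "heval (hlift \<tau> i) (case_nat v e) = case_nat v (\<lambda>i. heval (\<tau> i) e) i"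
  by (simp add: hlift_def split: nat.split)

lemma ssat_ssub: "ssat (ssub \<tau> \<phi>) e \<longleftrightarrow> ssat \<phi> (\<lambda>i. heval (\<tau> i) e)"
  by (induction \<phi> arbitrary: \<tau> e rule: sfm.induct[where ?P1.0 = "\<lambda>_. True"])
    (simp_all add: heval_hsub heval_hlift)

lemma ssat_sinst: "ssat (sinst K \<phi>) e \<longleftrightarrow> ssat \<phi> (case_nat (heval K e) e)"
proof -
  have "(\<lambda>i. heval (case_nat K HVar i) e) = case_nat (heval K e) e"
    by (simp add: fun_eq_iff split: nat.split)
  then show ?thesis by (simp add: ssat_ssub)
qed

lemma ssat_sskip [simp]:
  "ssat (sskip \<phi>) (case_nat a (case_nat b e)) \<longleftrightarrow> ssat \<phi> (case_nat a e)"
proof -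
  have "(\<lambda>i. heval (case_nat (HVar 0) (\<lambda>i. HVar (Suc (Suc i))) i) (case_nat a (case_nat b e))) =
      case_nat a e"
    by (simp add: fun_eq_iff split: nat.split)
  then show ?thesis by (simp add: ssat_ssub)
qed

text \<open>The exchange of value and argument in the replacement axiom, written with
  \<open>Suc\<close> because \<open>ssat_nnf\<close> unfolds numerals.\<close>

lemma ssat_swap:
  "ssat (ssub (case_nat (HVar (Suc 0)) (case_nat (HVar 0) (\<lambda>i. HVar (i + Suc (Suc (Suc 0)))))) \<phi>)
     (case_nat a (case_nat b (case_nat c e))) \<longleftrightarrow> ssat \<phi> (case_nat b (case_nat a e))"
proof -
  have "(\<lambda>i. heval (case_nat (HVar (Suc 0)) (case_nat (HVar 0) (\<lambda>i. HVar (i + Suc (Suc (Suc 0))))) i)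
      (case_nat a (case_nat b (case_nat c e)))) = case_nat b (case_nat a e)"
    by (simp add: fun_eq_iff split: nat.split)
  then show ?thesis by (simp only: ssat_ssub)
qed

lemma ssat_SEx1 [simp]: "ssat (SEx1 \<phi>) e \<longleftrightarrow> (\<exists>!v. ssat \<phi> (case_nat v e))"
  by (simp add: SEx1_def Ex1_def)

lemma ssat_SSub [simp]: "ssat (SSub K L) e \<longleftrightarrow> elts (heval K e) |\<subseteq>| elts (heval L e)"
  by (simp add: SSub_def less_eq_fset.rep_eq subset_eq) auto

lemma ssat_foldr_SOr: "ssat (foldr SOr \<phi>s \<psi>) e \<longleftrightarrow> (\<exists>\<phi>\<in>set \<phi>s. ssat \<phi> e) \<or> ssat \<psi> e"
  by (induction \<phi>s) auto

text \<open>Every environment is \<open>case_nat\<close> of its head and its tail; quantifying over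
  all environments on both sides therefore lets the prefix be dropped one quantifier at a
  time.\<close>

lemma ssat_SAll_funpow: "(\<forall>e. ssat ((SAll ^^ n) \<phi>) e) \<longleftrightarrow> (\<forall>e. ssat \<phi> e)"
proof (induction n)
  case (Suc n)
  have "(\<forall>e. ssat (SAll \<psi>) e) \<longleftrightarrow> (\<forall>e. ssat \<psi> e)" for \<psi>
  proof
    assume *: "\<forall>e. ssat (SAll \<psi>) e"
    show "\<forall>e. ssat \<psi> e"
    proof
      fix e :: "nat \<Rightarrow> hf"
      have "ssat \<psi> (case_nat (e 0) (\<lambda>i. e (Suc i)))" using * by simp
      moreover have "case_nat (e 0) (\<lambda>i. e (Suc i)) = e"
        by (simp add: fun_eq_iff split: nat.split)
      ultimately show "ssat \<psi> e" by simp
    qed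
  qed simp
  with Suc show ?case by (simp only: funpow.simps o_apply)
qed simp

lemma heval_cong_hbound: "hbound n K \<Longrightarrow> (\<And>i. i < n \<Longrightarrow> e i = e' i) \<Longrightarrow> heval K e = heval K e'"
proof (induction K rule: hft.induct[where ?P2.0 = "\<lambda>_. True"])
  case (HFun \<phi> Ks)
  then have "map (\<lambda>K. heval K e) Ks = map (\<lambda>K. heval K e') Ks"
    by (intro map_cong) (simp_all add: list_all_iff)
  then show ?case by (simp only: heval.simps)
qed simp_all

text \<open>The value of a symbol is computed with the empty set at all positions beyond its
  arguments; a bounded defining formula cannot see this filling.\<close>

lemma ssat_cong_sbound: "sbound n \<phi> \<Longrightarrow> \<forall>i<n. e i = e' i \<Longrightarrow> ssat \<phi> e \<longleftrightarrow> ssat \<phi> e'"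
proof (induction \<phi> arbitrary: n e e' rule: sfm.induct[where ?P1.0 = "\<lambda>_. True"])
  case (SEq K L)
  then have "heval K e = heval K e'" "heval L e = heval L e'"
    by (auto intro: heval_cong_hbound)
  then show ?case by simp
next
  case (SMem K L)
  then have "heval K e = heval K e'" "heval L e = heval L e'"
    by (auto intro: heval_cong_hbound)
  then show ?case by simp
next
  case (SNeg \<phi>)
  then have "ssat \<phi> e \<longleftrightarrow> ssat \<phi> e'" by (intro SNeg.IH[of n]) simp_all
  then show ?case by simp
next
  case (SOr \<phi> \<psi>)
  then have "ssat \<phi> e \<longleftrightarrow> ssat \<phi> e'" "ssat \<psi> e \<longleftrightarrow> ssat \<psi> e'"
    by (intro SOr.IH[of n]; simp)+
  then show ?case by simp
next
  case (SEx \<phi>)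
  have "ssat \<phi> (case_nat v e) \<longleftrightarrow> ssat \<phi> (case_nat v e')" for v
  proof (rule SEx.IH)
    show "sbound (Suc n) \<phi>" using SEx.prems(1) by simp
    show "\<forall>i<Suc n. case_nat v e i = case_nat v e' i"
      using SEx.prems(2) by (auto split: nat.split)
  qed
  then show ?case by simp
qed simp_all

text \<open>A common normal form for the axioms, whose derived connectives the simplifier would unfold, and
  for their meanings.\<close>

lemmas ssat_nnf = ssat.simps ssat_SEx1 ssat_SSub ssat_sinst ssat_sskip ssat_swap ssat_foldr_SOr
  heval.simps(1,2) nat.case heval_hshift One_nat_def numeral_2_eq_2 numeral_3_eq_3
  not_ex not_all not_not de_Morgan_conj de_Morgan_disj imp_conv_disj iff_conv_conj_imp

lemma hf_comprehension: "(\<And>z. z |\<in>| A \<longleftrightarrow> P z) \<Longrightarrow> \<exists>c. \<forall>z. z |\<in>| elts c \<longleftrightarrow> P z"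
  by (rule exI[of _ "HF A"]) simp

text \<open>The sets demanded by the axioms arise from finite sets by pairing, image, filter, union
  or power and are therefore finite. Each meaning is proved in plain form first and then identified
  with the axiom through the common normal form.\<close>

lemma zfc_axiom_sound: "zfc_axiom \<phi> \<Longrightarrow> ssat \<phi> e"
proof (induction rule: zfc_axiom.induct)
  case (eq_refl K)
  show ?case by simp
next
  case (eq_subst K L \<phi>)
  have "heval K e = heval L e \<longrightarrow> ssat \<phi> (case_nat (heval K e) e) \<longrightarrow> ssat \<phi> (case_nat (heval L e) e)"
    by simp
  then show ?case by (simp only: ssat_nnf)
next
  case (extensionality K L)
  have "(\<forall>z. z |\<in>| elts (heval K e) \<longleftrightarrow> z |\<in>| elts (heval L e)) \<longrightarrow> heval K e = heval L e"
    using hf_eqI by blast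
  then show ?case by (simp only: ssat_nnf)
next
  case (foundation K)
  have "(\<exists>x. x |\<in>| elts (heval K e)) \<longrightarrow>
      (\<exists>y. y |\<in>| elts (heval K e) \<and> \<not> (\<exists>z. z |\<in>| elts y \<and> z |\<in>| elts (heval K e)))"
    using hf_foundation by blast
  then show ?case by (simp only: ssat_nnf)
next
  case (pairing K L)
  have "\<exists>c. \<forall>z. z |\<in>| elts c \<longleftrightarrow> z = heval K e \<or> z = heval L e"
    by (rule hf_comprehension[of "{|heval K e, heval L e|}"]) simp
  then show ?case by (simp only: ssat_nnf)
next
  case (union K)
  have "\<exists>c. \<forall>z. z |\<in>| elts c \<longleftrightarrow> (\<exists>x. x |\<in>| elts (heval K e) \<and> z |\<in>| elts x)"
    by (rule hf_comprehension[of "ffUnion (elts |`| elts (heval K e))"]) (simp add: ffUnion.rep_eq, blast)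
  then show ?case by (simp only: ssat_nnf)
next
  case (powerset K)
  have "z |\<in>| HF |`| fPow (elts (heval K e)) \<longleftrightarrow> elts z |\<subseteq>| elts (heval K e)" for z
    by (cases z) auto
  from hf_comprehension[OF this] show ?case by (simp only: ssat_nnf)
next
  case (separation K \<phi>)
  have "\<exists>c. \<forall>z. z |\<in>| elts c \<longleftrightarrow> z |\<in>| elts (heval K e) \<and> ssat \<phi> (case_nat z e)"
    by (rule hf_comprehension[of "ffilter (\<lambda>z. ssat \<phi> (case_nat z e)) (elts (heval K e))"]) auto
  then show ?case by (simp only: ssat_nnf)
next
  case (replacement K \<phi>)
  have "\<exists>c. \<forall>y. y |\<in>| elts c \<longleftrightarrow>
      (\<exists>x. x |\<in>| elts (heval K e) \<and> ssat \<phi> (case_nat y (case_nat x e)))"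
    if *: "\<forall>x. x |\<in>| elts (heval K e) \<longrightarrow> (\<exists>!y. ssat \<phi> (case_nat y (case_nat x e)))"
  proof -
    define f where "f x = (THE y. ssat \<phi> (case_nat y (case_nat x e)))" for x
    have f: "ssat \<phi> (case_nat y (case_nat x e)) \<longleftrightarrow> y = f x" if x: "x |\<in>| elts (heval K e)" for x y
      using theI'[OF *[rule_format, OF x]] *[rule_format, OF x] unfolding f_def by blast
    show ?thesis
      by (rule hf_comprehension[of "f |`| elts (heval K e)"]) (use f in blast)
  qed
  then have "(\<forall>x. x |\<in>| elts (heval K e) \<longrightarrow> (\<exists>!y. ssat \<phi> (case_nat y (case_nat x e)))) \<longrightarrow>
      (\<exists>c. \<forall>y. y |\<in>| elts c \<longleftrightarrow>
        (\<exists>x. x |\<in>| elts (heval K e) \<and> ssat \<phi> (case_nat y (case_nat x e))))"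
    by blast
  then show ?case by (simp only: ssat_nnf)
next
  case (choice K)
  have "\<exists>c. \<forall>x. x |\<in>| A \<longrightarrow> (\<exists>!y. y |\<in>| elts x \<and> y |\<in>| elts c)"
    if ne: "\<forall>x. x |\<in>| A \<longrightarrow> (\<exists>y. y |\<in>| elts x)"
      and disj: "\<forall>x. x |\<in>| A \<longrightarrow> (\<forall>y. y |\<in>| A \<longrightarrow>
        (\<exists>z. z |\<in>| elts y \<and> z |\<in>| elts x) \<longrightarrow> y = x)" for A
  proof -
    define f where "f x = (SOME y. y |\<in>| elts x)" for x
    have f: "f x |\<in>| elts x" if "x |\<in>| A" for x
      unfolding f_def by (rule someI_ex) (use ne that in blast)
    have "\<exists>!y. y |\<in>| elts x \<and> y |\<in>| f |`| A" if x: "x |\<in>| A" for x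
    proof (rule ex1I[of _ "f x"])
      show "f x |\<in>| elts x \<and> f x |\<in>| f |`| A" using f x by simp
      fix y assume y: "y |\<in>| elts x \<and> y |\<in>| f |`| A"
      then obtain z where z: "z |\<in>| A" "y = f z" by auto
      \<comment> \<open>If the representative of \<open>z\<close> lies in \<open>x\<close>, the two
        members of the family meet and coincide; so \<open>x\<close> contains no selected element
        but its own.\<close>
      have "f z |\<in>| elts z" using z by (intro f)
      then have "\<exists>w. w |\<in>| elts z \<and> w |\<in>| elts x" using y z(2) by auto
      with disj x z(1) have "z = x" by simp
      then show "y = f x" using z by simp
    qed
    then show ?thesis by (intro exI[of _ "HF (f |`| A)"]) simp
  qed
  from this[of "elts (heval K e)"]
  have "(\<forall>x. x |\<in>| elts (heval K e) \<longrightarrow> (\<exists>y. y |\<in>| elts x)) \<and>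
      (\<forall>x. x |\<in>| elts (heval K e) \<longrightarrow> (\<forall>y. y |\<in>| elts (heval K e) \<longrightarrow>
        (\<exists>z. z |\<in>| elts y \<and> z |\<in>| elts x) \<longrightarrow> y = x)) \<longrightarrow>
      (\<exists>c. \<forall>x. x |\<in>| elts (heval K e) \<longrightarrow> (\<exists>!y. y |\<in>| elts x \<and> y |\<in>| elts c))"
    by blast
  then show ?case by (simp only: ssat_nnf)
next
  case (hf_constant \<kappa>)
  show ?case by (auto simp: ssat_foldr_SOr)
qed

text \<open>The uniqueness statement behind a Skolem symbol is a derivation inside the same
  induction, so its truth is an induction hypothesis. This is what gives the definite description in
  \<open>heval\<close> its meaning.\<close>

lemma sk_prov_sound: "sk_prov \<Gamma> \<phi> \<Longrightarrow> \<forall>e. (\<forall>\<gamma>\<in>set \<Gamma>. ssat \<gamma> e) \<longrightarrow> ssat \<phi> e"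
proof (induction rule: sk_term_sk_form_sk_prov.inducts(3)
    [where ?P1.0 = "\<lambda>_. True" and ?P2.0 = "\<lambda>_. True"])
  case (sk_ax \<phi> \<Gamma>)
  then show ?case by (simp add: zfc_axiom_sound)
next
  case (sk_skolem \<phi> n \<Gamma>)
  have uniq: "\<exists>!v. ssat \<phi> (case_nat v e)" for e
    using sk_skolem.IH by (simp add: ssat_SAll_funpow)
  have "ssat \<phi> (case_nat (heval (HFun \<phi> (map HVar [0..<n])) e) e)" for e
  proof -
    have "ssat \<phi> (case_nat v (\<lambda>i. if i < length (map HVar [0..<n])
        then map (\<lambda>K. heval K e) (map HVar [0..<n]) ! i else hempty)) \<longleftrightarrow>
      ssat \<phi> (case_nat v e)" for v
      by (rule ssat_cong_sbound[OF \<open>sbound (Suc n) \<phi>\<close>]) (auto split: nat.split)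
    then show ?thesis using theI'[OF uniq[of e]] by (simp only: heval.simps)
  qed
  then have "\<forall>e. ssat ((SAll ^^ n) (sinst (HFun \<phi> (map HVar [0..<n])) \<phi>)) e"
    unfolding ssat_SAll_funpow ssat_sinst by blast
  then show ?case by blast
next
  case (sk_exI \<Gamma> K \<phi>)
  then show ?case by (auto simp: ssat_sinst)
next
  case (sk_exE \<Gamma> \<phi> \<psi>)
  then show ?case by (fastforce simp: ssat_ssub)
qed auto

section \<open>Pairs, functions and powers in V_\<omega>\<close>

definition hpair :: "hf \<Rightarrow> hf \<Rightarrow> hf" where
  "hpair a b = HF {|HF {|a|}, HF {|a, b|}|}"

lemma eq_HF_pair_iff: "p = HF {|a, b|} \<longleftrightarrow> (\<forall>z. z |\<in>| elts p \<longleftrightarrow> z = a \<or> z = b)"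
  by (cases p) (simp add: fset_eq_iff)

lemma hpair_inject [simp]: "hpair a b = hpair c d \<longleftrightarrow> a = c \<and> b = d"
proof
  have pair_eq: "HF {|x, y|} = HF {|x, z|} \<longleftrightarrow> y = z" for x y z
    unfolding eq_HF_pair_iff[of "HF {|x, y|}"] hf.sel finsert_iff fempty_iff by metis
  assume eq: "hpair a b = hpair c d"
  \<comment> \<open>The singleton of \<open>a\<close> occurs on the right as {c} or as {c, d};
    either way \<open>c\<close> is its element.\<close>
  then have "HF {|a, a|} = HF {|c, c|} \<or> HF {|a, a|} = HF {|c, d|}"
    by (simp only: hpair_def eq_HF_pair_iff[of "HF _"]) auto
  then have "a = c" by (auto simp: eq_HF_pair_iff)
  with eq show "a = c \<and> b = d" by (simp add: hpair_def) (use pair_eq in metis)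
qed simp

lemma ssat_is_upair [simp]:
  "ssat (is_upair K L P) e \<longleftrightarrow> heval P e = HF {|heval K e, heval L e|}"
  unfolding is_upair_def eq_HF_pair_iff by auto

lemma ssat_is_pair [simp]: "ssat (is_pair K L P) e \<longleftrightarrow> heval P e = hpair (heval K e) (heval L e)"
  unfolding is_pair_def hpair_def eq_HF_pair_iff[of "heval P e"] by auto

lemma ssat_pair_in [simp]:
  "ssat (pair_in K L F) e \<longleftrightarrow> hpair (heval K e) (heval L e) |\<in>| elts (heval F e)"
  unfolding pair_in_def by auto

definition hfunction :: "hf \<Rightarrow> hf \<Rightarrow> hf \<Rightarrow> bool" where
  "hfunction f \<kappa> \<mu> \<longleftrightarrow>
     (\<forall>p. p |\<in>| elts f \<longrightarrow> (\<exists>k l. k |\<in>| elts \<kappa> \<and> l |\<in>| elts \<mu> \<and> p = hpair k l)) \<and>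
     (\<forall>k. k |\<in>| elts \<kappa> \<longrightarrow> (\<exists>!l. hpair k l |\<in>| elts f))"

lemma ssat_is_function [simp]:
  "ssat (is_function F K L) e \<longleftrightarrow> hfunction (heval F e) (heval K e) (heval L e)"
  unfolding is_function_def hfunction_def by (auto simp: numeral_2_eq_2)

definition happly :: "hf \<Rightarrow> hf \<Rightarrow> hf" where
  "happly f k = (if \<exists>!l. hpair k l |\<in>| elts f then THE l. hpair k l |\<in>| elts f else hempty)"

text \<open>By its case distinction the defining formula has exactly one solution for any two sets,
  so the description always denotes.\<close>

lemma heval_happ [simp]: "heval (happ F K) e = happly (heval F e) (heval K e)"
proof -
  have "(THE v. (\<exists>!l. hpair k l |\<in>| elts f) \<and> hpair k v |\<in>| elts f \<or>
      \<not> (\<exists>!l. hpair k l |\<in>| elts f) \<and> v = hempty) = happly f k" for f k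
    unfolding happly_def by auto
  then show ?thesis unfolding happ_def by (simp add: Let_def numeral_2_eq_2 numeral_3_eq_3)
qed

text \<open>Well-formedness of the symbol contains a set-theoretic proof that L^K exists uniquely.
  Soundness carries this over to V_\<omega>, which replaces a construction of L^K.\<close>

lemma elts_hexp:
  assumes "sk_term (hexp L K)"
  shows "f |\<in>| elts (heval (hexp L K) e) \<longleftrightarrow> hfunction f (heval K e) (heval L e)"
proof -
  define \<phi> where
    "\<phi> = SAll (SIff (SMem (HVar 0) (HVar 1)) (is_function (HVar 0) (HVar 3) (HVar 2)))"
  have "sk_term (HFun \<phi> [L, K])" using assms by (simp add: hexp_def \<phi>_def)
  then have "sk_prov [] ((SAll ^^ length [L, K]) (SEx1 \<phi>))" by cases
  from sk_prov_sound[OF this] have "\<forall>e. ssat ((SAll ^^ length [L, K]) (SEx1 \<phi>)) e"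
    by (simp only: list.set ball_empty simp_thms)
  then have "\<exists>!v. ssat \<phi> (case_nat v e)" for e
    unfolding ssat_SAll_funpow ssat_SEx1 by blast
  note uniq = this
  \<comment> \<open>The defining formula reads index 0 as the value, 1 as L and 2 as K; under its
    universal quantifier these become 1, 2 and 3.\<close>
  have sat: "ssat \<phi> (case_nat v (case_nat l (case_nat k E))) \<longleftrightarrow>
      (\<forall>z. z |\<in>| elts v \<longleftrightarrow> hfunction z k l)" for v l k E
    by (auto simp: \<phi>_def numeral_2_eq_2 numeral_3_eq_3)
  have "(\<lambda>i. if i < length [L, K] then map (\<lambda>K. heval K e) [L, K] ! i else hempty) =
      case_nat (heval L e) (case_nat (heval K e) (\<lambda>_. hempty))"
    by (auto simp: fun_eq_iff less_Suc_eq split: nat.split)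
  then have val: "heval (hexp L K) e =
      (THE v. \<forall>z. z |\<in>| elts v \<longleftrightarrow> hfunction z (heval K e) (heval L e))"
    unfolding hexp_def \<phi>_def[symmetric] heval.simps by (simp only: sat)
  have "\<exists>!v. \<forall>z. z |\<in>| elts v \<longleftrightarrow> hfunction z (heval K e) (heval L e)"
    using uniq[of "case_nat (heval L e) (case_nat (heval K e) (\<lambda>_. hempty))"] unfolding sat .
  from theI'[OF this] show ?thesis unfolding val by blast
qed

definition hgraph :: "hf \<Rightarrow> (hf \<Rightarrow> hf) \<Rightarrow> hf" where
  "hgraph \<kappa> g = HF ((\<lambda>k. hpair k (g k)) |`| elts \<kappa>)"

lemma hpair_in_hgraph: "hpair k l |\<in>| elts (hgraph \<kappa> g) \<longleftrightarrow> k |\<in>| elts \<kappa> \<and> l = g k"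
  unfolding hgraph_def by auto

lemma hfunction_hgraph: "(\<And>k. k |\<in>| elts \<kappa> \<Longrightarrow> g k |\<in>| elts \<mu>) \<Longrightarrow> hfunction (hgraph \<kappa> g) \<kappa> \<mu>"
  unfolding hfunction_def hpair_in_hgraph by (auto simp: hgraph_def)

lemma happly_hgraph: "k |\<in>| elts \<kappa> \<Longrightarrow> happly (hgraph \<kappa> g) k = g k"
  unfolding happly_def hpair_in_hgraph by simp

section \<open>The translation under environments\<close>

text \<open>Unlike \<open>transl\<close>, \<open>ftrans\<close> keeps the values of HF-variables in an environment instead of
  substituting constants, and the Predicate indices of a Function need not be consecutive.\<close>

primrec ftrans :: "(nat \<Rightarrow> hf) \<Rightarrow> (nat \<Rightarrow> (hf \<times> nat) list) \<Rightarrow> ffm \<Rightarrow> mfm" where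
  "ftrans e \<eta> (FEq t u) = MEq t u"
| "ftrans e \<eta> (FLess t u) = MLess t u"
| "ftrans e \<eta> (FHEq K L) = (if heval K e = heval L e then MTrue else MFalse)"
| "ftrans e \<eta> (FHMem K L) = (if heval K e |\<in>| elts (heval L e) then MTrue else MFalse)"
| "ftrans e \<eta> (FHSub K L) = (if elts (heval K e) |\<subseteq>| elts (heval L e) then MTrue else MFalse)"
| "ftrans e \<eta> (FApp F t L) =
     MDisj (map (\<lambda>p. MPred (snd p) t) (filter (\<lambda>p. fst p = heval L e) (\<eta> F)))"
| "ftrans e \<eta> (FNeg \<phi>) = MNeg (ftrans e \<eta> \<phi>)"
| "ftrans e \<eta> (FOr \<phi> \<psi>) = MOr (ftrans e \<eta> \<phi>) (ftrans e \<eta> \<psi>)"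
| "ftrans e \<eta> (FExI \<phi>) = MExI (ftrans e \<eta> \<phi>)"
| "ftrans e \<eta> (FExMem K \<phi>) =
     MDisj (map (\<lambda>\<kappa>. ftrans (case_nat \<kappa> e) \<eta> \<phi>) (members (heval K e)))"
| "ftrans e \<eta> (FExSub K \<phi>) =
     MDisj (map (\<lambda>\<kappa>. ftrans (case_nat \<kappa> e) \<eta> \<phi>) (subsets (heval K e)))"
| "ftrans e \<eta> (FExF K \<phi>) =
     (let \<kappa>s = members (heval K e); c = length \<kappa>s
      in (MExP ^^ c) (MAnd (MPart c)
           (ftrans e (case_nat (zip \<kappa>s [0..<c]) (\<lambda>F. map (map_prod id (\<lambda>X. X + c)) (\<eta> F))) \<phi>)))"

lemma msub_MExP_funpow: "msub \<sigma> (\<lambda>i. i) ((MExP ^^ c) \<phi>) = (MExP ^^ c) (msub \<sigma> (\<lambda>i. i) \<phi>)"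
  by (induction c) simp_all

lemma msub_MPart: "msub \<sigma> \<rho> (MPart c) = msub IVar \<rho> (MPart c)"
  by (simp add: MPart_def msub_MConj msub_MDisj map_concat comp_def ilift_def)

text \<open>The sorts behave differently: a substituted HF-term only changes the environment,
  whereas a substituted Individual term survives as a substitution in the output.\<close>

lemma ftrans_fsub:
  "ftrans e \<eta> (fsub \<sigma> \<tau> (\<lambda>i. i) \<phi>) = msub \<sigma> (\<lambda>i. i) (ftrans (\<lambda>i. heval (\<tau> i) e) \<eta> \<phi>)"
proof (induction \<phi> arbitrary: \<sigma> \<tau> e \<eta>)
  case (FExMem K \<phi>)
  have "(\<lambda>i. heval (hlift \<tau> i) (case_nat \<kappa> e)) = case_nat \<kappa> (\<lambda>i. heval (\<tau> i) e)" for \<kappa>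
    by (simp only: heval_hlift)
  with FExMem show ?case by (simp add: heval_hsub msub_MDisj comp_def)
next
  case (FExSub K \<phi>)
  have "(\<lambda>i. heval (hlift \<tau> i) (case_nat \<kappa> e)) = case_nat \<kappa> (\<lambda>i. heval (\<tau> i) e)" for \<kappa>
    by (simp only: heval_hlift)
  with FExSub show ?case by (simp add: heval_hsub msub_MDisj comp_def)
next
  case (FExF K \<phi>)
  have "msub \<sigma> (\<lambda>i. i) (MPart c) = MPart c" for c
    using msub_MPart[of \<sigma> "\<lambda>i. i" c] by simp
  with FExF show ?case by (simp add: heval_hsub Let_def msub_MExP_funpow)
qed (simp_all add: heval_hsub msub_MDisj comp_def)

lemma ftrans_finst_hf: "ftrans e \<eta> (finst_hf K \<phi>) = ftrans (case_nat (heval K e) e) \<eta> \<phi>"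
proof -
  have "(\<lambda>i. heval (case_nat K HVar i) e) = case_nat (heval K e) e"
    by (simp add: fun_eq_iff split: nat.split)
  then show ?thesis by (simp only: ftrans_fsub msub_id)
qed

lemma ftrans_finst_ind: "ftrans e \<eta> (finst_ind t \<phi>) = minst_ind t (ftrans e \<eta> \<phi>)"
  by (simp add: ftrans_fsub)

section \<open>Agreement of the two translations\<close>

abbreviation flatten_env :: "(nat \<Rightarrow> hf list \<times> nat) \<Rightarrow> nat \<Rightarrow> (hf \<times> nat) list" where
  "flatten_env \<eta> F \<equiv> zip (fst (\<eta> F)) [snd (\<eta> F)..<snd (\<eta> F) + length (fst (\<eta> F))]"

text \<open>The starting index is arbitrary since the tail of the list begins at
  \<open>Suc X\<close>.\<close>

lemma filter_zip_upt:
  "map g (filter (\<lambda>p. fst p = v) (zip xs [X..<X + length xs])) =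
   map (\<lambda>i. g (v, X + i)) (filter (\<lambda>i. xs ! i = v) [0..<length xs])"
proof (induction xs arbitrary: X)
  case (Cons x xs)
  have "[X..<X + length (x # xs)] = X # [Suc X..<Suc X + length xs]"
    by (simp add: upt_rec)
  moreover have "[0..<length (x # xs)] = 0 # map Suc [0..<length xs]"
    by (simp add: map_Suc_upt upt_conv_Cons del: upt_Suc)
  ultimately show ?case using Cons[of "Suc X"] by (simp add: filter_map comp_def)
qed simp

lemma flatten_env_extend:
  "flatten_env (case_nat (\<kappa>s, 0) (\<lambda>F. (fst (\<eta> F), snd (\<eta> F) + c))) =
   case_nat (zip \<kappa>s [0..<length \<kappa>s]) (\<lambda>F. map (map_prod id (\<lambda>X. X + c)) (flatten_env \<eta> F))"
proof
  fix F
  have "[X + c..<X + c + n] = map (\<lambda>X. X + c) [X..<X + n]" for X n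
    by (rule nth_equalityI) simp_all
  then show "flatten_env (case_nat (\<kappa>s, 0) (\<lambda>F. (fst (\<eta> F), snd (\<eta> F) + c))) F =
    case_nat (zip \<kappa>s [0..<length \<kappa>s]) (\<lambda>F. map (map_prod id (\<lambda>X. X + c)) (flatten_env \<eta> F)) F"
    by (simp add: zip_map2 map_prod_def split: nat.split)
qed

text \<open>Both translations evaluate HF-terms under the constantly empty environment. At a bounded
  quantifier one substitutes constants and the other updates the environment, with equal results by
  \<open>ftrans_finst_hf\<close>.\<close>

lemma transl_eq_ftrans: "transl \<eta> \<phi> = ftrans (\<lambda>_. hempty) (flatten_env \<eta>) \<phi>"
proof (induction \<eta> \<phi> rule: transl.induct)
  case (6 \<eta> F t L)
  show ?case
    using filter_zip_upt[of "\<lambda>p. MPred (snd p) t" "hvalue L" "fst (\<eta> F)" "snd (\<eta> F)"]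
    by (simp add: hvalue_def case_prod_beta)
next
  case (10 \<eta> K \<phi>)
  have "map (\<lambda>\<kappa>. transl \<eta> (finst_hf (HConst \<kappa>) \<phi>)) (members (hvalue K)) =
      map (\<lambda>\<kappa>. ftrans (case_nat \<kappa> (\<lambda>_. hempty)) (flatten_env \<eta>) \<phi>) (members (hvalue K))"
    by (rule map_cong[OF refl]) (simp only: 10 ftrans_finst_hf heval.simps)
  then show ?case by (simp only: transl.simps ftrans.simps hvalue_def)
next
  case (11 \<eta> K \<phi>)
  have "map (\<lambda>\<kappa>. transl \<eta> (finst_hf (HConst \<kappa>) \<phi>)) (subsets (hvalue K)) =
      map (\<lambda>\<kappa>. ftrans (case_nat \<kappa> (\<lambda>_. hempty)) (flatten_env \<eta>) \<phi>) (subsets (hvalue K))"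
    by (rule map_cong[OF refl]) (simp only: 11 ftrans_finst_hf heval.simps)
  then show ?case by (simp only: transl.simps ftrans.simps hvalue_def)
next
  case (12 \<eta> K \<phi>)
  then show ?case
    by (simp only: transl.simps ftrans.simps Let_def hvalue_def flatten_env_extend)
qed (simp_all add: hvalue_def)

section \<open>Well-formedness of translated formulae\<close>

lemma mso_form_MExP_funpow [simp]: "mso_form \<D> ((MExP ^^ c) \<phi>) \<longleftrightarrow> mso_form \<D> \<phi>"
  by (induction c) simp_all

lemma mso_form_MPart [simp]: "mso_form \<D> (MPart c)"
  by (auto simp: MPart_def mso_form_MDisj mso_form_MConj)

lemma mso_form_ftrans: "fso_form \<D> \<phi> \<Longrightarrow> mso_form \<D> (ftrans e \<eta> \<phi>)"
  by (induction \<phi> arbitrary: e \<eta>) (auto simp: mso_form_MDisj Let_def)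

lemma sk_term_hsubD: "sk_term (hsub \<tau> K) \<Longrightarrow> sk_term K"
proof (induction K rule: hft.induct[where ?P2.0 = "\<lambda>_. True"])
  case (HFun \<phi> Ks)
  from HFun.prems have "sk_term (HFun \<phi> (map (hsub \<tau>) Ks))" by simp
  then have "sk_form \<phi>" "sbound (Suc (length Ks)) \<phi>" "sk_prov [] ((SAll ^^ length Ks) (SEx1 \<phi>))"
    "\<And>K. K \<in> set Ks \<Longrightarrow> sk_term (hsub \<tau> K)"
    by (cases; simp)+
  with HFun.IH show ?case by (intro sk_term_sk_form_sk_prov.intros(3)) simp_all
qed (simp_all add: sk_term_sk_form_sk_prov.intros(1,2))

lemma fso_form_fsubD: "fso_form \<D> (fsub \<sigma> \<tau> \<rho> \<phi>) \<Longrightarrow> fso_form \<D> \<phi>"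
  by (induction \<phi> arbitrary: \<sigma> \<tau> \<rho>) (auto dest: ind_term_isubD sk_term_hsubD)

section \<open>Definable sets of a Henkin theory\<close>

context henkin
begin

section \<open>Truth of compound formulae in the theory\<close>

lemma M_allI: "mso_form \<D> \<phi> \<Longrightarrow> M (MAllI \<phi>) \<longleftrightarrow> (\<forall>t. ind_term \<D> t \<longrightarrow> M (minst_ind t \<phi>))"
proof -
  assume \<phi>: "mso_form \<D> \<phi>"
  have "M (MNeg (minst_ind t \<phi>)) \<longleftrightarrow> \<not> M (minst_ind t \<phi>)" if "ind_term \<D> t" for t
    by (intro M_neg mso_form_msub \<phi>) (simp add: that split: nat.split)
  then show ?thesis using \<phi> by (auto simp: M_neg M_exI)
qed

lemma M_MTrue [simp]: "M MTrue"
proof -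
  have "M (MAllI (MEq (IVar 0) (IVar 0)))" by (intro M_axiom mso_axiom.eq_refl) simp
  then show ?thesis using M_allI[of "MEq (IVar 0) (IVar 0)"] ind_term.simps(2) by fastforce
qed

lemma M_MFalse [simp]: "\<not> M MFalse"
  by (simp add: M_neg)

lemma M_and: "mso_form \<D> \<phi> \<Longrightarrow> mso_form \<D> \<psi> \<Longrightarrow> M (MAnd \<phi> \<psi>) \<longleftrightarrow> M \<phi> \<and> M \<psi>"
  by (simp add: M_neg M_or)

lemma M_iff: "mso_form \<D> \<phi> \<Longrightarrow> mso_form \<D> \<psi> \<Longrightarrow> M (MIff \<phi> \<psi>) \<longleftrightarrow> (M \<phi> \<longleftrightarrow> M \<psi>)"
  by (auto simp: M_neg M_or)

lemma M_MDisj: "\<forall>\<phi>\<in>set \<phi>s. mso_form \<D> \<phi> \<Longrightarrow> M (MDisj \<phi>s) \<longleftrightarrow> (\<exists>\<phi>\<in>set \<phi>s. M \<phi>)"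
  by (induction \<phi>s) (simp_all add: M_or mso_form_MDisj)

lemma M_MConj: "\<forall>\<phi>\<in>set \<phi>s. mso_form \<D> \<phi> \<Longrightarrow> M (MConj \<phi>s) \<longleftrightarrow> (\<forall>\<phi>\<in>set \<phi>s. M \<phi>)"
  by (induction \<phi>s) (simp_all add: M_and mso_form_MConj del: msub.simps)

lemma M_MPart: "M (msub \<sigma> \<rho> (MPart c)) \<longleftrightarrow> (\<forall>t. ind_term \<D> t \<longrightarrow>
    (\<exists>i<c. M (MPred (\<rho> i) t)) \<and> (\<forall>j<c. \<forall>i<j. \<not> (M (MPred (\<rho> i) t) \<and> M (MPred (\<rho> j) t))))"
proof -
  define \<phi> where "\<phi> t = MAnd (MDisj (map (\<lambda>i. MPred (\<rho> i) t) [0..<c]))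
     (MConj (concat (map (\<lambda>j. map (\<lambda>i. MNeg (MAnd (MPred (\<rho> i) t) (MPred (\<rho> j) t))) [0..<j]) [0..<c])))"
    for t
  have form: "ind_term \<D> t \<Longrightarrow> mso_form \<D> (\<phi> t)" for t
    by (auto simp: \<phi>_def mso_form_MDisj mso_form_MConj)
  have "msub \<sigma> \<rho> (MPart c) = MAllI (\<phi> (IVar 0))"
    by (simp add: MPart_def \<phi>_def msub_MConj msub_MDisj map_concat comp_def ilift_def)
  moreover have "minst_ind t (\<phi> (IVar 0)) = \<phi> t" for t
    by (simp add: \<phi>_def msub_MConj msub_MDisj map_concat comp_def)
  moreover have "M (\<phi> t) \<longleftrightarrow> (\<exists>i<c. M (MPred (\<rho> i) t)) \<and>
      (\<forall>j<c. \<forall>i<j. \<not> (M (MPred (\<rho> i) t) \<and> M (MPred (\<rho> j) t)))" if "ind_term \<D> t" for t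
    using that unfolding \<phi>_def
    by (subst M_and) (simp_all add: mso_form_MDisj mso_form_MConj M_MDisj M_MConj M_neg M_or,
        auto simp: Ball_def Bex_def)
  ultimately show ?thesis using M_allI[OF form[of "IVar 0"]] by simp
qed

text \<open>A block of \<open>c\<close> quantifiers sends the indices below \<open>c\<close> to
  arbitrary Predicates and lowers the others by \<open>c\<close> before \<rho> acts on them.\<close>

lemma M_exP_funpow:
  assumes "mso_form \<D> \<phi>" and "\<And>i. ind_term \<D> (\<sigma> i)"
  shows "M (msub \<sigma> \<rho> ((MExP ^^ c) \<phi>)) \<longleftrightarrow>
    (\<exists>P. M (msub \<sigma> (\<lambda>i. if i < c then P i else \<rho> (i - c)) \<phi>))"
proof (induction c arbitrary: \<rho>)
  case (Suc c)
  have form: "mso_form \<D> (msub \<sigma> (rlift \<rho>) ((MExP ^^ c) \<phi>))"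
    using assms by (intro mso_form_msub) simp_all
  have "M (msub \<sigma> \<rho> ((MExP ^^ Suc c) \<phi>)) \<longleftrightarrow>
      (\<exists>X. M (msub \<sigma> (case_nat X \<rho>) ((MExP ^^ c) \<phi>)))"
    using M_exP[OF form] by (simp add: minst_pred_rlift)
  also have "\<dots> \<longleftrightarrow> (\<exists>X P. M (msub \<sigma> (\<lambda>i. if i < c then P i else case_nat X \<rho> (i - c)) \<phi>))"
    by (simp only: Suc.IH)
  also have "\<dots> \<longleftrightarrow> (\<exists>P. M (msub \<sigma> (\<lambda>i. if i < Suc c then P i else \<rho> (i - Suc c)) \<phi>))"
  proof
    assume "\<exists>X P. M (msub \<sigma> (\<lambda>i. if i < c then P i else case_nat X \<rho> (i - c)) \<phi>)"
    then obtain X P where *: "M (msub \<sigma> (\<lambda>i. if i < c then P i else case_nat X \<rho> (i - c)) \<phi>)"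
      by blast
    \<comment> \<open>The outermost quantifier of the block carries the highest index,
      \<open>c\<close>.\<close>
    have "(\<lambda>i. if i < c then P i else case_nat X \<rho> (i - c)) =
        (\<lambda>i. if i < Suc c then (P(c := X)) i else \<rho> (i - Suc c))"
      by (auto simp: fun_eq_iff intro!: arg_cong[of _ _ \<rho>] split: nat.split)
    with * show "\<exists>P. M (msub \<sigma> (\<lambda>i. if i < Suc c then P i else \<rho> (i - Suc c)) \<phi>)" by metis
  next
    assume "\<exists>P. M (msub \<sigma> (\<lambda>i. if i < Suc c then P i else \<rho> (i - Suc c)) \<phi>)"
    then obtain P where *: "M (msub \<sigma> (\<lambda>i. if i < Suc c then P i else \<rho> (i - Suc c)) \<phi>)"
      by blast
    have "(\<lambda>i. if i < Suc c then P i else \<rho> (i - Suc c)) =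
        (\<lambda>i. if i < c then P i else case_nat (P c) \<rho> (i - c))"
      by (auto simp: fun_eq_iff less_Suc_eq intro!: arg_cong[of _ _ \<rho>] split: nat.split)
    with * show "\<exists>X P. M (msub \<sigma> (\<lambda>i. if i < c then P i else case_nat X \<rho> (i - c)) \<phi>)" by metis
  qed
  finally show ?case .
qed simp

section \<open>Definable sets of Individuals\<close>

definition definable :: "(ind \<Rightarrow> bool) \<Rightarrow> bool" where
  "definable P \<longleftrightarrow> (\<exists>X. \<forall>t. ind_term \<D> t \<longrightarrow> (M (MPred X t) \<longleftrightarrow> P t))"

lemma definable_cong: "definable P \<Longrightarrow> (\<And>t. ind_term \<D> t \<Longrightarrow> P t \<longleftrightarrow> Q t) \<Longrightarrow> definable Q"
  unfolding definable_def by simp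

text \<open>Comprehension turns the extension of a formula into that of a Predicate variable, and
  such variables are all that Predicate quantifiers range over.\<close>

lemma definable_form:
  assumes "mso_form \<D> \<phi>"
  shows "definable (\<lambda>t. M (minst_ind t \<phi>))"
proof -
  let ?\<psi> = "MAllI (MIff (MPred 0 (IVar 0)) (mshift_pred \<phi>))"
  have form: "mso_form \<D> (mshift_pred \<phi>)" using assms by (intro mso_form_msub) simp_all
  have "M (MExP ?\<psi>)" using form by (intro M_axiom mso_axiom.comprehension) simp
  moreover have "mso_form \<D> ?\<psi>" using form by simp
  moreover have "minst_pred X ?\<psi> = MAllI (MIff (MPred X (IVar 0)) \<phi>)" for X
    by (simp add: msub_msub)
  ultimately obtain X where "M (MAllI (MIff (MPred X (IVar 0)) \<phi>))"
    using M_exP[of ?\<psi>] by auto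
  then have "M (MIff (MPred X t) (minst_ind t \<phi>))" if "ind_term \<D> t" for t
    using M_allI[of "MIff (MPred X (IVar 0)) \<phi>"] assms that by simp
  moreover have "mso_form \<D> (minst_ind t \<phi>)" if "ind_term \<D> t" for t
    using assms that by (intro mso_form_msub) (simp_all split: nat.split)
  ultimately have "M (MPred X t) \<longleftrightarrow> M (minst_ind t \<phi>)" if "ind_term \<D> t" for t
    using that by (simp add: M_iff[of "MPred X t" "minst_ind t \<phi>", symmetric])
  then show ?thesis unfolding definable_def by blast
qed

lemma definable_False: "definable (\<lambda>t. False)"
  using definable_form[of MFalse] by simp

lemma definable_neg: "definable P \<Longrightarrow> definable (\<lambda>t. \<not> P t)"
proof -
  assume "definable P"
  then obtain X where "\<forall>t. ind_term \<D> t \<longrightarrow> (M (MPred X t) \<longleftrightarrow> P t)" unfolding definable_def by blast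
  with definable_form[of "MNeg (MPred X (IVar 0))"] show ?thesis
    by (auto elim!: definable_cong simp: M_neg)
qed

lemma definable_or: "definable P \<Longrightarrow> definable Q \<Longrightarrow> definable (\<lambda>t. P t \<or> Q t)"
proof -
  assume "definable P" "definable Q"
  then obtain X Y where "\<forall>t. ind_term \<D> t \<longrightarrow> (M (MPred X t) \<longleftrightarrow> P t)"
    "\<forall>t. ind_term \<D> t \<longrightarrow> (M (MPred Y t) \<longleftrightarrow> Q t)" unfolding definable_def by blast
  with definable_form[of "MOr (MPred X (IVar 0)) (MPred Y (IVar 0))"] show ?thesis
    by (auto elim!: definable_cong simp: M_or)
qed

lemma definable_and: "definable P \<Longrightarrow> definable Q \<Longrightarrow> definable (\<lambda>t. P t \<and> Q t)"
  using definable_neg[OF definable_or[OF definable_neg definable_neg]] by simp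

lemma definable_const: "definable (\<lambda>t. b)"
  using definable_False definable_neg[OF definable_False] by (cases b) simp_all

lemma definable_Ball:
  assumes "finite A" "\<And>x. x \<in> A \<Longrightarrow> definable (P x)"
  shows "definable (\<lambda>t. \<forall>x\<in>A. P x t)"
  using assms by (induction A) (simp_all add: definable_const definable_and)

text \<open>Taking the first suitable entry of a fixed finite list is a Boolean combination of the
  tests on its entries; an arbitrary choice need not be definable.\<close>

lemma definable_find:
  "(\<And>x. x \<in> set xs \<Longrightarrow> definable (\<lambda>t. P t x)) \<Longrightarrow> definable (\<lambda>t. find (P t) xs = Some y)"
proof (induction xs)
  case (Cons x xs)
  then have "definable (\<lambda>t. P t x \<and> x = y \<or> \<not> P t x \<and> find (P t) xs = Some y)"
    by (intro definable_or definable_and definable_neg definable_const) simp_all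
  then show ?case by (rule definable_cong) simp
qed (simp add: definable_const)

text \<open>The induction axiom speaks of Predicates, which confines induction on terms to definable
  properties.\<close>

lemma definable_induct:
  assumes "definable P" and "P Root"
    and step: "\<And>d t. d |\<in>| elts \<D> \<Longrightarrow> ind_term \<D> t \<Longrightarrow> P t \<Longrightarrow> P (Succ d t)"
    and t: "ind_term \<D> t"
  shows "P t"
proof -
  obtain X where X: "\<And>t. ind_term \<D> t \<Longrightarrow> M (MPred X t) \<longleftrightarrow> P t"
    using assms(1) unfolding definable_def by blast
  define \<psi> where "\<psi> X d = MAllI (MImp (MPred X (IVar 0)) (MPred X (Succ d (IVar 0))))" for X d
  define \<phi> where "\<phi> X = MImp (MPred X Root) (MImp (MConj (map (\<psi> X) (members \<D>)))
      (MAllI (MPred X (IVar 0))))" for X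
  have form_\<psi>: "\<forall>\<theta>\<in>set (map (\<psi> X) (members \<D>)). mso_form \<D> \<theta>" for X
    by (auto simp: \<psi>_def)
  then have form: "mso_form \<D> (\<phi> X)" for X by (simp add: \<phi>_def mso_form_MConj)
  have "M (MAllP (\<phi> 0))"
    using form[of 0] unfolding \<phi>_def \<psi>_def by (intro M_axiom mso_axiom.induction) simp
  then have "\<not> M (minst_pred X (MNeg (\<phi> 0)))"
    using form[of 0] by (simp add: M_neg M_exP)
  moreover have "minst_pred X (MNeg (\<phi> 0)) = MNeg (\<phi> X)"
  proof -
    have "minst_pred X (\<psi> 0 d) = \<psi> X d" for d by (simp add: \<psi>_def)
    then show ?thesis by (simp add: \<phi>_def msub_MConj comp_def)
  qed
  ultimately have "M (\<phi> X)" using form by (simp add: M_neg)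
  moreover have "M (\<psi> X d)" if "d \<in> set (members \<D>)" for d
    unfolding \<psi>_def using that X step by (subst M_allI) (auto simp: M_or M_neg)
  moreover have "M (MPred X Root)" using X assms(2) by simp
  ultimately have "M (MAllI (MPred X (IVar 0)))"
    using form_\<psi>[of X] by (auto simp: \<phi>_def M_or M_neg[of "MPred X Root"] M_neg[of "MConj _"]
        mso_form_MConj M_MConj)
  then show ?thesis using t X by (simp add: M_allI)
qed

end

section \<open>The FSO structure of a Henkin theory\<close>

context henkin
begin

text \<open>Rules of FSO may instantiate with terms containing \<open>Succ d\<close> for a non-direction \<open>d\<close>; sending these to
  the root gives every term a well-formed value.\<close>

primrec ival :: "(nat \<Rightarrow> ind) \<Rightarrow> ind \<Rightarrow> ind" where
  "ival \<sigma> (IVar i) = \<sigma> i"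
| "ival \<sigma> Root = Root"
| "ival \<sigma> (Succ d t) = (if d |\<in>| elts \<D> then Succ d (ival \<sigma> t) else Root)"

lemma ival_isub: "ival \<sigma> (isub \<sigma>' t) = ival (\<lambda>i. ival \<sigma> (\<sigma>' i)) t"
  by (induction t) simp_all

lemma ind_term_ival: "(\<And>i. ind_term \<D> (\<sigma> i)) \<Longrightarrow> ind_term \<D> (ival \<sigma> t)"
  by (induction t) simp_all

lemma ival_eq_isub: "ind_term \<D> t \<Longrightarrow> ival \<sigma> t = isub \<sigma> t"
  by (induction t) simp_all

lemma ival_ilift: "ival (case_nat t \<sigma>) (ilift \<sigma>' i) = case_nat t (\<lambda>i. ival \<sigma> (\<sigma>' i)) i"
  by (simp add: ilift_def ival_isub split: nat.split)

text \<open>The value \<open>None\<close> lets the Function variables that are free in a derivation be interpreted by the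
  nowhere defined map, which matches the empty list of values in \<open>translation\<close>.\<close>

definition definable_fun :: "(ind \<Rightarrow> hf option) \<Rightarrow> bool" where
  "definable_fun g \<longleftrightarrow>
     (\<forall>l. definable (\<lambda>t. g t = Some l)) \<and> finite {l. \<exists>t. ind_term \<D> t \<and> g t = Some l}"

definition maps_into :: "(ind \<Rightarrow> hf option) \<Rightarrow> hf \<Rightarrow> bool" where
  "maps_into g \<kappa> \<longleftrightarrow> (\<forall>t. ind_term \<D> t \<longrightarrow> (\<exists>l. l |\<in>| elts \<kappa> \<and> g t = Some l))"

text \<open>Henkin semantics: Function quantifiers range over definable maps only, and equality and
  order of Individuals are those of \<open>M\<close>. Atoms on HF-sets are independent of
  \<open>M\<close>.\<close>

primrec fsat ::
  "(nat \<Rightarrow> ind) \<Rightarrow> (nat \<Rightarrow> hf) \<Rightarrow> (nat \<Rightarrow> ind \<Rightarrow> hf option) \<Rightarrow> ffm \<Rightarrow> bool" where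
  "fsat \<sigma> e f (FEq t u) \<longleftrightarrow> M (MEq (ival \<sigma> t) (ival \<sigma> u))"
| "fsat \<sigma> e f (FLess t u) \<longleftrightarrow> M (MLess (ival \<sigma> t) (ival \<sigma> u))"
| "fsat \<sigma> e f (FHEq K L) \<longleftrightarrow> heval K e = heval L e"
| "fsat \<sigma> e f (FHMem K L) \<longleftrightarrow> heval K e |\<in>| elts (heval L e)"
| "fsat \<sigma> e f (FHSub K L) \<longleftrightarrow> elts (heval K e) |\<subseteq>| elts (heval L e)"
| "fsat \<sigma> e f (FApp F t K) \<longleftrightarrow> f F (ival \<sigma> t) = Some (heval K e)"
| "fsat \<sigma> e f (FNeg \<phi>) \<longleftrightarrow> \<not> fsat \<sigma> e f \<phi>"
| "fsat \<sigma> e f (FOr \<phi> \<psi>) \<longleftrightarrow> fsat \<sigma> e f \<phi> \<or> fsat \<sigma> e f \<psi>"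
| "fsat \<sigma> e f (FExI \<phi>) \<longleftrightarrow> (\<exists>t. ind_term \<D> t \<and> fsat (case_nat t \<sigma>) e f \<phi>)"
| "fsat \<sigma> e f (FExMem K \<phi>) \<longleftrightarrow>
     (\<exists>k. k |\<in>| elts (heval K e) \<and> fsat \<sigma> (case_nat k e) f \<phi>)"
| "fsat \<sigma> e f (FExSub K \<phi>) \<longleftrightarrow>
     (\<exists>k. elts k |\<subseteq>| elts (heval K e) \<and> fsat \<sigma> (case_nat k e) f \<phi>)"
| "fsat \<sigma> e f (FExF K \<phi>) \<longleftrightarrow>
     (\<exists>g. definable_fun g \<and> maps_into g (heval K e) \<and> fsat \<sigma> e (case_nat g f) \<phi>)"

lemma fsat_fsub:
  "fsat \<sigma> e f (fsub \<sigma>' \<tau> \<rho> \<phi>) \<longleftrightarrow>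
   fsat (\<lambda>i. ival \<sigma> (\<sigma>' i)) (\<lambda>i. heval (\<tau> i) e) (\<lambda>F. f (\<rho> F)) \<phi>"
proof (induction \<phi> arbitrary: \<sigma> e f \<sigma>' \<tau> \<rho>)
  case (FExF K \<phi>)
  have "(\<lambda>F. case_nat g f (rlift \<rho> F)) = case_nat g (\<lambda>F. f (\<rho> F))" for g
    by (simp add: fun_eq_iff rlift_def split: nat.split)
  with FExF show ?case by (simp add: heval_hsub)
qed (simp_all add: ival_isub ival_ilift heval_hsub heval_hlift)

lemma fsat_finst_ind: "fsat \<sigma> e f (finst_ind t \<phi>) \<longleftrightarrow> fsat (case_nat (ival \<sigma> t) \<sigma>) e f \<phi>"
proof -
  have "(\<lambda>i. ival \<sigma> (case_nat t IVar i)) = case_nat (ival \<sigma> t) \<sigma>"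
    by (simp add: fun_eq_iff split: nat.split)
  then show ?thesis by (simp only: fsat_fsub heval.simps)
qed

lemma fsat_finst_hf: "fsat \<sigma> e f (finst_hf K \<phi>) \<longleftrightarrow> fsat \<sigma> (case_nat (heval K e) e) f \<phi>"
proof -
  have "(\<lambda>i. heval (case_nat K HVar i) e) = case_nat (heval K e) e"
    by (simp add: fun_eq_iff split: nat.split)
  then show ?thesis by (simp only: fsat_fsub ival.simps)
qed

lemma fsat_finst_fun: "fsat \<sigma> e f (finst_fun F \<phi>) \<longleftrightarrow> fsat \<sigma> e (case_nat (f F) f) \<phi>"
proof -
  have "(\<lambda>i. f (case_nat F (\<lambda>i. i) i)) = case_nat (f F) f"
    by (simp add: fun_eq_iff split: nat.split)
  then show ?thesis by (simp only: fsat_fsub ival.simps heval.simps)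
qed

lemma fsat_fshift [simp]:
  "fsat (case_nat t \<sigma>) e f (fshift_ind \<phi>) \<longleftrightarrow> fsat \<sigma> e f \<phi>"
  "fsat \<sigma> (case_nat k e) f (fshift_hf \<phi>) \<longleftrightarrow> fsat \<sigma> e f \<phi>"
  "fsat \<sigma> e (case_nat g f) (fshift_fun \<phi>) \<longleftrightarrow> fsat \<sigma> e f \<phi>"
  by (simp_all add: fsat_fsub)

lemma fsat_FConj: "fsat \<sigma> e f (FConj \<phi>s) \<longleftrightarrow> (\<forall>\<phi>\<in>set \<phi>s. fsat \<sigma> e f \<phi>)"
  by (induction \<phi>s) simp_all

lemma fsat_FTyped: "fsat \<sigma> e f (FTyped F K) \<longleftrightarrow> maps_into (f F) (heval K e)"
  by (auto simp: FTyped_def maps_into_def)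

lemma fsat_hf_only: "hf_only \<phi> \<Longrightarrow> fsat \<sigma> e f \<phi> \<longleftrightarrow> ssat (to_sfm \<phi>) e"
  by (induction \<phi> arbitrary: e) simp_all

text \<open>Since the entries are distinct, the fibre over an entry is a single class of the
  partition, hence the extension of one Predicate.\<close>

lemma partition_definable_fun:
  assumes "distinct \<kappa>s"
    and cover: "\<And>t. ind_term \<D> t \<Longrightarrow> \<exists>i<length \<kappa>s. M (MPred (P i) t)"
    and disjoint: "\<And>t i j. ind_term \<D> t \<Longrightarrow> j < length \<kappa>s \<Longrightarrow> i < j \<Longrightarrow>
      \<not> (M (MPred (P i) t) \<and> M (MPred (P j) t))"
  shows "\<exists>g. definable_fun g \<and> (\<forall>t. ind_term \<D> t \<longrightarrow>
    (\<exists>l\<in>set \<kappa>s. g t = Some l) \<and>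
    (\<forall>l. g t = Some l \<longleftrightarrow> (\<exists>i<length \<kappa>s. \<kappa>s ! i = l \<and> M (MPred (P i) t))))"
proof -
  define idx where "idx t = (SOME i. i < length \<kappa>s \<and> M (MPred (P i) t))" for t
  define g where "g t = Some (\<kappa>s ! idx t)" for t
  have idx: "idx t < length \<kappa>s \<and> M (MPred (P (idx t)) t)" if "ind_term \<D> t" for t
    unfolding idx_def by (rule someI_ex) (rule cover[OF that])
  have idx_eq: "idx t = i" if t: "ind_term \<D> t" and i: "i < length \<kappa>s" "M (MPred (P i) t)" for t i
  proof (rule linorder_cases[of "idx t" i])
    show ?thesis if "idx t < i" using disjoint[OF t i(1) that] idx[OF t] i(2) by blast
    show ?thesis if "i < idx t" using disjoint[OF t _ that] idx[OF t] i(2) by blast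
  qed
  have graph: "g t = Some l \<longleftrightarrow> (\<exists>i<length \<kappa>s. \<kappa>s ! i = l \<and> M (MPred (P i) t))"
    if t: "ind_term \<D> t" for t l
    using idx[OF t] idx_eq[OF t] unfolding g_def by auto
  have range: "\<exists>l\<in>set \<kappa>s. g t = Some l" if "ind_term \<D> t" for t
    using idx[OF that] by (simp add: g_def)
  have "definable (\<lambda>t. g t = Some l)" for l
  proof (cases "l \<in> set \<kappa>s")
    case True
    then obtain i where i: "i < length \<kappa>s" "l = \<kappa>s ! i" by (auto simp: in_set_conv_nth)
    have "M (MPred (P i) t) \<longleftrightarrow> g t = Some l" if "ind_term \<D> t" for t
      using graph[OF that] i nth_eq_iff_index_eq[OF \<open>distinct \<kappa>s\<close>] by auto
    then show ?thesis unfolding definable_def by blast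
  next
    case False
    then have "g t \<noteq> Some l" if "ind_term \<D> t" for t using range[OF that] by auto
    then show ?thesis by (intro definable_cong[OF definable_False]) simp
  qed
  moreover have "finite {l. \<exists>t. ind_term \<D> t \<and> g t = Some l}"
    by (rule finite_subset[OF _ finite_set[of \<kappa>s]]) (use range in fastforce)
  ultimately have "definable_fun g" by (simp add: definable_fun_def)
  then show ?thesis using range graph by (intro exI[of _ g]) simp
qed

text \<open>The truth lemma. Indices in the translated formula are read through \<rho>, because a
  Function quantifier raises the indices already in use by the size of its block. An empty list in
  \<eta> stands for the nowhere defined map.\<close>

lemma fsat_ftrans:
  assumes "fso_form \<D> \<phi>" and "\<And>i. ind_term \<D> (\<sigma> i)"
    and "\<And>F t l. ind_term \<D> t \<Longrightarrow>
      f F t = Some l \<longleftrightarrow> (\<exists>X. (l, X) \<in> set (\<eta> F) \<and> M (MPred (\<rho> X) t))"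
  shows "fsat \<sigma> e f \<phi> \<longleftrightarrow> M (msub \<sigma> \<rho> (ftrans e \<eta> \<phi>))"
  using assms
proof (induction \<phi> arbitrary: \<sigma> e f \<eta> \<rho>)
  case (FApp F t K)
  have t: "ind_term \<D> (isub \<sigma> t)" using FApp.prems(1,2) by (simp add: ind_term_isub)
  then have "fsat \<sigma> e f (FApp F t K) \<longleftrightarrow>
      (\<exists>X. (heval K e, X) \<in> set (\<eta> F) \<and> M (MPred (\<rho> X) (isub \<sigma> t)))"
    using FApp.prems by (simp add: ival_eq_isub)
  also have "\<dots> \<longleftrightarrow> M (msub \<sigma> \<rho> (ftrans e \<eta> (FApp F t K)))"
    using t by (auto simp: msub_MDisj M_MDisj)
  finally show ?case .
next
  case (FNeg \<phi>)
  then have "mso_form \<D> (msub \<sigma> \<rho> (ftrans e \<eta> \<phi>))" by (simp add: mso_form_msub mso_form_ftrans)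
  moreover have "fsat \<sigma> e f \<phi> \<longleftrightarrow> M (msub \<sigma> \<rho> (ftrans e \<eta> \<phi>))"
    using FNeg.prems by (intro FNeg.IH) simp_all
  ultimately show ?case by (simp add: M_neg)
next
  case (FOr \<phi> \<psi>)
  then have "mso_form \<D> (msub \<sigma> \<rho> (ftrans e \<eta> \<phi>))" "mso_form \<D> (msub \<sigma> \<rho> (ftrans e \<eta> \<psi>))"
    by (simp_all add: mso_form_msub mso_form_ftrans)
  moreover have "fsat \<sigma> e f \<phi> \<longleftrightarrow> M (msub \<sigma> \<rho> (ftrans e \<eta> \<phi>))"
    using FOr.prems by (intro FOr.IH) simp_all
  moreover have "fsat \<sigma> e f \<psi> \<longleftrightarrow> M (msub \<sigma> \<rho> (ftrans e \<eta> \<psi>))"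
    using FOr.prems by (intro FOr.IH) simp_all
  ultimately show ?case by (simp add: M_or)
next
  case (FExI \<phi>)
  have form: "mso_form \<D> (msub (ilift \<sigma>) \<rho> (ftrans e \<eta> \<phi>))"
    using FExI.prems by (intro mso_form_msub mso_form_ftrans ind_term_ilift) simp_all
  have "fsat (case_nat t \<sigma>) e f \<phi> \<longleftrightarrow> M (msub (case_nat t \<sigma>) \<rho> (ftrans e \<eta> \<phi>))"
    if "ind_term \<D> t" for t
    using FExI.prems that by (intro FExI.IH) (simp_all split: nat.split)
  then show ?case by (auto simp: M_exI[OF form] minst_ind_ilift)
next
  case (FExMem K \<phi>)
  have "\<forall>\<theta>\<in>set (map (msub \<sigma> \<rho>) (map (\<lambda>\<kappa>. ftrans (case_nat \<kappa> e) \<eta> \<phi>) (members (heval K e)))).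
      mso_form \<D> \<theta>"
    using FExMem.prems by (auto simp: mso_form_msub mso_form_ftrans)
  moreover have "fsat \<sigma> (case_nat k e) f \<phi> \<longleftrightarrow> M (msub \<sigma> \<rho> (ftrans (case_nat k e) \<eta> \<phi>))" for k
    using FExMem.prems by (intro FExMem.IH) simp_all
  ultimately show ?case by (auto simp: msub_MDisj M_MDisj)
next
  case (FExSub K \<phi>)
  have "\<forall>\<theta>\<in>set (map (msub \<sigma> \<rho>) (map (\<lambda>\<kappa>. ftrans (case_nat \<kappa> e) \<eta> \<phi>) (subsets (heval K e)))).
      mso_form \<D> \<theta>"
    using FExSub.prems by (auto simp: mso_form_msub mso_form_ftrans)
  moreover have "fsat \<sigma> (case_nat k e) f \<phi> \<longleftrightarrow> M (msub \<sigma> \<rho> (ftrans (case_nat k e) \<eta> \<phi>))" for k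
    using FExSub.prems by (intro FExSub.IH) simp_all
  ultimately show ?case by (auto simp: msub_MDisj M_MDisj)
next
  case (FExF K \<phi>)
  define \<kappa>s where "\<kappa>s = members (heval K e)"
  define c where "c = length \<kappa>s"
  define \<eta>' where "\<eta>' = case_nat (zip \<kappa>s [0..<c]) (\<lambda>F. map (map_prod id (\<lambda>X. X + c)) (\<eta> F))"
  \<comment> \<open>New indices go to the Predicates \<open>P\<close> chosen for the block; old ones
    are lowered again, which undoes the shift in \<open>\<eta>'\<close>.\<close>
  define \<rho>' where "\<rho>' P i = (if i < c then P i else \<rho> (i - c))" for P i
  define \<chi> where "\<chi> = ftrans e \<eta>' \<phi>"
  have form: "mso_form \<D> \<chi>" using FExF.prems by (simp add: \<chi>_def mso_form_ftrans)
  have form': "mso_form \<D> (msub \<sigma> (\<rho>' P) \<chi>)" "mso_form \<D> (msub \<sigma> (\<rho>' P) (MPart c))" for P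
    using form FExF.prems by (simp_all add: mso_form_msub)
  have "M (msub \<sigma> \<rho> (ftrans e \<eta> (FExF K \<phi>))) \<longleftrightarrow>
      (\<exists>P. M (msub \<sigma> (\<rho>' P) (MAnd (MPart c) \<chi>)))"
    using M_exP_funpow[of "MAnd (MPart c) \<chi>" \<sigma> \<rho> c] form FExF.prems(2)
    by (simp add: Let_def \<kappa>s_def[symmetric] c_def[symmetric] \<eta>'_def[symmetric] \<chi>_def[symmetric]
        \<rho>'_def[symmetric])
  also have "\<dots> \<longleftrightarrow> (\<exists>P. M (msub \<sigma> (\<rho>' P) (MPart c)) \<and> M (msub \<sigma> (\<rho>' P) \<chi>))"
    using M_and[OF form'(2,1)] by simp
  also have "\<dots> \<longleftrightarrow> fsat \<sigma> e f (FExF K \<phi>)"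
  proof -
    have part: "M (msub \<sigma> (\<rho>' P) (MPart c)) \<longleftrightarrow> (\<forall>t. ind_term \<D> t \<longrightarrow>
        (\<exists>i<c. M (MPred (P i) t)) \<and> (\<forall>j<c. \<forall>i<j. \<not> (M (MPred (P i) t) \<and> M (MPred (P j) t))))" for P
      unfolding M_MPart by (auto simp: \<rho>'_def)
    \<comment> \<open>The body sees \<open>g\<close> only through its fibres, so one equivalence
      serves both directions between partitions and maps.\<close>
    have body: "fsat \<sigma> e (case_nat g f) \<phi> \<longleftrightarrow> M (msub \<sigma> (\<rho>' P) \<chi>)"
      if g: "\<And>t l. ind_term \<D> t \<Longrightarrow>
        g t = Some l \<longleftrightarrow> (\<exists>i<c. \<kappa>s ! i = l \<and> M (MPred (P i) t))" for g P
      unfolding \<chi>_def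
    proof (rule FExF.IH)
      show "fso_form \<D> \<phi>" "\<And>i. ind_term \<D> (\<sigma> i)" using FExF.prems by simp_all
      fix F t l assume t: "ind_term \<D> t"
      show "case_nat g f F t = Some l \<longleftrightarrow> (\<exists>X. (l, X) \<in> set (\<eta>' F) \<and> M (MPred (\<rho>' P X) t))"
      proof (cases F)
        case 0
        have "(l, X) \<in> set (zip \<kappa>s [0..<c]) \<longleftrightarrow> X < c \<and> \<kappa>s ! X = l" for X
          by (auto simp: set_zip c_def)
        then show ?thesis using 0 g[OF t, of l] by (auto simp: \<eta>'_def \<rho>'_def)
      next
        case (Suc G)
        have "(\<exists>X. (l, X) \<in> set (\<eta>' F) \<and> M (MPred (\<rho>' P X) t)) \<longleftrightarrow>
            (\<exists>X. (l, X) \<in> set (\<eta> G) \<and> M (MPred (\<rho> X) t))"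
          using Suc by (force simp: \<eta>'_def \<rho>'_def)
        then show ?thesis using Suc FExF.prems(3)[OF t] by simp
      qed
    qed
    have distinct: "distinct \<kappa>s" by (simp add: \<kappa>s_def)
    show ?thesis
    proof
      assume "\<exists>P. M (msub \<sigma> (\<rho>' P) (MPart c)) \<and> M (msub \<sigma> (\<rho>' P) \<chi>)"
      then obtain P where P: "M (msub \<sigma> (\<rho>' P) (MPart c))" "M (msub \<sigma> (\<rho>' P) \<chi>)" by blast
      have cover: "\<exists>i<length \<kappa>s. M (MPred (P i) t)" if "ind_term \<D> t" for t
        using P(1)[unfolded part] that unfolding c_def by blast
      have disjoint: "\<not> (M (MPred (P i) t) \<and> M (MPred (P j) t))"
        if "ind_term \<D> t" "j < length \<kappa>s" "i < j" for t i j
        using P(1)[unfolded part] that unfolding c_def by blast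
      obtain g where g: "definable_fun g"
        "\<And>t. ind_term \<D> t \<Longrightarrow> \<exists>l\<in>set \<kappa>s. g t = Some l"
        "\<And>t l. ind_term \<D> t \<Longrightarrow>
          g t = Some l \<longleftrightarrow> (\<exists>i<length \<kappa>s. \<kappa>s ! i = l \<and> M (MPred (P i) t))"
        using partition_definable_fun[OF distinct cover disjoint] by blast
      have "maps_into g (heval K e)" using g(2) by (auto simp: maps_into_def \<kappa>s_def)
      moreover have "fsat \<sigma> e (case_nat g f) \<phi>"
        using body[of g P] g(3) P(2) by (simp add: c_def)
      ultimately show "fsat \<sigma> e f (FExF K \<phi>)" using g(1) by auto
    next
      assume "fsat \<sigma> e f (FExF K \<phi>)"
      then obtain g where g: "definable_fun g" "maps_into g (heval K e)"
        "fsat \<sigma> e (case_nat g f) \<phi>" by auto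
      have "\<exists>X. \<forall>t. ind_term \<D> t \<longrightarrow> (M (MPred X t) \<longleftrightarrow> g t = Some l)" for l
        using g(1) by (simp add: definable_fun_def definable_def)
      then obtain Q where Q: "\<And>l t. ind_term \<D> t \<Longrightarrow> M (MPred (Q l) t) \<longleftrightarrow> g t = Some l"
        by metis
      \<comment> \<open>The class of an entry is the fibre over it. These classes cover because
        \<open>g\<close> maps into the value of \<open>K\<close>, and they are disjoint because the
        entries are distinct.\<close>
      define P where "P i = Q (\<kappa>s ! i)" for i
      have P: "M (MPred (P i) t) \<longleftrightarrow> g t = Some (\<kappa>s ! i)" if "ind_term \<D> t" for t i
        using Q[OF that] by (simp add: P_def)
      have into: "\<exists>i<c. g t = Some (\<kappa>s ! i)" if t: "ind_term \<D> t" for t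
      proof -
        have "\<exists>l. l \<in> set \<kappa>s \<and> g t = Some l"
          using g(2) t by (simp add: maps_into_def \<kappa>s_def)
        then show ?thesis by (auto simp: in_set_conv_nth c_def)
      qed
      have "M (msub \<sigma> (\<rho>' P) (MPart c))"
        unfolding part using P into distinct by (auto simp: c_def nth_eq_iff_index_eq)
      moreover have "fsat \<sigma> e (case_nat g f) \<phi> \<longleftrightarrow> M (msub \<sigma> (\<rho>' P) \<chi>)"
      proof (rule body)
        fix t l assume t: "ind_term \<D> t"
        show "g t = Some l \<longleftrightarrow> (\<exists>i<c. \<kappa>s ! i = l \<and> M (MPred (P i) t))"
          using P[OF t] into[OF t] by auto
      qed
      ultimately show "\<exists>P. M (msub \<sigma> (\<rho>' P) (MPart c)) \<and> M (msub \<sigma> (\<rho>' P) \<chi>)"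
        using g(3) by blast
    qed
  qed
  finally show ?case by blast
qed (simp_all add: ival_eq_isub M_neg)

text \<open>The finite range is what lets a list of values with Predicates describe the whole
  map.\<close>

lemma definable_fun_represented:
  assumes "definable_fun g"
  shows "\<exists>xs. \<forall>t l. ind_term \<D> t \<longrightarrow>
    (g t = Some l \<longleftrightarrow> (\<exists>X. (l, X) \<in> set xs \<and> M (MPred X t)))"
proof -
  have "finite {l. \<exists>t. ind_term \<D> t \<and> g t = Some l}"
    using assms by (simp add: definable_fun_def)
  from finite_list[OF this] obtain ls where ls: "set ls = {l. \<exists>t. ind_term \<D> t \<and> g t = Some l}" ..
  have "\<exists>X. \<forall>t. ind_term \<D> t \<longrightarrow> (M (MPred X t) \<longleftrightarrow> g t = Some l)" for l
    using assms by (simp add: definable_fun_def definable_def)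
  then obtain Q where Q: "\<And>l t. ind_term \<D> t \<Longrightarrow> M (MPred (Q l) t) \<longleftrightarrow> g t = Some l"
    by metis
  have "g t = Some l \<longleftrightarrow> (\<exists>X. (l, X) \<in> set (map (\<lambda>l. (l, Q l)) ls) \<and> M (MPred X t))"
    if "ind_term \<D> t" for t l
    using Q[OF that, of l] ls that by auto
  then show ?thesis by blast
qed

text \<open>One \<eta> serves all formulae and all values of Individual and HF-variables, so the
  value of an Individual variable can run while \<eta> stays fixed.\<close>

lemma env_represented:
  assumes "\<And>F. definable_fun (f F)"
  obtains \<eta> where "\<And>\<phi> \<sigma> e. fso_form \<D> \<phi> \<Longrightarrow> (\<And>i. ind_term \<D> (\<sigma> i)) \<Longrightarrow>
    fsat \<sigma> e f \<phi> \<longleftrightarrow> M (msub \<sigma> (\<lambda>i. i) (ftrans e \<eta> \<phi>))"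
proof -
  from definable_fun_represented[OF assms] obtain \<eta> where
    "\<And>F t l. ind_term \<D> t \<Longrightarrow> f F t = Some l \<longleftrightarrow> (\<exists>X. (l, X) \<in> set (\<eta> F) \<and> M (MPred X t))"
    by metis
  then have "fsat \<sigma> e f \<phi> \<longleftrightarrow> M (msub \<sigma> (\<lambda>i. i) (ftrans e \<eta> \<phi>))"
    if "fso_form \<D> \<phi>" "\<And>i. ind_term \<D> (\<sigma> i)" for \<phi> \<sigma> e
    using that by (intro fsat_ftrans) simp_all
  then show ?thesis by (rule that)
qed

text \<open>The truth lemma reduces satisfaction with parameters to the instances of one MSO
  formula, to which comprehension applies.\<close>

lemma definable_fsat:
  assumes "fso_form \<D> \<phi>" and "\<And>i. ind_term \<D> (\<sigma> i)" and "\<And>F. definable_fun (f F)"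
  shows "definable (\<lambda>t. fsat (case_nat t \<sigma>) e f \<phi>)"
proof -
  obtain \<eta> where \<eta>: "\<And>\<phi> \<sigma> e. fso_form \<D> \<phi> \<Longrightarrow> (\<And>i. ind_term \<D> (\<sigma> i)) \<Longrightarrow>
    fsat \<sigma> e f \<phi> \<longleftrightarrow> M (msub \<sigma> (\<lambda>i. i) (ftrans e \<eta> \<phi>))"
    using env_represented[of f, OF assms(3)] by blast
  have "definable (\<lambda>t. M (minst_ind t (msub (ilift \<sigma>) (\<lambda>i. i) (ftrans e \<eta> \<phi>))))"
    using assms by (intro definable_form mso_form_msub mso_form_ftrans ind_term_ilift)
  then show ?thesis
  proof (rule definable_cong)
    fix t assume "ind_term \<D> t"
    then have "ind_term \<D> (case_nat t \<sigma> i)" for i using assms(2) by (simp split: nat.split)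
    from \<eta>[OF assms(1) this]
    show "M (minst_ind t (msub (ilift \<sigma>) (\<lambda>i. i) (ftrans e \<eta> \<phi>))) \<longleftrightarrow> fsat (case_nat t \<sigma>) e f \<phi>"
      by (simp add: minst_ind_ilift)
  qed
qed

lemma fsat_if_mso_axiom:
  assumes "fso_form \<D> \<phi>" and "\<And>i. ind_term \<D> (\<sigma> i)" and "\<And>F. definable_fun (f F)"
    and "\<And>e \<eta>. mso_axiom \<D> (ftrans e \<eta> \<phi>)"
  shows "fsat \<sigma> e f \<phi>"
proof -
  obtain \<eta> where "fsat \<sigma> e f \<phi> \<longleftrightarrow> M (msub \<sigma> (\<lambda>i. i) (ftrans e \<eta> \<phi>))"
    using env_represented[of f, OF assms(3)] assms(1,2) by metis
  moreover have "M (msub \<sigma> (\<lambda>i. i) (ftrans e \<eta> \<phi>))" for \<eta>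
    using assms by (intro M_axiom mso_axiom_msub mso_form_msub mso_form_ftrans)
  ultimately show ?thesis by simp
qed

text \<open>With G for \<open>f j\<close>, the map \<open>f' j\<close> sends a term t to the set
  G(t) applied to k. The third hypothesis has the shape of the formula that replaces an atom, so
  atoms are immediate and the work lies in passing under binders.\<close>

lemma fsat_app_subst:
  assumes "\<And>i. ind_term \<D> (\<sigma> i)" and "\<And>F. F \<noteq> j \<Longrightarrow> f' F = f F"
    and "\<And>t l. ind_term \<D> t \<Longrightarrow> f' j t = Some l \<longleftrightarrow>
      (\<exists>h. h |\<in>| elts (heval E e) \<and> f j t = Some h \<and> happly h (heval k e) = l)"
  shows "fsat \<sigma> e f (app_subst E k j \<phi>) \<longleftrightarrow> fsat \<sigma> e f' \<phi>"
  using assms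
proof (induction \<phi> arbitrary: \<sigma> e f f' E k j)
  case (FApp F t M)
  then show ?case by (auto simp: ind_term_ival)
next
  case (FOr \<phi> \<psi>)
  have "fsat \<sigma> e f (app_subst E k j \<phi>) \<longleftrightarrow> fsat \<sigma> e f' \<phi>"
    using FOr.prems by (rule FOr.IH(1))
  moreover have "fsat \<sigma> e f (app_subst E k j \<psi>) \<longleftrightarrow> fsat \<sigma> e f' \<psi>"
    using FOr.prems by (rule FOr.IH(2))
  ultimately show ?case by simp
next
  case (FNeg \<phi>)
  have "fsat \<sigma> e f (app_subst E k j \<phi>) \<longleftrightarrow> fsat \<sigma> e f' \<phi>"
    using FNeg.prems by (rule FNeg.IH)
  then show ?case by simp
next
  case (FExI \<phi>)
  have "fsat (case_nat t \<sigma>) e f (app_subst E k j \<phi>) \<longleftrightarrow> fsat (case_nat t \<sigma>) e f' \<phi>"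
    if "ind_term \<D> t" for t
    by (rule FExI.IH) (use that FExI.prems in \<open>simp_all split: nat.split\<close>)
  then show ?case by auto
next
  case (FExMem K \<phi>)
  have "fsat \<sigma> (case_nat v e) f (app_subst (hshift E) (hshift k) j \<phi>) \<longleftrightarrow>
      fsat \<sigma> (case_nat v e) f' \<phi>" for v
    by (rule FExMem.IH) (use FExMem.prems in simp_all)
  then show ?case by simp
next
  case (FExSub K \<phi>)
  have "fsat \<sigma> (case_nat v e) f (app_subst (hshift E) (hshift k) j \<phi>) \<longleftrightarrow>
      fsat \<sigma> (case_nat v e) f' \<phi>" for v
    by (rule FExSub.IH) (use FExSub.prems in simp_all)
  then show ?case by simp
next
  case (FExF K \<phi>)
  have "fsat \<sigma> e (case_nat g f) (app_subst E k (Suc j) \<phi>) \<longleftrightarrow> fsat \<sigma> e (case_nat g f') \<phi>" for g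
  proof (rule FExF.IH)
    show "case_nat g f' F = case_nat g f F" if "F \<noteq> Suc j" for F
      using that FExF.prems(2) by (cases F) simp_all
  qed (use FExF.prems in simp_all)
  then show ?case by simp
qed simp_all

section \<open>Validity of the FSO axioms\<close>

lemma fsat_FAllI: "fsat \<sigma> e f (FAllI \<phi>) \<longleftrightarrow> (\<forall>t. ind_term \<D> t \<longrightarrow> fsat (case_nat t \<sigma>) e f \<phi>)"
  and fsat_FImp: "fsat \<sigma> e f (FImp \<phi> \<psi>) \<longleftrightarrow> (fsat \<sigma> e f \<phi> \<longrightarrow> fsat \<sigma> e f \<psi>)"
  and fsat_FAnd: "fsat \<sigma> e f (FAnd \<phi> \<psi>) \<longleftrightarrow> fsat \<sigma> e f \<phi> \<and> fsat \<sigma> e f \<psi>"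
  and fsat_FAllMem: "fsat \<sigma> e f (FAllMem K \<phi>) \<longleftrightarrow>
    (\<forall>k. k |\<in>| elts (heval K e) \<longrightarrow> fsat \<sigma> (case_nat k e) f \<phi>)"
  by auto

lemma fsat_induction:
  assumes form: "fso_form \<D> \<phi>" and \<sigma>: "\<And>i. ind_term \<D> (\<sigma> i)" and f: "\<And>F. definable_fun (f F)"
    and root: "fsat \<sigma> e f (finst_ind Root \<phi>)"
    and step: "\<And>d. d |\<in>| elts \<D> \<Longrightarrow> fsat \<sigma> e f (FAllI (FImp \<phi>
      (fsub (case_nat (Succ d (IVar 0)) (\<lambda>i. IVar (Suc i))) HVar (\<lambda>i. i) \<phi>)))"
  shows "fsat \<sigma> e f (FAllI \<phi>)"
  unfolding fsat_FAllI
proof (intro allI impI)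
  fix t assume "ind_term \<D> t"
  then show "fsat (case_nat t \<sigma>) e f \<phi>"
  proof (rule definable_induct[where P = "\<lambda>t. fsat (case_nat t \<sigma>) e f \<phi>", rotated -1])
    show "definable (\<lambda>t. fsat (case_nat t \<sigma>) e f \<phi>)" using form \<sigma> f by (rule definable_fsat)
    show "fsat (case_nat Root \<sigma>) e f \<phi>" using root by (simp add: fsat_finst_ind)
    fix d t assume d: "d |\<in>| elts \<D>" and t: "ind_term \<D> t" and "fsat (case_nat t \<sigma>) e f \<phi>"
    then have "fsat (case_nat t \<sigma>) e f
        (fsub (case_nat (Succ d (IVar 0)) (\<lambda>i. IVar (Suc i))) HVar (\<lambda>i. i) \<phi>)"
      using step[OF d] unfolding fsat_FAllI fsat_FImp by blast
    \<comment> \<open>As \<open>d\<close> is a direction, \<open>ival\<close> keeps the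
      successor.\<close>
    moreover have "(\<lambda>i. ival (case_nat t \<sigma>) (case_nat (Succ d (IVar 0)) (\<lambda>i. IVar (Suc i)) i)) =
        case_nat (Succ d t) \<sigma>"
      using d by (simp add: fun_eq_iff split: nat.split)
    ultimately show "fsat (case_nat (Succ d t) \<sigma>) e f \<phi>" by (simp only: fsat_fsub heval.simps)
  qed
qed

text \<open>The chosen values do not vary with an Individual, so they may be chosen outside the
  theory; the graph of the resulting map is an HF-set.\<close>

lemma fsat_choice_hf:
  assumes hexp: "sk_term (hexp L K)" and prem: "fsat \<sigma> e f (FAllMem K (FExMem (hshift L) \<phi>))"
  shows "fsat \<sigma> e f (FExMem (hexp L K) (FAllMem (hshift K)
       (fsub IVar
          (case_nat (happ (HVar 1) (HVar 0)) (case_nat (HVar 0) (\<lambda>i. HVar (Suc (Suc i)))))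
          (\<lambda>i. i) \<phi>)))"
proof -
  have "\<forall>k. \<exists>l. k |\<in>| elts (heval K e) \<longrightarrow>
      l |\<in>| elts (heval L e) \<and> fsat \<sigma> (case_nat l (case_nat k e)) f \<phi>"
    using prem unfolding fsat_FAllMem by auto
  then obtain g where g: "\<And>k. k |\<in>| elts (heval K e) \<Longrightarrow>
      g k |\<in>| elts (heval L e) \<and> fsat \<sigma> (case_nat (g k) (case_nat k e)) f \<phi>"
    by metis
  define h where "h = hgraph (heval K e) g"
  have "h |\<in>| elts (heval (hexp L K) e)"
    unfolding elts_hexp[OF hexp] h_def using g by (intro hfunction_hgraph) blast
  moreover have "fsat \<sigma> (case_nat k (case_nat h e)) f
      (fsub IVar (case_nat (happ (HVar 1) (HVar 0)) (case_nat (HVar 0) (\<lambda>i. HVar (Suc (Suc i)))))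
        (\<lambda>i. i) \<phi>)" if k: "k |\<in>| elts (heval K e)" for k
  proof -
    have "(\<lambda>i. heval (case_nat (happ (HVar 1) (HVar 0)) (case_nat (HVar 0) (\<lambda>i. HVar (Suc (Suc i)))) i)
        (case_nat k (case_nat h e))) = case_nat (g k) (case_nat k e)"
      using happly_hgraph[OF k, of g] by (simp add: fun_eq_iff h_def split: nat.split)
    then show ?thesis using g[OF k] by (simp only: fsat_fsub ival.simps)
  qed
  ultimately show ?thesis by (auto simp del: One_nat_def)
qed

text \<open>The choice varies with the Individual and needs definable fibres; hence the first
  suitable member in a fixed enumeration is taken.\<close>

lemma fsat_choice_fun:
  assumes form: "fso_form \<D> \<phi>" and \<sigma>: "\<And>i. ind_term \<D> (\<sigma> i)" and f: "\<And>F. definable_fun (f F)"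
    and prem: "fsat \<sigma> e f (FAllI (FExMem K \<phi>))"
  shows "fsat \<sigma> e f
    (FExF K (FAllI (FExMem K (FAnd (FApp 0 (IVar 0) (HVar 0)) (fshift_fun \<phi>)))))"
proof -
  define P where "P t k = fsat (case_nat t \<sigma>) (case_nat k e) f \<phi>" for t k
  define g where "g t = find (P t) (members (heval K e))" for t
  have g: "\<exists>l. l |\<in>| elts (heval K e) \<and> g t = Some l \<and> P t l" if t: "ind_term \<D> t" for t
  proof -
    have "\<exists>k\<in>set (members (heval K e)). P t k"
      using prem t unfolding fsat_FAllI P_def by auto
    then have "g t \<noteq> None" by (auto simp: g_def find_None_iff)
    then obtain l where l: "g t = Some l" by blast
    then have "l \<in> set (members (heval K e)) \<and> P t l"
      unfolding g_def find_Some_iff using nth_mem by metis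
    with l show ?thesis by auto
  qed
  have "definable (\<lambda>t. g t = Some l)" for l
    unfolding g_def P_def by (intro definable_find definable_fsat form \<sigma> f)
  moreover have "finite {l. \<exists>t. ind_term \<D> t \<and> g t = Some l}"
    by (rule finite_subset[of _ "fset (elts (heval K e))"]) (use g in fastforce)+
  ultimately have "definable_fun g" by (simp add: definable_fun_def)
  moreover have "maps_into g (heval K e)" using g by (fastforce simp: maps_into_def)
  moreover have "fsat \<sigma> e (case_nat g f)
      (FAllI (FExMem K (FAnd (FApp 0 (IVar 0) (HVar 0)) (fshift_fun \<phi>))))"
    using g unfolding fsat_FAllI by (simp add: P_def)
  ultimately show ?thesis by (simp only: fsat.simps) blast
qed

text \<open>A Function is chosen outside the theory for each of the finitely many k, and these are
  merged pointwise: G(t) is the graph of k \<mapsto> \<open>g k t\<close>. The fibre of G over the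
  graph of \<open>u\<close> is a finite intersection of fibres of the \<open>g k\<close>, hence
  definable.\<close>

lemma fsat_choice_iterated:
  assumes hexp: "sk_term (hexp L K)" and \<sigma>: "\<And>i. ind_term \<D> (\<sigma> i)"
    and prem: "fsat \<sigma> e f (FAllMem K (FExF (hshift L) \<phi>))"
  shows "fsat \<sigma> e f
    (FExF (hexp L K) (FAllMem K (app_subst (hshift (hexp L K)) (HVar 0) 0 \<phi>)))"
proof -
  let ?K = "elts (heval K e)"
  have "\<forall>k. \<exists>g. k |\<in>| ?K \<longrightarrow> definable_fun g \<and> maps_into g (heval L e) \<and>
      fsat \<sigma> (case_nat k e) (case_nat g f) \<phi>"
    using prem unfolding fsat_FAllMem by auto
  then obtain g where g: "\<And>k. k |\<in>| ?K \<Longrightarrow> definable_fun (g k)"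
      "\<And>k. k |\<in>| ?K \<Longrightarrow> maps_into (g k) (heval L e)"
      "\<And>k. k |\<in>| ?K \<Longrightarrow> fsat \<sigma> (case_nat k e) (case_nat (g k) f) \<phi>"
    by metis
  have gL: "the (g k t) |\<in>| elts (heval L e) \<and> g k t = Some (the (g k t))"
    if "k |\<in>| ?K" "ind_term \<D> t" for k t
    using g(2)[OF that(1)] that(2) unfolding maps_into_def by fastforce
  define G where "G t = Some (hgraph (heval K e) (\<lambda>k. the (g k t)))" for t
  have G_in: "hgraph (heval K e) (\<lambda>k. the (g k t)) |\<in>| elts (heval (hexp L K) e)"
    if "ind_term \<D> t" for t
    unfolding elts_hexp[OF hexp] using gL that by (intro hfunction_hgraph) blast
  then have into: "maps_into G (heval (hexp L K) e)" by (simp add: maps_into_def G_def)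
  have "definable (\<lambda>t. G t = Some h)" for h
  proof (cases "\<exists>u. h = hgraph (heval K e) u")
    case True
    then obtain u where h: "h = hgraph (heval K e) u" by blast
    have "definable (\<lambda>t. \<forall>k\<in>fset ?K. g k t = Some (u k))"
      using g(1) by (intro definable_Ball) (simp_all add: definable_fun_def)
    then show ?thesis
    proof (rule definable_cong)
      fix t assume t: "ind_term \<D> t"
      have "G t = Some h \<longleftrightarrow> (\<forall>k\<in>fset ?K. the (g k t) = u k)"
        unfolding G_def h option.inject
      proof
        assume "hgraph (heval K e) (\<lambda>k. the (g k t)) = hgraph (heval K e) u"
        then show "\<forall>k\<in>fset ?K. the (g k t) = u k" using happly_hgraph by metis
      next
        assume "\<forall>k\<in>fset ?K. the (g k t) = u k"
        then show "hgraph (heval K e) (\<lambda>k. the (g k t)) = hgraph (heval K e) u"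
          unfolding hgraph_def by (auto intro!: fset.map_cong)
      qed
      moreover have "g k t = Some (u k) \<longleftrightarrow> the (g k t) = u k" if "k \<in> fset ?K" for k
        using gL[OF that t] by auto
      ultimately show "(\<forall>k\<in>fset ?K. g k t = Some (u k)) \<longleftrightarrow> G t = Some h" by simp
    qed
  next
    case False
    then show ?thesis by (intro definable_cong[OF definable_False]) (auto simp: G_def)
  qed
  moreover have "finite {h. \<exists>t. ind_term \<D> t \<and> G t = Some h}"
    by (rule finite_subset[of _ "fset (elts (heval (hexp L K) e))"])
      (use G_in in \<open>auto simp: G_def\<close>)
  ultimately have "definable_fun G" by (simp add: definable_fun_def)
  moreover have "fsat \<sigma> (case_nat k e) (case_nat G f)
      (app_subst (hshift (hexp L K)) (HVar 0) 0 \<phi>)" if k: "k |\<in>| ?K" for k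
  proof -
    have "fsat \<sigma> (case_nat k e) (case_nat G f) (app_subst (hshift (hexp L K)) (HVar 0) 0 \<phi>) \<longleftrightarrow>
        fsat \<sigma> (case_nat k e) (case_nat (g k) f) \<phi>"
    proof (rule fsat_app_subst[OF \<sigma>])
      show "case_nat (g k) f F = case_nat G f F" if "F \<noteq> 0" for F
        using that by (cases F) simp_all
      fix t l assume t: "ind_term \<D> t"
      show "case_nat (g k) f 0 t = Some l \<longleftrightarrow>
        (\<exists>h. h |\<in>| elts (heval (hshift (hexp L K)) (case_nat k e)) \<and> case_nat G f 0 t = Some h \<and>
          happly h (heval (HVar 0) (case_nat k e)) = l)"
        using G_in[OF t] gL[OF k t] by (auto simp: G_def happly_hgraph[OF k])
    qed
    then show ?thesis using g(3)[OF k] by blast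
  qed
  ultimately show ?thesis using into unfolding fsat.simps(12) fsat_FAllMem by blast
qed

text \<open>The axioms on trees and on equality of Individuals translate into MSO axioms of the same
  form and are inherited from \<open>M\<close>; the remaining axioms are checked in the
  structure.\<close>

lemma fso_axiom_sound:
  assumes "fso_axiom \<D> \<phi>" and "fso_form \<D> \<phi>"
    and \<sigma>: "\<And>i. ind_term \<D> (\<sigma> i)" and f: "\<And>F. definable_fun (f F)"
  shows "fsat \<sigma> e f \<phi>"
  using assms(1,2)
proof (cases rule: fso_axiom.cases)
  case (eq_subst t u \<psi>)
  have "mso_axiom \<D> (ftrans e \<eta> \<phi>)" for e \<eta>
    using mso_axiom.eq_subst[of \<D> t u "ftrans e \<eta> \<psi>"] unfolding eq_subst by (simp add: ftrans_finst_ind)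
  then show ?thesis using assms(2) \<sigma> f by (intro fsat_if_mso_axiom)
next
  case (hf_eq_subst K L \<psi>)
  show ?thesis unfolding hf_eq_subst fsat_FImp fsat_finst_hf by simp
next
  case (hf_eq_refl K)
  then show ?thesis by simp
next
  case (fun_eq F t K L)
  then show ?thesis by simp
next
  case (induction \<psi>)
  have form: "fso_form \<D> \<psi>"
    using assms(2) unfolding induction by (auto dest: fso_form_fsubD)
  show ?thesis unfolding induction fsat_FImp fsat_FConj
    using fsat_induction[where f = f and \<sigma> = \<sigma>, OF form \<sigma> f] by simp
next
  case hf_sets
  from sk_prov_sound[OF hf_sets(2)] have "ssat (to_sfm \<phi>) e" by simp
  then show ?thesis using fsat_hf_only[OF hf_sets(1)] by blast
next
  case (choice_hf K L \<psi>)
  then have "sk_term (hexp L K)" using assms(2) by simp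
  then show ?thesis unfolding choice_hf fsat_FImp using fsat_choice_hf by blast
next
  case (choice_fun K \<psi>)
  then have form: "fso_form \<D> \<psi>" using assms(2) by simp
  show ?thesis unfolding choice_fun fsat_FImp using fsat_choice_fun[where \<sigma> = \<sigma> and f = f, OF form \<sigma> f] by blast
next
  case (choice_iterated K L \<psi>)
  then have "sk_term (hexp L K)" using assms(2) by simp
  then show ?thesis unfolding choice_iterated fsat_FImp
    using fsat_choice_iterated[where \<sigma> = \<sigma>, OF _ \<sigma>] by blast
qed (rule fsat_if_mso_axiom[OF assms(2) \<sigma> f]; simp add: mso_axiom.intros del: One_nat_def)+

text \<open>The environments are general in the induction because elimination rules bring in new
  variables. To introduce a Function quantifier, the premise \<open>FTyped\<close> supplies the
  codomain and the assumption on \<open>f\<close> the definability.\<close>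

theorem fso_prov_sound:
  assumes "fso_prov \<D> \<Gamma> \<phi>"
    and "\<And>i. ind_term \<D> (\<sigma> i)" and "\<And>F. definable_fun (f F)"
    and "\<forall>\<gamma>\<in>set \<Gamma>. fsat \<sigma> e f \<gamma>"
  shows "fsat \<sigma> e f \<phi>"
  using assms
proof (induction arbitrary: \<sigma> e f rule: fso_prov.induct)
  case (assm \<phi> \<Gamma>)
  then show ?case by blast
next
  case (ax \<phi> \<Gamma>)
  then show ?case by (intro fso_axiom_sound)
next
  case (negI \<phi> \<Gamma> \<psi>)
  show ?case
    using negI.IH(1)[where \<sigma> = \<sigma> and e = e and f = f, OF negI.prems(1,2)] negI.IH(2)[where \<sigma> = \<sigma> and e = e and f = f, OF negI.prems(1,2)]
      negI.prems(3) by auto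
next
  case (negE \<Gamma> \<phi>)
  then show ?case using negE.IH[where \<sigma> = \<sigma> and e = e and f = f, OF negE.prems] by simp
next
  case (disjI1 \<Gamma> \<phi> \<psi>)
  then show ?case using disjI1.IH[where \<sigma> = \<sigma> and e = e and f = f, OF disjI1.prems] by simp
next
  case (disjI2 \<Gamma> \<psi> \<phi>)
  then show ?case using disjI2.IH[where \<sigma> = \<sigma> and e = e and f = f, OF disjI2.prems] by simp
next
  case (disjE \<Gamma> \<phi> \<psi> \<chi>)
  show ?case
    using disjE.IH(1)[where \<sigma> = \<sigma> and e = e and f = f, OF disjE.prems] disjE.IH(2)[where \<sigma> = \<sigma> and e = e and f = f, OF disjE.prems(1,2)]
      disjE.IH(3)[where \<sigma> = \<sigma> and e = e and f = f, OF disjE.prems(1,2)] disjE.prems(3) by auto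
next
  case (ex_indI \<Gamma> t \<phi>)
  have "fsat (case_nat (ival \<sigma> t) \<sigma>) e f \<phi>"
    using ex_indI.IH[where \<sigma> = \<sigma> and e = e and f = f, OF ex_indI.prems] by (simp add: fsat_finst_ind)
  then show ?case using ind_term_ival[where \<sigma> = \<sigma>, OF ex_indI.prems(1)] by auto
next
  case (ex_indE \<Gamma> \<phi> \<psi>)
  obtain t where t: "ind_term \<D> t" "fsat (case_nat t \<sigma>) e f \<phi>"
    using ex_indE.IH(1)[where \<sigma> = \<sigma> and e = e and f = f, OF ex_indE.prems] by auto
  have "fsat (case_nat t \<sigma>) e f (fshift_ind \<psi>)"
    by (rule ex_indE.IH(2)) (use t ex_indE.prems in \<open>simp_all split: nat.split\<close>)
  then show ?case by simp
next
  case (ex_memI \<Gamma> L K \<phi>)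
  show ?case
    using ex_memI.IH(1)[where \<sigma> = \<sigma> and e = e and f = f, OF ex_memI.prems] ex_memI.IH(2)[where \<sigma> = \<sigma> and e = e and f = f, OF ex_memI.prems]
    by (auto simp: fsat_finst_hf)
next
  case (ex_memE \<Gamma> K \<phi> \<psi>)
  obtain k where k: "k |\<in>| elts (heval K e)" "fsat \<sigma> (case_nat k e) f \<phi>"
    using ex_memE.IH(1)[where \<sigma> = \<sigma> and e = e and f = f, OF ex_memE.prems] by auto
  have "fsat \<sigma> (case_nat k e) f (fshift_hf \<psi>)"
    by (rule ex_memE.IH(2)) (use k ex_memE.prems in simp_all)
  then show ?case by simp
next
  case (ex_subI \<Gamma> L K \<phi>)
  show ?case
    using ex_subI.IH(1)[where \<sigma> = \<sigma> and e = e and f = f, OF ex_subI.prems] ex_subI.IH(2)[where \<sigma> = \<sigma> and e = e and f = f, OF ex_subI.prems]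
    by (auto simp: fsat_finst_hf)
next
  case (ex_subE \<Gamma> K \<phi> \<psi>)
  obtain k where k: "elts k |\<subseteq>| elts (heval K e)" "fsat \<sigma> (case_nat k e) f \<phi>"
    using ex_subE.IH(1)[where \<sigma> = \<sigma> and e = e and f = f, OF ex_subE.prems] by auto
  have "fsat \<sigma> (case_nat k e) f (fshift_hf \<psi>)"
    by (rule ex_subE.IH(2)) (use k ex_subE.prems in simp_all)
  then show ?case by simp
next
  case (ex_funI \<Gamma> F K \<phi>)
  show ?case
    using ex_funI.IH(1)[where \<sigma> = \<sigma> and e = e and f = f, OF ex_funI.prems] ex_funI.IH(2)[where \<sigma> = \<sigma> and e = e and f = f, OF ex_funI.prems]
      ex_funI.prems(2) by (auto simp: fsat_finst_fun fsat_FTyped)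
next
  case (ex_funE \<Gamma> K \<phi> \<psi>)
  obtain g where g: "definable_fun g" "maps_into g (heval K e)" "fsat \<sigma> e (case_nat g f) \<phi>"
    using ex_funE.IH(1)[where \<sigma> = \<sigma> and e = e and f = f, OF ex_funE.prems] by auto
  have "fsat \<sigma> e (case_nat g f) (fshift_fun \<psi>)"
    by (rule ex_funE.IH(2)) (use g ex_funE.prems in \<open>simp_all add: fsat_FTyped split: nat.split\<close>)
  then show ?case by simp
qed

end

theorem theorem3p24:
  fixes \<D> :: hf and \<phi> :: ffm
  assumes "\<D> \<noteq> hempty"
    and "fso_form \<D> \<phi>"
    and "fso_closed \<phi>"
    and "fso_prov \<D> [] \<phi>"
  shows "mso_prov \<D> [] \<lbrakk>\<phi>\<rbrakk>"
proof -
  have transl: "\<lbrakk>\<phi>\<rbrakk> = ftrans (\<lambda>_. hempty) (\<lambda>_. []) \<phi>"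
    by (simp add: translation_def transl_eq_ftrans)
  show ?thesis
  proof (rule mso_completeness)
    show "mso_form \<D> \<lbrakk>\<phi>\<rbrakk>" using assms(2) unfolding transl by (rule mso_form_ftrans)
    fix M assume "henkin \<D> M"
    then interpret henkin \<D> M .
    \<comment> \<open>Variables are themselves Individuals, so they can stand for themselves, and
      the resulting identity substitution leaves the translated formula unchanged.\<close>
    have "fsat IVar (\<lambda>_. hempty) (\<lambda>_ _. None) \<phi>"
      by (rule fso_prov_sound[OF assms(4)]) (simp_all add: definable_fun_def definable_False)
    then have "M (msub IVar (\<lambda>i. i) (ftrans (\<lambda>_. hempty) (\<lambda>_. []) \<phi>))"
      using assms(2) by (subst fsat_ftrans[symmetric]) simp_all
    then show "M \<lbrakk>\<phi>\<rbrakk>" by (simp add: transl)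
  qed
qed

end
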